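(* Let $N\ge 1$ and $\tau>0$. Assume that $\sigma\in\Omega^{2}(\mathbb{T}^{2N})$ is non-resonant in period $\tau$, that $V\in C^{\infty}(\mathbb{S}_{\tau}\times\mathbb{T}^{2N},\mathbb{R})$, and that $w\in\mathcal{P}_{\tau}^{h}(\sigma,V)$ is nondegenerate for some $h\in\pi_{1}(\mathbb{T}^{2N})$ with $h\neq 0$. Then $\#\mathcal{P}_{\tau}^{h}(\sigma,V)\geq 2$.
   Context: $\mathbb{T}^{2N}=\mathbb{R}^{2N}/\mathbb{Z}^{2N}$ with the flat metric, viewed as $\prod_{j=1}^{N}\mathbb{T}^{2}_{j}$ with $\mathbb{T}^2_j=\mathbb{T}^2=\mathbb{R}^2/\mathbb{Z}^2$ and projections $\mathtt{p}_{j}:\mathbb{T}^{2N}\to\mathbb{T}^{2}_{j}$; $\mathbb{S}_{\tau}=\mathbb{R}/\tau\mathbb{Z}$. On $T^{*}\mathbb{T}^{2N}$, with footpoint projection $\pi$ and coordinates $(x,p)$, let $\lambda=\sum_i p_i\,dx_i$ be the Liouville 1-form and $\omega_{\sigma}=d\lambda+\pi^{*}\sigma$ the magnetic symplectic form. Put $H_{V}(t,x,p)=\frac12|p|^{2}+V(t,x)$ and let $X_{\sigma,V}$ be the vector field defined by $\omega_{\sigma}(X_{\sigma,V},\cdot)=-dH_{V}$, with flow $\phi^t_{\sigma,V}$. $\mathcal{P}_{\tau}(\sigma,V)$ is the set of $w\in C^{\infty}(\mathbb{S}_{\tau},T^{*}\mathbb{T}^{2N})$ with $\partial_t w=X_{\sigma,V}(t,w)$,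 and for $h\in\mathbb{Z}^{2N}=\pi_1(\mathbb{T}^{2N})=\pi_1(T^*\mathbb{T}^{2N})$, $\mathcal{P}_{\tau}^{h}(\sigma,V)$ is the subset of those representing $h$. An element $w$ is nondegenerate if $\det(D\phi^{\tau}_{\sigma,V}(w(0))-\mathrm{Id})\neq 0$. A 2-form $a\mu$ on $\mathbb{T}^{2}$ ($\mu=dx_1\wedge dx_2$, $a\in C^\infty(\mathbb{T}^2,\mathbb{R})$) is non-resonant in period $\tau$ if there is $k\in\mathbb{Z}$ with $\frac{2\pi k}{\tau}<a(x)<\frac{2\pi(k+1)}{\tau}$ for all $x\in\mathbb{T}^{2}$. A 2-form $\sigma$ on $\mathbb{T}^{2N}$ is non-resonant in period $\tau$ if $\sigma=\sum_{j=1}^{N}\mathtt{p}_{j}^{*}\sigma_{j}$ with each $\sigma_{j}\in\Omega^{2}(\mathbb{T}^{2}_{j})$ non-resonant in period $\tau$. *)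

theory Defs
  imports "HOL-Analysis.Analysis"
begin

section \<open>Smooth maps between Euclidean spaces\<close>

primrec times_differentiable_on ::
  "nat \<Rightarrow> 'a::real_normed_vector set \<Rightarrow> ('a \<Rightarrow> 'b::real_normed_vector) \<Rightarrow> bool" where
  "times_differentiable_on 0 S f \<longleftrightarrow> continuous_on S f"
| "times_differentiable_on (Suc n) S f \<longleftrightarrow>
     (\<forall>x\<in>S. f differentiable (at x)) \<and>
     (\<forall>v. times_differentiable_on n S (\<lambda>x. frechet_derivative f (at x) v))"

text \<open>Only used for open \<open>S\<close>.\<close>

definition smooth_on :: "'a::real_normed_vector set \<Rightarrow> ('a \<Rightarrow> 'b::real_normed_vector) \<Rightarrow> bool" where
  "smooth_on S f \<longleftrightarrow> (\<forall>n. times_differentiable_on n S f)"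

section \<open>Flat tori\<close>

definition int_lattice :: "'a::euclidean_space set" where
  "int_lattice = {x. \<forall>b\<in>Basis. x \<bullet> b \<in> \<int>}"

definition lattice_rel :: "'a::euclidean_space \<Rightarrow> 'a \<Rightarrow> bool" where
  "lattice_rel x y \<longleftrightarrow> x - y \<in> int_lattice"

lemma equivp_lattice_rel: "equivp lattice_rel"
proof (rule equivpI)
  show "reflp lattice_rel"
    by (auto simp: reflp_def lattice_rel_def int_lattice_def)
  show "symp lattice_rel"
    unfolding symp_def lattice_rel_def int_lattice_def
    by (auto simp: inner_diff_left) (metis Ints_minus minus_diff_eq)
  show "transp lattice_rel"
    unfolding transp_def lattice_rel_def int_lattice_def
    by (auto simp: inner_diff_left) (metis Ints_add diff_add_cancel add_diff_eq)
qed

quotient_type (overloaded) 'a torus = "'a::euclidean_space" / lattice_rel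
  morphisms torus_rep torus_proj
  by (rule equivp_lattice_rel)

instantiation torus :: (euclidean_space) topological_space
begin

definition open_torus :: "'a torus set \<Rightarrow> bool" where
  "open_torus U \<longleftrightarrow> open (torus_proj -` U)"

instance
  by standard (auto simp: open_torus_def vimage_Union)

end

text \<open>The projection of $T^{2N}$ onto its \<open>j\<close>-th factor $T^2$.\<close>

lift_definition torus_component :: "'n::finite \<Rightarrow> (real^2^'n) torus \<Rightarrow> (real^2) torus"
  is "\<lambda>j x. x $ j"
proof -
  fix j :: 'n and x y :: "real^2^'n"
  assume "lattice_rel x y"
  then have *: "(x - y) \<bullet> axis j b \<in> \<int>" if "b \<in> Basis" for b
    using that by (auto simp: lattice_rel_def int_lattice_def Basis_vec_def)
  show "lattice_rel (x $ j) (y $ j)"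
    using * by (simp add: lattice_rel_def int_lattice_def inner_axis)
qed

definition smooth_torus_fun :: "('a::euclidean_space torus \<Rightarrow> real) \<Rightarrow> bool" where
  "smooth_torus_fun f \<longleftrightarrow> smooth_on UNIV (\<lambda>x. f (torus_proj x))"

text \<open>Functions on $(\mathbf{R}/\tau\mathbf{Z}) \times T$ are functions of real time
  that are \<open>\<tau>\<close>-periodic in time.\<close>

definition smooth_potential :: "real \<Rightarrow> (real \<Rightarrow> 'a::euclidean_space torus \<Rightarrow> real) \<Rightarrow> bool" where
  "smooth_potential \<tau> V \<longleftrightarrow>
     (\<forall>t q. V (t + \<tau>) q = V t q) \<and>
     smooth_on UNIV (\<lambda>(t, x). V t (torus_proj x))"

section \<open>Two-forms on tori and non-resonance\<close>

text \<open>The tangent bundle of the torus is trivialised by the coordinate frame.\<close>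

type_synonym 'a torus_form2 = "'a torus \<Rightarrow> 'a \<Rightarrow> 'a \<Rightarrow> real"

definition smooth_form2 :: "'a::euclidean_space torus_form2 \<Rightarrow> bool" where
  "smooth_form2 \<sigma> \<longleftrightarrow>
     (\<forall>q. bilinear (\<sigma> q)) \<and> (\<forall>q u. \<sigma> q u u = 0) \<and>
     (\<forall>u v. smooth_torus_fun (\<lambda>q. \<sigma> q u v))"

definition area_form :: "(real^2) torus_form2" where
  "area_form q u v = u $ 1 * v $ 2 - u $ 2 * v $ 1"

definition non_resonant2 :: "real \<Rightarrow> (real^2) torus_form2 \<Rightarrow> bool" where
  "non_resonant2 \<tau> s \<longleftrightarrow>
     (\<exists>a. smooth_torus_fun a \<and> (\<forall>q u v. s q u v = a q * area_form q u v) \<and>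
        (\<exists>k::int. \<forall>q. 2 * pi * real_of_int k / \<tau> < a q \<and> a q < 2 * pi * real_of_int (k + 1) / \<tau>))"

definition pullback_component :: "'n::finite \<Rightarrow> (real^2) torus_form2 \<Rightarrow> (real^2^'n) torus_form2" where
  "pullback_component j s q u v = s (torus_component j q) (u $ j) (v $ j)"

definition non_resonant :: "real \<Rightarrow> (real^2^'n::finite) torus_form2 \<Rightarrow> bool" where
  "non_resonant \<tau> \<sigma> \<longleftrightarrow>
     (\<exists>s :: 'n \<Rightarrow> (real^2) torus_form2.
        (\<forall>j. smooth_form2 (s j) \<and> non_resonant2 \<tau> (s j)) \<and>
        (\<forall>q u v. \<sigma> q u v = (\<Sum>j\<in>UNIV. pullback_component j (s j) q u v)))"

section \<open>The cotangent bundle of a torus\<close>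

text \<open>Covectors are identified with their coordinate vectors \<open>p\<close>; all tangent spaces of the
  cotangent bundle are identified with \<^typ>\<open>'a \<times> 'a\<close> through the coordinates $(x,p)$.\<close>

type_synonym 'a cotangent = "'a torus \<times> 'a"

definition cot_proj :: "'a::euclidean_space \<times> 'a \<Rightarrow> 'a cotangent" where
  "cot_proj z = (torus_proj (fst z), snd z)"

definition cot_rep :: "'a::euclidean_space cotangent \<Rightarrow> 'a \<times> 'a" where
  "cot_rep m = (torus_rep (fst m), snd m)"

text \<open>Derivatives are computed in the local coordinates given by the covering map
  \<^const>\<open>cot_proj\<close>. They do not depend on the representative or the local lift, since two
  continuous local lifts differ by a lattice translation.\<close>

definition cot_differential :: "('a::euclidean_space cotangent \<Rightarrow> real) \<Rightarrow> 'a cotangent \<Rightarrow> 'a \<times> 'a \<Rightarrow> real" where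
  "cot_differential f m = frechet_derivative (\<lambda>z. f (cot_proj z)) (at (cot_rep m))"

definition smooth_curve :: "(real \<Rightarrow> 'a::euclidean_space cotangent) \<Rightarrow> bool" where
  "smooth_curve w \<longleftrightarrow>
     (\<forall>t. \<exists>U \<gamma>. open U \<and> t \<in> U \<and> smooth_on U \<gamma> \<and> (\<forall>s\<in>U. w s = cot_proj (\<gamma> s)))"

definition has_velocity :: "(real \<Rightarrow> 'a::euclidean_space cotangent) \<Rightarrow> real \<Rightarrow> 'a \<times> 'a \<Rightarrow> bool" where
  "has_velocity w t A \<longleftrightarrow>
     (\<exists>U \<gamma>. open U \<and> t \<in> U \<and> (\<forall>s\<in>U. w s = cot_proj (\<gamma> s)) \<and>
        (\<gamma> has_vector_derivative A) (at t))"

definition has_tangent_map ::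
  "('a::euclidean_space cotangent \<Rightarrow> 'a cotangent) \<Rightarrow> 'a cotangent \<Rightarrow> ('a \<times> 'a \<Rightarrow> 'a \<times> 'a) \<Rightarrow> bool" where
  "has_tangent_map F m D \<longleftrightarrow>
     (\<exists>U G. open U \<and> cot_rep m \<in> U \<and> (\<forall>z\<in>U. F (cot_proj z) = cot_proj (G z)) \<and>
        (G has_derivative D) (at (cot_rep m)))"

definition tangent_map ::
  "('a::euclidean_space cotangent \<Rightarrow> 'a cotangent) \<Rightarrow> 'a cotangent \<Rightarrow> 'a \<times> 'a \<Rightarrow> 'a \<times> 'a" where
  "tangent_map F m = (THE D. has_tangent_map F m D)"

section \<open>Magnetic Hamiltonian dynamics\<close>

definition liouville_form :: "'a::euclidean_space cotangent \<Rightarrow> 'a \<times> 'a \<Rightarrow> real" where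
  "liouville_form m A = snd m \<bullet> fst A"

text \<open>Exterior derivative of a 1-form, evaluated on constant coordinate vector fields
  (whose Lie bracket vanishes).\<close>

definition ext_deriv1 ::
  "('a::euclidean_space cotangent \<Rightarrow> 'a \<times> 'a \<Rightarrow> real) \<Rightarrow> 'a cotangent \<Rightarrow> 'a \<times> 'a \<Rightarrow> 'a \<times> 'a \<Rightarrow> real" where
  "ext_deriv1 \<alpha> m A B =
     cot_differential (\<lambda>m'. \<alpha> m' B) m A - cot_differential (\<lambda>m'. \<alpha> m' A) m B"

definition magnetic_form ::
  "'a::euclidean_space torus_form2 \<Rightarrow> 'a cotangent \<Rightarrow> 'a \<times> 'a \<Rightarrow> 'a \<times> 'a \<Rightarrow> real" where
  "magnetic_form \<sigma> m A B = ext_deriv1 liouville_form m A B + \<sigma> (fst m) (fst A) (fst B)"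

definition hamiltonian :: "(real \<Rightarrow> 'a::euclidean_space torus \<Rightarrow> real) \<Rightarrow> real \<Rightarrow> 'a cotangent \<Rightarrow> real" where
  "hamiltonian V t m = (norm (snd m))\<^sup>2 / 2 + V t (fst m)"

definition magnetic_field ::
  "'a::euclidean_space torus_form2 \<Rightarrow> (real \<Rightarrow> 'a torus \<Rightarrow> real) \<Rightarrow> real \<Rightarrow> 'a cotangent \<Rightarrow> 'a \<times> 'a" where
  "magnetic_field \<sigma> V t m =
     (THE A. \<forall>B. magnetic_form \<sigma> m A B = - cot_differential (hamiltonian V t) m B)"

definition integral_curve ::
  "'a::euclidean_space torus_form2 \<Rightarrow> (real \<Rightarrow> 'a torus \<Rightarrow> real) \<Rightarrow> (real \<Rightarrow> 'a cotangent) \<Rightarrow> bool" where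
  "integral_curve \<sigma> V w \<longleftrightarrow> (\<forall>t. has_velocity w t (magnetic_field \<sigma> V t (w t)))"

text \<open>The flow starts at time \<open>0\<close>. It is complete: the magnetic force does not change \<open>|p|\<close>
  and the force of the potential is bounded.\<close>

definition magnetic_flow ::
  "'a::euclidean_space torus_form2 \<Rightarrow> (real \<Rightarrow> 'a torus \<Rightarrow> real) \<Rightarrow> real \<Rightarrow> 'a cotangent \<Rightarrow> 'a cotangent" where
  "magnetic_flow \<sigma> V t m = (THE w. integral_curve \<sigma> V w \<and> w 0 = m) t"

text \<open>Maps on $\mathbf{R}/\tau\mathbf{Z}$ are \<open>\<tau>\<close>-periodic maps on the real line.\<close>

definition periodic_orbits ::
  "real \<Rightarrow> 'a::euclidean_space torus_form2 \<Rightarrow> (real \<Rightarrow> 'a torus \<Rightarrow> real) \<Rightarrow> (real \<Rightarrow> 'a cotangent) set" where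
  "periodic_orbits \<tau> \<sigma> V =
     {w. (\<forall>t. w (t + \<tau>) = w t) \<and> smooth_curve w \<and> integral_curve \<sigma> V w}"

text \<open>The lattice vector \<open>h\<close> corresponds to the class of the loop $s \mapsto s h$. As the
  fundamental group is abelian, based and free homotopy classes agree.\<close>

definition represents :: "real \<Rightarrow> 'a::euclidean_space \<Rightarrow> (real \<Rightarrow> 'a cotangent) \<Rightarrow> bool" where
  "represents \<tau> h w \<longleftrightarrow>
     homotopic_loops UNIV (\<lambda>s. w (\<tau> * s)) (\<lambda>s. cot_proj (s *\<^sub>R h, 0))"

definition periodic_orbits_in ::
  "real \<Rightarrow> 'a::euclidean_space \<Rightarrow> 'a torus_form2 \<Rightarrow> (real \<Rightarrow> 'a torus \<Rightarrow> real) \<Rightarrow> (real \<Rightarrow> 'a cotangent) set" where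
  "periodic_orbits_in \<tau> h \<sigma> V = {w \<in> periodic_orbits \<tau> \<sigma> V. represents \<tau> h w}"

text \<open>Coordinate frame $\partial_{x_i}, \partial_{p_i}$ of the cotangent bundle of $T^{2N}$.\<close>

fun coord_frame :: "('n::finite \<times> 2) + ('n \<times> 2) \<Rightarrow> (real^2^'n) \<times> (real^2^'n)" where
  "coord_frame (Inl (j, i)) = (axis j (axis i 1), 0)"
| "coord_frame (Inr (j, i)) = (0, axis j (axis i 1))"

definition coord_matrix ::
  "((real^2^'n::finite) \<times> (real^2^'n) \<Rightarrow> (real^2^'n) \<times> (real^2^'n)) \<Rightarrow>
   real^(('n \<times> 2) + ('n \<times> 2))^(('n \<times> 2) + ('n \<times> 2))" where
  "coord_matrix D = (\<chi> k l. D (coord_frame l) \<bullet> coord_frame k)"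

definition nondegenerate ::
  "real \<Rightarrow> (real^2^'n::finite) torus_form2 \<Rightarrow> (real \<Rightarrow> (real^2^'n) torus \<Rightarrow> real) \<Rightarrow>
   (real \<Rightarrow> (real^2^'n) cotangent) \<Rightarrow> bool" where
  "nondegenerate \<tau> \<sigma> V w \<longleftrightarrow>
     det (coord_matrix (tangent_map (magnetic_flow \<sigma> V \<tau>) (w 0)) - mat 1) \<noteq> 0"

end

(* On the universal cover the flow satisfies x' = p, and a momentum component in one factor obeys a
   planar equation p_j' = -i a_j p_j - (force). Removing the rotation by the angle theta = integral of
   a_j and using p(tau) = p(0) bounds p_j(0) by the force divided by |exp(i theta) - 1|, and
   non-resonance keeps theta away from the multiples of 2 pi. The bound does not involve the
   displacement x(tau) - x(0), so the lattice-periodic map G = flow^tau - id has no zeros of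
   G = (h + s h, 0) for large s, while all these zeros for s >= 0 stay in a compact part of
   T^k x R^k. Hence the degree of G = (h, 0) vanishes, whereas a nondegenerate solution contributes
   +1 or -1: there must be a second one. *)

theory Submission
  imports Defs "HOL-Homology.Homology"
begin

section \<open>Homotopies of maps with a regular zero\<close>

text \<open>Zeros are counted on the cotangent bundle of a torus, which is neither compact nor a
  Euclidean space. The missing compactness is in the momentum. Moving the target only along
  \<open>(h, 0)\<close> keeps its momentum component equal to zero, so every equation met during the
  deformation still says that the momentum returns after time \<tau>. The momentum bound therefore
  holds at all stages, not just for the orbits in the class of \<open>h\<close>, and it bounds the
  displacement as well: a solution with bounded initial momentum has bounded speed on one period.
  The torus directions are absorbed by viewing each circle times a line as a punctured plane. On an
  open subset of a Euclidean space no integer degree has to be defined: a regular zero induces an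
  injective map on local homology, a map without zeros kills every class coming from the whole
  domain, and a homotopy whose zeros stay in one compact set identifies the two maps on the class of
  a large ball. Orbits, velocities and the tangent map are defined on the quotient through local
  lifts, so they are first transported to the universal cover, where the flow is
  constructed.\<close>

lemma homotopic_withI_euclidean:
  fixes h :: "real \<times> 'a::topological_space \<Rightarrow> 'b::topological_space"
  assumes "continuous_on ({0..1} \<times> U) h" "h \<in> {0..1} \<times> U \<rightarrow> V"
    and "\<And>t. t \<in> {0..1} \<Longrightarrow> P (\<lambda>x. h (t, x))"
  shows "homotopic_with P (top_of_set U) (top_of_set V) (\<lambda>x. h (0, x)) (\<lambda>x. h (1, x))"
proof -
  have eq: "prod_topology (top_of_set {0..1::real}) (top_of_set U) = top_of_set ({0..1} \<times> U)"
    by (metis prod_topology_subtopology_eu)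
  show ?thesis
    unfolding homotopic_with_def eq
    by (rule exI[of _ h]) (use assms in \<open>auto simp: image_subset_iff_funcset\<close>)
qed

section \<open>Excision and the local homology of a Euclidean space at a point\<close>

text \<open>The excised set is the complement of \<open>U\<close>: it is closed and lies in the open
  set \<open>- Z\<close>.\<close>

lemma iso_excision_open:
  fixes U :: "'a::topological_space set"
  assumes "open U" "closed Z" "Z \<subseteq> U"
  shows "hom_induced p (top_of_set U) (U - Z) euclidean (- Z) id
    \<in> iso (relative_homology_group p (top_of_set U) (U - Z)) (relative_homology_group p euclidean (- Z))"
proof -
  have "euclidean closure_of (- U) \<subseteq> euclidean interior_of (- Z)"
    using assms by (simp add: closed_Compl interior_open open_Compl)
  then have "hom_induced p (subtopology euclidean (UNIV - - U)) ((- Z) - (- U)) (subtopology euclidean UNIV) (- Z) id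
    \<in> iso (relative_homology_group p (subtopology euclidean (UNIV - - U)) ((- Z) - (- U)))
          (relative_homology_group p (subtopology euclidean UNIV) (- Z))"
    by (rule homology_excision_axiom) auto
  moreover have "UNIV - - U = U" "(- Z) - (- U) = U - Z" by auto
  ultimately show ?thesis by simp
qed

text \<open>Here \<open>U - B\<close> is excised: it is closed in \<open>U\<close> because
  \<open>B\<close> is open, it avoids \<open>a\<close>, and \<open>U - {a}\<close> is open in
  \<open>U\<close> because points are closed.\<close>

lemma iso_excision_open_subset:
  fixes U B :: "'a::t1_space set"
  assumes "open U" "open B" "B \<subseteq> U" "a \<in> B"
  shows "hom_induced p (top_of_set B) (B - {a}) (top_of_set U) (U - {a}) id
    \<in> iso (relative_homology_group p (top_of_set B) (B - {a})) (relative_homology_group p (top_of_set U) (U - {a}))"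
proof -
  have op: "openin (top_of_set U) (U - {a})"
    using assms by (auto simp: open_openin_trans openin_open_eq open_delete)
  have "top_of_set U closure_of (U - B) \<subseteq> U - B"
    by (rule closure_of_minimal) (use assms in \<open>auto simp: closedin_def openin_open_eq Diff_Diff_Int Int_absorb1\<close>)
  moreover have "top_of_set U interior_of (U - {a}) = U - {a}"
    using op by (simp add: interior_of_openin)
  ultimately have "top_of_set U closure_of (U - B) \<subseteq> top_of_set U interior_of (U - {a})"
    using assms by auto
  then have "hom_induced p (subtopology (top_of_set U) (U - (U - B))) ((U - {a}) - (U - B)) (subtopology (top_of_set U) U) (U - {a}) id
    \<in> iso (relative_homology_group p (subtopology (top_of_set U) (U - (U - B))) ((U - {a}) - (U - B)))
          (relative_homology_group p (subtopology (top_of_set U) U) (U - {a}))"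
    by (rule homology_excision_axiom) auto
  moreover have "U - (U - B) = B" "(U - {a}) - (U - B) = B - {a}" "U \<inter> B = B"
    using assms by auto
  ultimately show ?thesis by (simp add: subtopology_subtopology)
qed

text \<open>\<open>f\<close> moves every point away from \<open>a\<close> by \<open>R\<close> along
  its ray, the intermediate maps by \<open>(1 - t) * R\<close>. Distances to \<open>a\<close> never
  decrease, so the exterior of the ball is preserved throughout while the punctured space is
  deformed into it.\<close>

lemma homotopic_with_radial_push:
  fixes a :: "'a::euclidean_space" and R :: real
  assumes "R > 0"
  defines "f \<equiv> \<lambda>x. a + (1 + R / norm (x - a)) *\<^sub>R (x - a)"
  shows "homotopic_with (\<lambda>k. k ` (- cball a R) \<subseteq> - cball a R) (top_of_set (-{a})) (top_of_set (-{a})) f id"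
    and "continuous_map (top_of_set (-{a})) (subtopology (top_of_set (-{a})) (- cball a R)) f"
proof -
  let ?h = "\<lambda>(t::real, x). a + (1 + (1 - t) * R / norm (x - a)) *\<^sub>R (x - a)"
  have nrm: "norm (?h (t, x) - a) = norm (x - a) + (1 - t) * R" if "t \<in> {0..1}" "x \<noteq> a" for t x
  proof -
    have "norm (?h (t, x) - a) = \<bar>1 + (1 - t) * R / norm (x - a)\<bar> * norm (x - a)" by simp
    also have "\<bar>1 + (1 - t) * R / norm (x - a)\<bar> = 1 + (1 - t) * R / norm (x - a)"
      using that assms by (intro abs_of_nonneg) (auto intro!: add_nonneg_nonneg divide_nonneg_nonneg mult_nonneg_nonneg)
    finally show ?thesis using that by (simp add: distrib_right)
  qed
  have cont: "continuous_on ({0..1} \<times> (-{a})) ?h"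
    unfolding case_prod_unfold by (intro continuous_intros) auto
  have "homotopic_with (\<lambda>k. k ` (- cball a R) \<subseteq> - cball a R) (top_of_set (-{a})) (top_of_set (-{a}))
     (\<lambda>x. ?h (0, x)) (\<lambda>x. ?h (1, x))"
  proof (rule homotopic_withI_euclidean[OF cont])
    show "?h \<in> {0..1} \<times> (-{a}) \<rightarrow> -{a}"
    proof
      fix z :: "real \<times> 'a" assume z: "z \<in> {0..1} \<times> (-{a})"
      then have "fst z \<in> {0..1}" "snd z \<noteq> a" by auto
      then have "norm (?h (fst z, snd z) - a) > 0"
        using assms nrm[of "fst z" "snd z"] by (smt (verit) atLeastAtMost_iff mult_nonneg_nonneg zero_less_norm_iff right_minus_eq)
      then show "?h z \<in> -{a}" by auto
    qed
    fix t :: real assume t: "t \<in> {0..1}"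
    show "(\<lambda>x. ?h (t, x)) ` (- cball a R) \<subseteq> - cball a R"
    proof (rule image_subsetI)
      fix x assume x: "x \<in> - cball a R"
      then have "x \<noteq> a" using assms by auto
      then have "norm (?h (t, x) - a) \<ge> norm (x - a)" using nrm t assms by auto
      then show "?h (t, x) \<in> - cball a R" using x by (simp add: dist_norm norm_minus_commute)
    qed
  qed
  moreover have "(\<lambda>x. ?h (0, x)) = f" "(\<lambda>x. ?h (1, x)) = id" by (auto simp: f_def)
  ultimately show "homotopic_with (\<lambda>k. k ` (- cball a R) \<subseteq> - cball a R) (top_of_set (-{a})) (top_of_set (-{a})) f id"
    by simp
  have "norm (f x - a) > R" if "x \<noteq> a" for x
    using nrm[of 0 x] that by (simp add: f_def)
  then have fim: "f ` (-{a}) \<subseteq> - cball a R" by (fastforce simp: dist_norm norm_minus_commute)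
  have "continuous_on (-{a}) f" unfolding f_def by (intro continuous_intros) auto
  then show "continuous_map (top_of_set (-{a})) (subtopology (top_of_set (-{a})) (- cball a R)) f"
    using fim assms by (auto simp: continuous_map_in_subtopology)
qed

text \<open>In the exact sequence of the triple (space, punctured space, exterior of the ball) the
  groups on both sides of the inclusion are relative groups of the punctured space modulo the
  exterior, and the radial push makes them trivial.\<close>

lemma iso_complement_ball_complement_point:
  fixes a :: "'a::euclidean_space"
  assumes "R > 0"
  shows "hom_induced p euclidean (- cball a R) euclidean (-{a}) id
    \<in> iso (relative_homology_group p euclidean (- cball a R)) (relative_homology_group p euclidean (-{a}))"
proof (rule very_short_exact_sequence)
  have sub: "- cball a R \<subseteq> -{a}" using assms by auto
  show "exact_seq
         ([relative_homology_group(p - 1) (subtopology euclidean (-{a})) (- cball a R), relative_homology_group p euclidean (-{a}),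
           relative_homology_group p euclidean (- cball a R), relative_homology_group p (subtopology euclidean (-{a})) (- cball a R)],
          [hom_relboundary p euclidean (-{a}) (- cball a R), hom_induced p euclidean (- cball a R) euclidean (-{a}) id,
           hom_induced p (subtopology euclidean (-{a})) (- cball a R) euclidean (- cball a R) id])"
    using homology_exactness_triple_1 [OF sub] homology_exactness_triple_3 [OF sub] by fastforce
  show "trivial_group (relative_homology_group p (subtopology euclidean (-{a})) (- cball a R))"
    "trivial_group (relative_homology_group (p - 1) (subtopology euclidean (-{a})) (- cball a R))"
    using trivial_relative_homology_group_alt[OF homotopic_with_radial_push(2,1)[OF assms, of a]] by auto
qed

text \<open>The space is contractible, so this group is the reduced homology of the punctured space
  one degree lower; the punctured space has the homotopy type of a sphere, and the degree is the
  dimension of that sphere.\<close>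

lemma nontrivial_local_homology:
  fixes a :: "'a::euclidean_space"
  shows "\<not> trivial_group (relative_homology_group (int DIM('a)) (euclidean :: 'a topology) (-{a}))"
proof -
  have [simp]: "int (DIM('a) - Suc 0) = int DIM('a) - 1" using DIM_positive[where 'a='a] by linarith
  obtain f g where "homeomorphic_maps (nsphere (DIM('a) - 1)) (top_of_set (sphere (0::'a) 1 \<inter> span Basis)) f g"
    by (rule homeomorphic_maps_nsphere_euclidean_sphere[OF independent_Basis orthogonal_Basis refl]) auto
  then have "nsphere (DIM('a) - 1) homeomorphic_space (top_of_set (sphere (0::'a) 1))"
    by (auto simp: homeomorphic_space_def)
  then have 1: "nsphere (DIM('a) - 1) homotopy_equivalent_space (top_of_set (sphere (0::'a) 1))"
    by (rule homeomorphic_imp_homotopy_equivalent_space)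
  have "sphere (0::'a) 1 homotopy_eqv sphere a 1" by (simp add: homeomorphic_imp_homotopy_eqv homeomorphic_spheres)
  also have "sphere a 1 homotopy_eqv - {a}"
    using homotopy_eqv_rel_frontier_punctured_affine_hull[of "cball a 1" a]
    by (simp add: Compl_eq_Diff_UNIV affine_hull_nonempty_interior mem_rel_interior_cball) (metis order_refl zero_less_one)
  finally have 2: "top_of_set (sphere (0::'a) 1) homotopy_equivalent_space top_of_set (-{a})" .
  have "\<not> trivial_group (reduced_homology_group (int DIM('a) - 1) (nsphere (DIM('a) - 1)))"
    by (simp add: trivial_reduced_homology_group_nsphere)
  moreover have "reduced_homology_group (int DIM('a) - 1) (nsphere (DIM('a) - 1)) \<cong> reduced_homology_group (int DIM('a) - 1) (top_of_set (-{a}))"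
    using homotopy_equivalent_space_imp_isomorphic_reduced_homology_groups[OF homotopy_eqv_trans[OF 1 2]] by blast
  ultimately have nt: "\<not> trivial_group (reduced_homology_group (int DIM('a) - 1) (top_of_set (-{a})))"
    by (subst (asm) isomorphic_group_triviality) auto
  have cs: "contractible_space (euclidean :: 'a topology)"
    using convex_imp_contractible[of "UNIV::'a set"] contractible_space_top_of_set[of "UNIV::'a set"] by (metis convex_UNIV subtopology_UNIV)
  have "- {a} \<noteq> {}"
  proof -
    obtain b :: 'a where "b \<in> Basis" using nonempty_Basis by blast
    then have "a + b \<in> - {a}" by auto
    then show ?thesis by blast
  qed
  then have "relative_homology_group (int DIM('a)) (euclidean :: 'a topology) (-{a}) \<cong>
            reduced_homology_group (int DIM('a) - 1) (subtopology euclidean (-{a}))"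
    using isomorphic_group_relative_homology_of_contractible[OF cs, of "-{a}" "int DIM('a)"] by simp
  then show ?thesis using nt by (subst isomorphic_group_triviality) auto
qed

section \<open>Regular zeros and maps without zeros\<close>

text \<open>Excision shrinks \<open>U\<close> to a ball \<open>D\<close> on which the segment from
  \<open>f\<close> to its affine part \<open>g\<close> avoids \<open>0\<close> away from
  \<open>u0\<close>. As \<open>A\<close> is an injective linear endomorphism, \<open>g\<close> is a
  homeomorphism of the whole space and induces an isomorphism. Working with injectivity makes
  orientations and signs unnecessary.\<close>

lemma inj_on_hom_induced_local_zero:
  fixes f :: "'a::euclidean_space \<Rightarrow> 'a"
  assumes "open U" "u0 \<in> U" "continuous_on U f"
    and zero: "\<And>u. u \<in> U \<Longrightarrow> f u = 0 \<longleftrightarrow> u = u0"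
    and deriv: "(f has_derivative A) (at u0)" and "inj A"
  shows "inj_on (hom_induced p (top_of_set U) (U - {u0}) euclidean (-{0}) f)
    (carrier (relative_homology_group p (top_of_set U) (U - {u0})))"
proof -
  have linA: "linear A" using deriv by (rule has_derivative_linear)
  then obtain B where B: "B > 0" "\<And>x. B * norm x \<le> norm (A x)"
    using linear_inj_bounded_below_pos[OF linA \<open>inj A\<close>] by metis
  have f0: "f u0 = 0" using zero assms by blast
  \<comment> \<open>Half of the lower bound \<open>B\<close>: the error is at most half of the
    linear part, so no convex combination of \<open>f\<close> and \<open>g\<close> vanishes.\<close>
  obtain d where d: "d > 0" "\<And>u. norm (u - u0) < d \<Longrightarrow> norm (f u - f u0 - A (u - u0)) \<le> B / 2 * norm (u - u0)"
    using deriv B(1) unfolding has_derivative_at_alt by (meson half_gt_zero)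
  obtain r where r: "r > 0" "ball u0 r \<subseteq> U" using assms open_contains_ball by blast
  define D where "D = ball u0 (min d r)"
  have D: "open D" "D \<subseteq> U" "u0 \<in> D" using d r by (auto simp: D_def)
  define g where "g = (\<lambda>u. A (u - u0))"
  have contA: "continuous_on S A" for S using linA by (simp add: linear_continuous_on linear_conv_bounded_linear)
  have contg: "continuous_on S g" for S unfolding g_def
    by (intro continuous_on_compose2[OF contA[of UNIV]] continuous_intros) auto
  have homot: "homotopic_with (\<lambda>h. h \<in> (D - {u0}) \<rightarrow> -{0}) (top_of_set D) euclidean f g"
  proof -
    let ?h = "\<lambda>(t::real, x). (1 - t) *\<^sub>R f x + t *\<^sub>R g x"
    have "continuous_on ({0..1} \<times> D) (\<lambda>z. f (snd z))" "continuous_on ({0..1::real} \<times> D) (\<lambda>z. g (snd z))"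
      by (rule continuous_on_compose2[OF _ continuous_on_snd[OF continuous_on_id]]; use assms D contg in \<open>force intro: continuous_on_subset\<close>)+
    then have cont: "continuous_on ({0..1} \<times> D) ?h"
      unfolding case_prod_unfold by (intro continuous_intros)
    have "homotopic_with (\<lambda>h. h \<in> (D - {u0}) \<rightarrow> -{0}) (top_of_set D) (top_of_set UNIV) (\<lambda>x. ?h (0,x)) (\<lambda>x. ?h (1,x))"
    proof (rule homotopic_withI_euclidean[OF cont])
      fix t :: real assume t: "t \<in> {0..1}"
      show "(\<lambda>x. ?h (t, x)) \<in> (D - {u0}) \<rightarrow> - {0}"
      proof
        fix x assume x: "x \<in> D - {u0}"
        have 1: "norm (f x - g x) \<le> B / 2 * norm (x - u0)"
          using d(2)[of x] x f0 by (simp add: D_def g_def dist_norm norm_minus_commute)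
        have 2: "norm (g x) \<ge> B * norm (x - u0)" using B(2)[of "x - u0"] by (simp add: g_def mult.commute)
        have "norm (g x) \<le> norm (?h (t, x)) + norm ((1 - t) *\<^sub>R (f x - g x))"
          by (rule order_trans[OF _ norm_triangle_ineq4]) (simp add: algebra_simps)
        also have "norm ((1 - t) *\<^sub>R (f x - g x)) \<le> norm (f x - g x)"
          using t by (simp add: mult_left_le_one_le)
        finally have "norm (?h (t, x)) \<ge> B / 2 * norm (x - u0)" using 1 2 by simp
        moreover have "B / 2 * norm (x - u0) > 0" using B x by simp
        ultimately show "?h (t, x) \<in> -{0}" by auto
      qed
    qed auto
    then show ?thesis by simp
  qed
  let ?G = "relative_homology_group p (top_of_set D) (D - {u0})"
  have "hom_induced p (top_of_set D) (D - {u0}) euclidean (-{0}) g \<in> iso ?G (relative_homology_group p euclidean (-{0}))"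
  proof -
    have bij: "bij g"
    proof -
      have "bij A" using linA \<open>inj A\<close> linear_injective_imp_surjective by (auto simp: bij_def)
      moreover have "bij (\<lambda>u. u - u0)" by (metis bij_plus_right diff_conv_add_uminus ext)
      ultimately show ?thesis unfolding g_def using bij_comp[of "\<lambda>u. u - u0" A] by (simp add: o_def)
    qed
    have "g ` (-{u0}) = -{0}"
      using bij_image_Compl_eq[OF bij, of "{u0}"] linA by (simp add: g_def linear_0)
    moreover obtain k where "homeomorphism UNIV UNIV g k"
    proof -
      obtain A' where A': "linear A'" "\<And>x. A' (A x) = x" "\<And>x. A (A' x) = x"
        using linear_injective_isomorphism linA \<open>inj A\<close> by metis
      have "homeomorphism UNIV UNIV g (\<lambda>y. A' y + u0)"
      proof (rule homeomorphismI)
        show "continuous_on UNIV (\<lambda>y. A' y + u0)"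
          using A'(1) by (intro continuous_intros linear_continuous_on) (simp add: linear_conv_bounded_linear)
      qed (use A' contg in \<open>auto simp: g_def\<close>)
      then show ?thesis using that by blast
    qed
    then have "homeomorphic_maps (top_of_set UNIV) (top_of_set UNIV) g k"
      by (simp only: homeomorphic_maps_iff_homeomorphism)
    then have "homeomorphic_map euclidean euclidean g"
      by (simp add: homeomorphic_maps_map)
    ultimately have i1: "hom_induced p euclidean (-{u0}) euclidean (-{0}) g \<in> iso (relative_homology_group p euclidean (-{u0})) (relative_homology_group p euclidean (-{0}))"
      by (intro homeomorphic_map_relative_homology_iso) auto
    have "hom_induced p (top_of_set D) (D - {u0}) euclidean (-{u0}) id \<in> iso ?G (relative_homology_group p euclidean (-{u0}))"
      using iso_excision_open[of D "{u0}"] D by auto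
    from iso_set_trans[OF this i1] show ?thesis
      using \<open>g ` (-{u0}) = -{0}\<close> contg
      by (subst (asm) hom_induced_compose[symmetric]) auto
  qed
  then have injD: "inj_on (hom_induced p (top_of_set D) (D - {u0}) euclidean (-{0}) f) (carrier ?G)"
    unfolding homology_homotopy_axiom[OF homot] by (simp add: iso_def bij_betw_def)
  have exc: "hom_induced p (top_of_set D) (D - {u0}) (top_of_set U) (U - {u0}) id
    \<in> iso ?G (relative_homology_group p (top_of_set U) (U - {u0}))"
    by (rule iso_excision_open_subset) (use assms D in auto)
  have comp: "hom_induced p (top_of_set U) (U - {u0}) euclidean (-{0}) f (hom_induced p (top_of_set D) (D - {u0}) (top_of_set U) (U - {u0}) id c)
     = hom_induced p (top_of_set D) (D - {u0}) euclidean (-{0}) f c" for c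
    using D assms zero by (subst hom_induced_compose') auto
  show ?thesis
  proof (rule inj_onI)
    fix x y assume x: "x \<in> carrier (relative_homology_group p (top_of_set U) (U - {u0}))"
      and y: "y \<in> carrier (relative_homology_group p (top_of_set U) (U - {u0}))"
      and eq: "hom_induced p (top_of_set U) (U - {u0}) euclidean (- {0}) f x = hom_induced p (top_of_set U) (U - {u0}) euclidean (- {0}) f y"
    let ?j = "hom_induced p (top_of_set D) (D - {u0}) (top_of_set U) (U - {u0}) id"
    have im: "?j ` carrier ?G = carrier (relative_homology_group p (top_of_set U) (U - {u0}))"
      using exc by (simp add: iso_def bij_betw_def)
    obtain x' where x': "x' \<in> carrier ?G" "x = ?j x'" using x unfolding im[symmetric] by blast
    obtain y' where y': "y' \<in> carrier ?G" "y = ?j y'" using y unfolding im[symmetric] by blast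
    have "x' = y'" using eq unfolding x'(2) y'(2) comp by (rule inj_onD[OF injD _ x'(1) y'(1)])
    then show "x = y" by (simp only: x'(2) y'(2))
  qed
qed

text \<open>The image \<open>d\<close> in \<open>H(U, U - Z)\<close> of a generator of the homology of the complement of a large ball
  is killed by \<open>F (1, _)\<close>, which maps \<open>U\<close> into the complement of \<open>0\<close>, but not by the homotopic map
  \<open>F (0, _)\<close>, which is injective on \<open>H(U, U - {u0})\<close>.\<close>

theorem no_isolated_regular_zero_if_homotopic_nonvanishing:
  fixes F :: "real \<times> 'a::euclidean_space \<Rightarrow> 'a"
  assumes "open U" "compact Z" "Z \<subseteq> U" and contF: "continuous_on ({0..1} \<times> U) F"
    and FZ: "\<And>s u. s \<in> {0..1} \<Longrightarrow> u \<in> U \<Longrightarrow> F (s, u) = 0 \<Longrightarrow> u \<in> Z"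
    and F1: "\<And>u. u \<in> U \<Longrightarrow> F (1, u) \<noteq> 0"
    and u0: "u0 \<in> U" and F0: "\<And>u. u \<in> U \<Longrightarrow> F (0, u) = 0 \<longleftrightarrow> u = u0"
    and deriv: "((\<lambda>u. F (0, u)) has_derivative A) (at u0)" and "inj A"
  shows False
proof -
  let ?m = "int DIM('a)" and ?f0 = "\<lambda>u. F (0, u)" and ?f1 = "\<lambda>u. F (1, u)"
  let ?E = "euclidean :: 'a topology"
  have u0Z: "u0 \<in> Z" using FZ[of 0 u0] F0[of u0] u0 by simp
  \<comment> \<open>The ball contains \<open>Z\<close>, so its exterior lies in \<open>- Z\<close>
    and in \<open>-{u0}\<close>, and one class of the exterior can be pushed into both pairs.
    \<open>max R 1\<close> makes the radius positive.\<close>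
  obtain R where R: "R > 0" "Z \<subseteq> cball u0 R"
  proof -
    obtain R where "\<forall>z\<in>Z. dist u0 z \<le> R" 
      using compact_imp_bounded[OF \<open>compact Z\<close>] bounded_any_center by blast
    then have "Z \<subseteq> cball u0 (max R 1)" by force
    then show ?thesis using that[of "max R 1"] by simp
  qed
  have cont: "continuous_on U ?f0" "continuous_on U ?f1"
    by (rule continuous_on_compose2[OF contF]; force intro!: continuous_intros)+
  let ?B = "- cball u0 R"
  let ?HB = "relative_homology_group ?m ?E ?B" and ?H0 = "relative_homology_group ?m ?E (-{u0})"
  obtain c where c: "c \<in> carrier ?HB" "hom_induced ?m ?E ?B ?E (-{u0}) id c \<noteq> \<one>\<^bsub>?H0\<^esub>"
  proof -
    obtain y where y: "y \<in> carrier ?H0" "y \<noteq> \<one>\<^bsub>?H0\<^esub>"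
    proof -
      have "carrier ?H0 \<noteq> {\<one>\<^bsub>?H0\<^esub>}"
        using nontrivial_local_homology[of u0] by (simp add: trivial_group_def)
      moreover have "\<one>\<^bsub>?H0\<^esub> \<in> carrier ?H0"
        by (rule monoid.one_closed) (simp add: group.is_monoid)
      ultimately show ?thesis using that by blast
    qed
    then have "y \<in> hom_induced ?m ?E ?B ?E (-{u0}) id ` carrier ?HB"
      using iso_complement_ball_complement_point[OF R(1), where a=u0 and p="?m"] by (simp add: iso_def bij_betw_def)
    then obtain c where "c \<in> carrier ?HB" "y = hom_induced ?m ?E ?B ?E (-{u0}) id c" by blast
    with y(2) show ?thesis using that by metis
  qed
  let ?HU = "relative_homology_group ?m (top_of_set U) (U - Z)"
  have cZ: "hom_induced ?m ?E ?B ?E (-Z) id c \<in> carrier (relative_homology_group ?m ?E (-Z))"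
    by (rule hom_induced_carrier)
  have "hom_induced ?m (top_of_set U) (U - Z) ?E (-Z) id ` carrier ?HU = carrier (relative_homology_group ?m ?E (-Z))"
    using iso_excision_open[OF \<open>open U\<close> compact_imp_closed[OF \<open>compact Z\<close>] \<open>Z \<subseteq> U\<close>, of ?m]
    by (simp add: iso_def bij_betw_def)
  then have "hom_induced ?m ?E ?B ?E (-Z) id c \<in> hom_induced ?m (top_of_set U) (U - Z) ?E (-Z) id ` carrier ?HU"
    using cZ by simp
  then obtain d where d: "d \<in> carrier ?HU" "hom_induced ?m (top_of_set U) (U - Z) ?E (-Z) id d = hom_induced ?m ?E ?B ?E (-Z) id c"
    by (rule imageE) (rule that, auto)
  define d0 where "d0 = hom_induced ?m (top_of_set U) (U - Z) (top_of_set U) (U - {u0}) id d"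
  let ?HU0 = "relative_homology_group ?m (top_of_set U) (U - {u0})"
  have d0: "d0 \<in> carrier ?HU0" unfolding d0_def by (rule hom_induced_carrier)
  have one: "hom_induced ?m X S Y T h \<one>\<^bsub>relative_homology_group ?m X S\<^esub> = \<one>\<^bsub>relative_homology_group ?m Y T\<^esub>"
    for X S Y T and h :: "'a \<Rightarrow> 'a"
    by (meson group_relative_homology_group hom_induced_hom hom_one)
  \<comment> \<open>All maps here are inclusions, so \<open>d0\<close> and \<open>c\<close> have the
    same image in the local homology at \<open>u0\<close>, which is nontrivial by the choice of
    \<open>c\<close>.\<close>
  have "hom_induced ?m (top_of_set U) (U - {u0}) ?E (-{u0}) id d0 = hom_induced ?m (top_of_set U) (U - Z) ?E (-{u0}) id d"
    unfolding d0_def using u0Z by (subst hom_induced_compose') auto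
  also have "\<dots> = hom_induced ?m ?E (-Z) ?E (-{u0}) id (hom_induced ?m (top_of_set U) (U - Z) ?E (-Z) id d)"
    using u0Z by (subst hom_induced_compose') auto
  also have "\<dots> = hom_induced ?m ?E ?B ?E (-{u0}) id c"
    unfolding d(2) using u0Z R by (subst hom_induced_compose') auto
  finally have "d0 \<noteq> \<one>\<^bsub>?HU0\<^esub>" using c(2) one by metis
  moreover have "hom_induced ?m (top_of_set U) (U - {u0}) ?E (-{0}) ?f0 d0 = \<one>\<^bsub>relative_homology_group ?m ?E (-{0})\<^esub>"
  proof -
    have "hom_induced ?m (top_of_set U) (U - {u0}) ?E (-{0}) ?f0 d0 = hom_induced ?m (top_of_set U) (U - Z) ?E (-{0}) ?f0 d"
      unfolding d0_def using u0Z F0 cont by (subst hom_induced_compose') auto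
    also have "homotopic_with (\<lambda>h. h \<in> (U - Z) \<rightarrow> - {0}) (top_of_set U) (top_of_set UNIV) ?f0 ?f1"
      by (rule homotopic_withI_euclidean) (use contF FZ in auto)
    then have "hom_induced ?m (top_of_set U) (U - Z) ?E (-{0}) ?f0 d = hom_induced ?m (top_of_set U) (U - Z) ?E (-{0}) ?f1 d"
      by (metis homology_homotopy_axiom subtopology_UNIV)
    \<comment> \<open>Since \<open>F (1, _)\<close> has no zero on \<open>U\<close>, its induced map
      factors through the homology of \<open>U\<close> relative to itself, which is trivial.\<close>
    also have "\<dots> = hom_induced ?m (top_of_set U) U ?E (-{0}) ?f1 (hom_induced ?m (top_of_set U) (U - Z) (top_of_set U) U id d)"
      using F1 cont by (subst hom_induced_compose') auto
    also have "hom_induced ?m (top_of_set U) (U - Z) (top_of_set U) U id d = \<one>\<^bsub>relative_homology_group ?m (top_of_set U) U\<^esub>"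
      using hom_induced_carrier[of ?m "top_of_set U" "U - Z" "top_of_set U" U id d] 
        trivial_relative_homology_group_topspace[of ?m "top_of_set U"] by (simp add: trivial_group_def)
    finally show ?thesis by (simp only: one)
  qed
  moreover have "hom_induced ?m (top_of_set U) (U - {u0}) ?E (-{0}) ?f0 \<one>\<^bsub>?HU0\<^esub> = \<one>\<^bsub>relative_homology_group ?m ?E (-{0})\<^esub>"
    by (rule one)
  moreover have "\<one>\<^bsub>?HU0\<^esub> \<in> carrier ?HU0" by (meson group.is_monoid group_relative_homology_group monoid.one_closed)
  ultimately show False
    using inj_on_hom_induced_local_zero[OF \<open>open U\<close> u0 cont(1) F0 deriv \<open>inj A\<close>, of ?m] d0 by (metis inj_onD)
qed

section \<open>Flows of ordinary differential equations\<close>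

text \<open>The squared norm stays differentiable where \<open>u\<close> vanishes. Multiplied by
  \<open>exp (- (K * t))\<close> and diminished by \<open>c * t\<close> it is nonincreasing, because
  the exponential is at most \<open>1\<close>; so \<open>c\<close> costs only a linear term and
  \<open>K = 0\<close> is allowed.\<close>

lemma gronwall_norm_sq:
  fixes u :: "real \<Rightarrow> 'a::euclidean_space"
  assumes "T \<ge> 0" "K \<ge> 0" "c \<ge> 0"
    and der: "\<And>t. t \<in> {0..T} \<Longrightarrow> (u has_vector_derivative u' t) (at t)"
    and bnd: "\<And>t. t \<in> {0..T} \<Longrightarrow> 2 * (u t \<bullet> u' t) \<le> K * (norm (u t))\<^sup>2 + c"
  shows "(norm (u T))\<^sup>2 \<le> exp (K * T) * ((norm (u 0))\<^sup>2 + c * T)"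
proof -
  define g where "g = (\<lambda>t. exp (- (K * t)) * (u t \<bullet> u t) - c * t)"
  have "g T \<le> g 0"
  proof (rule DERIV_nonpos_imp_nonincreasing[OF \<open>T \<ge> 0\<close>])
    fix t assume t: "0 \<le> t" "t \<le> T"
    have ud: "(u has_derivative (\<lambda>h. h *\<^sub>R u' t)) (at t)"
      using der t by (simp add: has_vector_derivative_def)
    have "((\<lambda>t. u t \<bullet> u t) has_derivative (\<lambda>h. u t \<bullet> (h *\<^sub>R u' t) + (h *\<^sub>R u' t) \<bullet> u t)) (at t)"
      by (rule has_derivative_inner[OF ud ud])
    then have D: "DERIV (\<lambda>t. u t \<bullet> u t) t :> 2 * (u t \<bullet> u' t)"
      unfolding has_field_derivative_def by (rule has_derivative_eq_rhs) (auto simp: fun_eq_iff inner_commute)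
    have "DERIV g t :> exp (- (K * t)) * (2 * (u t \<bullet> u' t)) - K * exp (- (K * t)) * (u t \<bullet> u t) - c"
      unfolding g_def by (auto intro!: derivative_eq_intros D)
    moreover have "exp (- (K * t)) * (2 * (u t \<bullet> u' t)) - K * exp (- (K * t)) * (u t \<bullet> u t) - c \<le> 0"
    proof -
      have "exp (- (K * t)) * (2 * (u t \<bullet> u' t)) - K * exp (- (K * t)) * (u t \<bullet> u t)
        = exp (- (K * t)) * (2 * (u t \<bullet> u' t) - K * (norm (u t))\<^sup>2)"
        by (simp add: algebra_simps power2_norm_eq_inner)
      also have "\<dots> \<le> exp (- (K * t)) * c" using bnd[of t] t by (intro mult_left_mono) auto
      also have "\<dots> \<le> 1 * c" using assms t by (intro mult_right_mono) auto
      finally show ?thesis by simp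
    qed
    ultimately show "\<exists>y. DERIV g t :> y \<and> y \<le> 0" by blast
  qed
  then have "exp (- (K * T)) * (norm (u T))\<^sup>2 \<le> (norm (u 0))\<^sup>2 + c * T"
    by (simp add: g_def power2_norm_eq_inner)
  then have "exp (K * T) * (exp (- (K * T)) * (norm (u T))\<^sup>2) \<le> exp (K * T) * ((norm (u 0))\<^sup>2 + c * T)"
    by (intro mult_left_mono) auto
  then show ?thesis by (simp add: mult.assoc[symmetric] exp_minus_inverse)
qed

lemma has_vector_derivative_reflect:
  assumes "(y has_vector_derivative D) (at (- t))"
  shows "((\<lambda>s. y (- s)) has_vector_derivative - D) (at t)"
proof -
  have "(uminus has_vector_derivative - 1) (at t)"
    using has_vector_derivative_minus[OF has_vector_derivative_id[of "at t"]] by (simp add: id_def)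
  from vector_diff_chain_at[OF this assms] show ?thesis by (simp add: o_def)
qed

text \<open>A mean value inequality with a power as dominating function, extended to negative
  \<open>t\<close> by reflection. The case \<open>n = 0\<close> bounds displacements; for general
  \<open>n\<close> the factor \<open>1 / Suc n\<close> builds up the factorials of Picard
  iteration.\<close>

lemma norm_diff_le_power:
  fixes H :: "real \<Rightarrow> 'a::real_normed_vector"
  assumes der: "\<And>s. (H has_vector_derivative H' s) (at s)"
    and bnd: "\<And>s. \<bar>s\<bar> \<le> \<bar>t\<bar> \<Longrightarrow> norm (H' s) \<le> C * \<bar>s\<bar> ^ n"
  shows "norm (H t - H 0) \<le> C * \<bar>t\<bar> ^ Suc n / Suc n"
proof -
  have pos: "norm (F t - F 0) \<le> C * t ^ Suc n / Suc n"
    if "t > 0" "\<And>s. (F has_vector_derivative F' s) (at s)" "\<And>s. \<bar>s\<bar> \<le> \<bar>t\<bar> \<Longrightarrow> norm (F' s) \<le> C * \<bar>s\<bar> ^ n"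
    for F :: "real \<Rightarrow> 'a" and F' t
  proof -
    define \<phi> where "\<phi> = (\<lambda>t::real. C * t ^ Suc n / Suc n)"
    have \<phi>: "(\<phi> has_vector_derivative C * s ^ n) (at s)" for s
    proof -
      have "DERIV \<phi> s :> C * (real (Suc n) * s ^ n) / Suc n" 
        unfolding \<phi>_def by (auto intro!: derivative_eq_intros simp del: of_nat_Suc power_Suc)
      then show ?thesis by (simp add: has_real_derivative_iff_has_vector_derivative del: of_nat_Suc)
    qed
    have c1: "continuous_on {0..t} F" 
      using that(2) by (meson continuous_at_imp_continuous_on has_vector_derivative_continuous)
    have c2: "continuous_on {0..t} \<phi>" 
      using \<phi> by (meson continuous_at_imp_continuous_on has_vector_derivative_continuous)
    have "norm (F t - F 0) \<le> \<phi> t - \<phi> 0"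
    proof (rule differentiable_bound_general[OF that(1) c1 c2 that(2) \<phi>])
      show "norm (F' x) \<le> C * x ^ n" if "0 < x" "x < t" for x
        using \<open>\<And>s. \<bar>s\<bar> \<le> \<bar>t\<bar> \<Longrightarrow> norm (F' s) \<le> C * \<bar>s\<bar> ^ n\<close>[of x] that by simp
    qed
    then show ?thesis by (simp add: \<phi>_def)
  qed
  consider "t = 0" | "t > 0" | "t < 0" by linarith
  then show ?thesis
  proof cases
    case 2 then show ?thesis using pos[OF 2 der] bnd by simp
  next
    case 3
    have "norm (H (- (-t)) - H (- 0)) \<le> C * (-t) ^ Suc n / Suc n"
      by (rule pos[where F' = "\<lambda>s. - H' (- s)"])
        (use 3 bnd[of "- s" for s] in \<open>auto intro!: has_vector_derivative_reflect der\<close>)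
    then show ?thesis using 3 by simp
  qed auto
qed

lemma continuous_antiderivative:
  fixes h :: "real \<Rightarrow> 'a::euclidean_space"
  assumes "continuous_on UNIV h"
  shows "\<exists>H. H 0 = 0 \<and> (\<forall>t. (H has_vector_derivative h t) (at t))"
proof -
  \<comment> \<open>At most one of the two intervals is nondegenerate, so negative \<open>t\<close>
    is covered with the right sign.\<close>
  define H where "H = (\<lambda>t. integral {0..t} h - integral {t..0} h)"
  have int: "h integrable_on {a..b}" for a b
    using assms by (intro integrable_continuous_real) (auto intro: continuous_on_subset)
  have eq: "H t = integral {-T..t} h - integral {-T..0} h" if "\<bar>t\<bar> \<le> T" for t T
  proof (cases "t \<ge> 0")
    case True
    have "integral {-T..0} h + integral {0..t} h = integral {-T..t} h"
      using True that int by (intro Henstock_Kurzweil_Integration.integral_combine) auto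
    moreover have "integral {t..0} h = 0" using True by (cases "t = 0") auto
    ultimately show ?thesis by (simp add: H_def algebra_simps)
  next
    case False
    have "integral {-T..t} h + integral {t..0} h = integral {-T..0} h"
      using False that int by (intro Henstock_Kurzweil_Integration.integral_combine) auto
    then show ?thesis using False by (simp add: H_def algebra_simps)
  qed
  have "(H has_vector_derivative h t) (at t)" for t
  proof -
    define T where "T = \<bar>t\<bar> + 1"
    have "((\<lambda>u. integral {-T..u} h) has_vector_derivative h t) (at t within {-T..T})"
      using assms by (intro integral_has_vector_derivative) (auto intro: continuous_on_subset simp: T_def)
    then have "((\<lambda>u. integral {-T..u} h) has_vector_derivative h t) (at t)"
      using at_within_interior[of t "{-T..T}"] by (simp add: T_def abs_if split: if_splits)
    then have "((\<lambda>u. integral {-T..u} h - integral {-T..0} h) has_vector_derivative h t - 0) (at t)"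
      by (intro derivative_intros)
    then have "((\<lambda>u. integral {-T..u} h - integral {-T..0} h) has_vector_derivative h t) (at t)"
      by simp
    then show ?thesis
      by (rule has_vector_derivative_transform_within_open[where S = "{-T<..<T}"]) (use eq[of _ T] in \<open>auto simp: T_def abs_le_iff\<close>)
  qed
  then show ?thesis by (intro exI[of _ H]) (simp add: H_def)
qed

text \<open>Picard iteration from the constant \<open>z0\<close>. The Lipschitz constant is uniform
  in the space variable, so the iterates are compared on all of \<open>{-T..T}\<close> without
  shrinking the interval: \<open>M\<close> bounds the speed at \<open>z0\<close>, and each further
  iteration multiplies by \<open>L\<close> and integrates once.\<close>

theorem global_solution_exists:
  fixes f :: "real \<Rightarrow> 'a::euclidean_space \<Rightarrow> 'a"
  assumes cont: "continuous_on UNIV (\<lambda>(t, z). f t z)"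
    and lip: "\<And>T. \<exists>L\<ge>0. \<forall>t z z'. \<bar>t\<bar> \<le> T \<longrightarrow> norm (f t z - f t z') \<le> L * norm (z - z')"
  shows "\<exists>y. y 0 = z0 \<and> (\<forall>t. (y has_vector_derivative f t (y t)) (at t))"
proof -
  have contc: "continuous_on UNIV (\<lambda>t. f t (g t))" if "continuous_on UNIV g" for g
    using continuous_on_compose2[OF cont continuous_on_Pair[OF continuous_on_id that]] by auto
  obtain J where J: "\<And>h :: real \<Rightarrow> 'a. continuous_on UNIV h \<Longrightarrow> J h 0 = 0 \<and> (\<forall>t. (J h has_vector_derivative h t) (at t))"
    using continuous_antiderivative by metis
  define Y where "Y = rec_nat (\<lambda>_. z0) (\<lambda>n y t. z0 + J (\<lambda>s. f s (y s)) t)"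
  have Y0: "Y 0 = (\<lambda>_. z0)" and YS: "Y (Suc n) = (\<lambda>t. z0 + J (\<lambda>s. f s (Y n s)) t)" for n
    by (simp_all add: Y_def)
  have YC: "continuous_on UNIV (Y n)" for n
  proof (induction n)
    case (Suc n)
    then have "continuous_on UNIV (J (\<lambda>s. f s (Y n s)))"
      using J[OF contc] by (meson continuous_at_imp_continuous_on has_vector_derivative_continuous)
    then show ?case unfolding YS by (intro continuous_intros)
  qed (simp add: Y0)
  have YD: "(Y (Suc n) has_vector_derivative f t (Y n t)) (at t)" for n t
    unfolding YS using J[OF contc[OF YC]] by (auto intro!: derivative_eq_intros)
  have Yz: "Y n 0 = z0" for n by (cases n) (simp_all add: Y0 YS J[OF contc[OF YC]])
  have unif: "\<exists>y. uniform_limit {-T..T} Y y sequentially" for T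
  proof -
    obtain L where L: "L \<ge> 0" "\<And>t z z'. \<bar>t\<bar> \<le> T \<Longrightarrow> norm (f t z - f t z') \<le> L * norm (z - z')"
      using lip by metis
    have "compact ((\<lambda>t. f t z0) ` {-T..T})"
      by (intro compact_continuous_image continuous_on_subset[OF contc[of "\<lambda>_. z0"]]) auto
    then obtain M where M: "\<And>t. t \<in> {-T..T} \<Longrightarrow> norm (f t z0) \<le> M"
      using compact_imp_bounded bounded_iff by (metis imageI)
    have est: "norm (Y (Suc n) t - Y n t) \<le> M * L ^ n * \<bar>t\<bar> ^ Suc n / fact (Suc n)" if "\<bar>t\<bar> \<le> T" for n t
      using that
    proof (induction n arbitrary: t)
      case 0
      have "norm (Y (Suc 0) t - Y (Suc 0) 0) \<le> M * \<bar>t\<bar> ^ Suc 0 / Suc 0"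
        by (rule norm_diff_le_power[OF YD]) (use 0 in \<open>auto simp: Y0 intro!: M\<close>)
      then show ?case by (simp add: Yz Y0)
    next
      case (Suc n)
      define C where "C = M * L ^ Suc n / fact (Suc n)"
      let ?d = "\<lambda>t. Y (Suc (Suc n)) t - Y (Suc n) t"
      have "norm (?d t - ?d 0) \<le> C * \<bar>t\<bar> ^ Suc (Suc n) / Suc (Suc n)"
      proof (rule norm_diff_le_power)
        show "(?d has_vector_derivative f s (Y (Suc n) s) - f s (Y n s)) (at s)" for s
          by (intro derivative_intros YD)
        fix s :: real assume s: "\<bar>s\<bar> \<le> \<bar>t\<bar>"
        then have "norm (f s (Y (Suc n) s) - f s (Y n s)) \<le> L * norm (Y (Suc n) s - Y n s)"
          using L Suc by auto
        also have "\<dots> \<le> L * (M * L ^ n * \<bar>s\<bar> ^ Suc n / fact (Suc n))"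
          using Suc s L by (intro mult_left_mono) auto
        finally show "norm (f s (Y (Suc n) s) - f s (Y n s)) \<le> C * \<bar>s\<bar> ^ Suc n"
          by (simp add: C_def field_simps)
      qed
      also have "C * \<bar>t\<bar> ^ Suc (Suc n) / Suc (Suc n) = M * L ^ Suc n * \<bar>t\<bar> ^ Suc (Suc n) / fact (Suc (Suc n))"
        by (simp add: C_def field_simps fact_Suc[of "Suc n"] del: of_nat_Suc)
      finally show ?case by (simp add: Yz)
    qed
    define m where "m = (\<lambda>n. \<bar>M\<bar> * \<bar>T\<bar> * ((L * \<bar>T\<bar>) ^ n /\<^sub>R fact n))"
    have "uniform_limit {-T..T} (\<lambda>n t. \<Sum>i<n. Y (Suc i) t - Y i t) (\<lambda>t. suminf (\<lambda>i. Y (Suc i) t - Y i t)) sequentially"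
    proof (rule Weierstrass_m_test)
      show "summable m" unfolding m_def by (intro summable_mult summable_exp_generic)
      fix n t assume "t \<in> {-T..T}"
      then have t: "\<bar>t\<bar> \<le> T" by auto
      have "norm (Y (Suc n) t - Y n t) \<le> M * L ^ n * \<bar>t\<bar> ^ Suc n / fact (Suc n)" by (rule est[OF t])
      also have "\<dots> \<le> \<bar>M\<bar> * L ^ n * \<bar>T\<bar> ^ Suc n / fact n"
        using t L by (intro frac_le mult_mono power_mono fact_mono) auto
      also have "\<dots> = m n" by (simp add: m_def power_mult_distrib divide_inverse)
      finally show "norm (Y (Suc n) t - Y n t) \<le> m n" .
    qed
    then have "uniform_limit {-T..T} (\<lambda>n t. z0 + (\<Sum>i<n. Y (Suc i) t - Y i t)) (\<lambda>t. z0 + suminf (\<lambda>i. Y (Suc i) t - Y i t)) sequentially"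
      by (intro uniform_limit_intros)
    moreover have "z0 + (\<Sum>i<n. Y (Suc i) t - Y i t) = Y n t" for n t
      by (simp add: sum_lessThan_telescope[of "\<lambda>i. Y i t"] Y0)
    ultimately show ?thesis by auto
  qed
  define y where "y t = lim (\<lambda>n. Y n t)" for t
  have ul: "uniform_limit {-T..T} Y y sequentially" for T
  proof -
    obtain y' where y': "uniform_limit {-T..T} Y y' sequentially" using unif by blast
    then have "y' t = y t" if "t \<in> {-T..T}" for t
      unfolding y_def using tendsto_uniform_limitI[OF y' that] by (simp add: limI)
    then show ?thesis using y' uniform_limit_cong'[of "{-T..T}" Y Y y' y] by simp
  qed
  have yc: "continuous_on UNIV y"
  proof -
    have "isCont y t" for t
    proof -
      have "continuous_on {-(\<bar>t\<bar>+1)..\<bar>t\<bar>+1} y"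
        by (rule uniform_limit_theorem[OF _ ul]) (auto intro: always_eventually continuous_on_subset[OF YC])
      then show ?thesis by (rule continuous_on_interior) auto
    qed
    then show ?thesis by (simp add: continuous_at_imp_continuous_on)
  qed
  define H where "H = J (\<lambda>s. f s (y s))"
  have H: "H 0 = 0" "\<And>t. (H has_vector_derivative f t (y t)) (at t)"
    using J[OF contc[OF yc]] by (auto simp: H_def)
  have yH: "y t = z0 + H t" for t
  proof -
    define T where "T = \<bar>t\<bar>"
    obtain L where L: "L \<ge> 0" "\<And>t z z'. \<bar>t\<bar> \<le> T \<Longrightarrow> norm (f t z - f t z') \<le> L * norm (z - z')"
      using lip by metis
    have "(\<lambda>n. Y (Suc n) t) \<longlonglongrightarrow> z0 + H t"
    proof (rule LIMSEQ_I)
      fix e :: real assume "e > 0"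
      \<comment> \<open>Small enough that the integrated error \<open>L * d * T\<close> is below
        \<open>e\<close>; the summands \<open>+ 1\<close> keep the denominator positive when
        \<open>L\<close> or \<open>T\<close> vanishes.\<close>
      define d where "d = e / (2 * (L + 1) * (T + 1))"
      have "d > 0" using \<open>e > 0\<close> L by (simp add: d_def T_def)
      then obtain N where N: "\<And>n s. n \<ge> N \<Longrightarrow> s \<in> {-T..T} \<Longrightarrow> dist (Y n s) (y s) < d"
        using ul[of T] unfolding uniform_limit_sequentially_iff by metis
      have "norm (Y (Suc n) t - (z0 + H t)) < e" if "n \<ge> N" for n
      proof -
        let ?d = "\<lambda>t. Y (Suc n) t - H t"
        have "norm (?d t - ?d 0) \<le> (L * d) * \<bar>t\<bar> ^ Suc 0 / Suc 0"
        proof (rule norm_diff_le_power)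
          show "(?d has_vector_derivative f s (Y n s) - f s (y s)) (at s)" for s
            by (intro derivative_intros YD H)
          fix s :: real assume s: "\<bar>s\<bar> \<le> \<bar>t\<bar>"
          then have "norm (f s (Y n s) - f s (y s)) \<le> L * norm (Y n s - y s)" using L by (auto simp: T_def)
          also have "\<dots> \<le> L * d" using N[OF that, of s] s L 
            by (intro mult_left_mono) (auto simp: T_def dist_norm abs_le_iff intro: less_imp_le)
          finally show "norm (f s (Y n s) - f s (y s)) \<le> L * d * \<bar>s\<bar> ^ 0" by simp
        qed
        also have "\<dots> = L * d * T" by (simp add: T_def)
        also have "\<dots> \<le> (L + 1) * d * (T + 1)" using L \<open>d > 0\<close> by (intro mult_mono) (auto simp: T_def)
        also have "\<dots> = e / 2"
        proof -
          have "L + 1 \<noteq> 0" "T + 1 \<noteq> 0" using L by (auto simp: T_def)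
          then show ?thesis unfolding d_def by (simp add: divide_simps)
        qed
        also have "\<dots> < e" using \<open>e > 0\<close> by simp
        finally show ?thesis by (simp add: Yz H algebra_simps)
      qed
      then show "\<exists>N. \<forall>n\<ge>N. norm (Y (Suc n) t - (z0 + H t)) < e" by blast
    qed
    moreover have "(\<lambda>n. Y (Suc n) t) \<longlonglongrightarrow> y t"
      using tendsto_uniform_limitI[OF ul[of T], of t] by (intro LIMSEQ_Suc) (auto simp: T_def abs_if split: if_splits)
    ultimately show ?thesis using LIMSEQ_unique by blast
  qed
  have "(y has_vector_derivative f t (y t)) (at t)" for t
    unfolding yH[abs_def] using H(2)[of t] by (auto intro!: derivative_eq_intros simp: yH[abs_def])
  moreover have "y 0 = z0" by (simp add: yH H)
  ultimately show ?thesis by blast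
qed

section \<open>Truncation and complete solutions of Newtonian fields\<close>

text \<open>Written as a nearest-point projection, it is 1-Lipschitz by convexity of the ball; the
  explicit formula \<open>clip_eq\<close> supplies continuity jointly in the radius and the
  point.\<close>

definition clip :: "real \<Rightarrow> 'a::euclidean_space \<Rightarrow> 'a" where
  "clip R x = closest_point (cball 0 R) x"

lemma clip_eq: "R > 0 \<Longrightarrow> clip R x = (R / max R (norm x)) *\<^sub>R x"
proof -
  assume R: "R > 0"
  have "closest_point (cball 0 R) x = (R / max R (norm x)) *\<^sub>R x"
  proof (rule closest_point_unique[symmetric])
    show "(R / max R (norm x)) *\<^sub>R x \<in> cball 0 R"
      using R by (auto simp: max_def divide_simps mult_left_mono)
    show "\<forall>z\<in>cball 0 R. dist x ((R / max R (norm x)) *\<^sub>R x) \<le> dist x z"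
    proof
      fix z :: 'a assume z: "z \<in> cball 0 R"
      show "dist x ((R / max R (norm x)) *\<^sub>R x) \<le> dist x z"
      proof (cases "norm x \<le> R")
        case True then show ?thesis using R by (simp add: max_def)
      next
        case False
        have "x - (R / norm x) *\<^sub>R x = (1 - R / norm x) *\<^sub>R x" by (simp add: algebra_simps)
        then have "dist x ((R / max R (norm x)) *\<^sub>R x) = \<bar>1 - R / norm x\<bar> * norm x" 
          using False by (simp add: dist_norm max_def)
        also have "\<bar>1 - R / norm x\<bar> = 1 - R / norm x" using False R by (subst abs_of_nonneg) (auto simp: divide_le_eq)
        also have "(1 - R / norm x) * norm x = norm x - R" using False R by (auto simp: left_diff_distrib)
        also have "\<dots> \<le> dist x z" using z norm_triangle_ineq2[of x z] by (simp add: dist_norm)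
        finally show ?thesis .
      qed
    qed
  qed auto
  then show ?thesis by (simp add: clip_def)
qed

lemma clip_eq_self: "norm x \<le> R \<Longrightarrow> clip R x = x"
  by (simp add: clip_def closest_point_self)

lemma norm_clip_le: "R \<ge> 0 \<Longrightarrow> norm (clip R x) \<le> R"
  using closest_point_in_set[of "cball 0 R" x] by (simp add: clip_def)

lemma norm_clip_diff_le: "R \<ge> 0 \<Longrightarrow> norm (clip R x - clip R y) \<le> norm (x - y)"
  using closest_point_lipschitz[of "cball 0 R" x y] by (simp add: clip_def dist_norm)

text \<open>A time-dependent field of Newtonian form \<open>x' = p\<close> whose force changes \<open>|p|\<close> at a bounded rate,
  which is what makes the flow complete.\<close>

locale newton_field =
  fixes X :: "real \<Rightarrow> 'a::euclidean_space \<times> 'a \<Rightarrow> 'a \<times> 'a"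
    and DX :: "real \<Rightarrow> 'a \<times> 'a \<Rightarrow> 'a \<times> 'a \<Rightarrow> 'a \<times> 'a" and M :: real
  assumes X_cont: "continuous_on UNIV (\<lambda>(t, z). X t z)"
    and X_deriv: "\<And>t z. (X t has_derivative DX t z) (at z)"
    and DX_cont: "\<And>v. continuous_on UNIV (\<lambda>(t, z). DX t z v)"
    and fst_X: "\<And>t z. fst (X t z) = snd z"
    and power_bound: "\<And>t z. \<bar>snd z \<bullet> snd (X t z)\<bar> \<le> M * norm (snd z)"
begin

definition is_solution :: "(real \<Rightarrow> 'a \<times> 'a) \<Rightarrow> bool" where
  "is_solution y \<longleftrightarrow> (\<forall>t. (y has_vector_derivative X t (y t)) (at t))"

lemma M_nonneg: "M \<ge> 0"
proof -
  obtain b :: 'a where "b \<in> Basis" using nonempty_Basis by blast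
  then show ?thesis using power_bound[of "(0, b)" 0] by (simp add: order_trans[OF abs_ge_zero])
qed

lemma bounded_linear_DX: "bounded_linear (DX t z)"
  using X_deriv by (rule has_derivative_bounded_linear)

lemma DX_sum_cont: "continuous_on UNIV (\<lambda>(t, z). \<Sum>b\<in>Basis. norm (DX t z b))"
  using DX_cont unfolding case_prod_unfold by (intro continuous_intros) auto

text \<open>The ball is convex, and the sum of the derivatives on basis vectors dominates the
  operator norm and is bounded on a compact region. \<open>max L 0\<close> serves an empty region,
  where \<open>L\<close> may be negative.\<close>

lemma X_lipschitz_on_cball:
  "\<exists>L\<ge>0. \<forall>t z z'. \<bar>t\<bar> \<le> T \<longrightarrow> norm z \<le> r \<longrightarrow> norm z' \<le> r \<longrightarrow> norm (X t z - X t z') \<le> L * norm (z - z')"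
proof -
  have "compact ((\<lambda>(t, z). \<Sum>b\<in>Basis. norm (DX t z b)) ` ({-T..T} \<times> cball 0 r))"
    by (intro compact_continuous_image continuous_on_subset[OF DX_sum_cont] compact_Times) auto
  then have "bounded ((\<lambda>(t, z). \<Sum>b\<in>Basis. norm (DX t z b)) ` ({-T..T} \<times> cball 0 r))"
    by (rule compact_imp_bounded)
  then obtain L where L: "\<And>t z. t \<in> {-T..T} \<Longrightarrow> z \<in> cball 0 r \<Longrightarrow> \<bar>\<Sum>b\<in>Basis. norm (DX t z b)\<bar> \<le> L"
    unfolding bounded_iff by fastforce
  have "norm (X t z - X t z') \<le> max L 0 * norm (z - z')" if "\<bar>t\<bar> \<le> T" "norm z \<le> r" "norm z' \<le> r" for t z z'
  proof (rule differentiable_bound[of "cball 0 r" _ "DX t"])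
    fix x assume x: "x \<in> cball (0::'a \<times> 'a) r"
    show "(X t has_derivative DX t x) (at x within cball 0 r)"
      using X_deriv has_derivative_at_withinI by blast
    have "onorm (DX t x) \<le> (\<Sum>b\<in>Basis. norm (DX t x b))" by (rule onorm_componentwise[OF bounded_linear_DX])
    also have "\<dots> \<le> L" using L[of t x] that x by (auto simp: abs_le_iff)
    finally show "onorm (DX t x) \<le> max L 0" by simp
  qed (use that in auto)
  then show ?thesis by (intro exI[of _ "max L 0"]) auto
qed

text \<open>\<open>sqrt (1 + |p|^2)\<close> replaces \<open>|p|\<close>: it is differentiable
  everywhere and its derivative is at most \<open>M\<close>. The curve need only obey the power
  inequality, as the bound is also applied to solutions of a truncated field.\<close>

lemma solution_growth:
  assumes der: "\<And>s. (y has_vector_derivative y' s) (at s)"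
    and bnd: "\<And>s. \<bar>snd (y s) \<bullet> snd (y' s)\<bar> \<le> M * norm (snd (y s))"
  shows "norm (snd (y t)) \<le> sqrt (1 + (norm (snd (y 0)))\<^sup>2) + M * \<bar>t\<bar>"
proof -
  define g where "g = (\<lambda>s. sqrt (1 + (norm (snd (y s)))\<^sup>2))"
  define g' where "g' = (\<lambda>s. (snd (y s) \<bullet> snd (y' s)) / g s)"
  have gpos: "g s > 0" for s by (simp add: g_def add_pos_nonneg)
  have gge: "norm (snd (y s)) \<le> g s" for s
    unfolding g_def by (rule real_le_rsqrt) simp
  have "(g has_vector_derivative g' s) (at s)" for s
  proof -
    have yd: "((\<lambda>s. snd (y s)) has_derivative (\<lambda>h. h *\<^sub>R snd (y' s))) (at s)"
      using der[of s] unfolding has_vector_derivative_def by (auto dest: has_derivative_snd)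
    have "((\<lambda>s. snd (y s) \<bullet> snd (y s)) has_derivative (\<lambda>h. snd (y s) \<bullet> (h *\<^sub>R snd (y' s)) + (h *\<^sub>R snd (y' s)) \<bullet> snd (y s))) (at s)"
      by (rule has_derivative_inner[OF yd yd])
    then have D: "DERIV (\<lambda>s. snd (y s) \<bullet> snd (y s)) s :> 2 * (snd (y s) \<bullet> snd (y' s))"
      unfolding has_field_derivative_def by (rule has_derivative_eq_rhs) (auto simp: fun_eq_iff inner_commute)
    have p: "0 < 1 + snd (y s) \<bullet> snd (y s)" by (simp add: add_pos_nonneg)
    have geq: "g = (\<lambda>s. sqrt (1 + snd (y s) \<bullet> snd (y s)))" by (simp add: g_def power2_norm_eq_inner)
    have "DERIV g s :> inverse (sqrt (1 + snd (y s) \<bullet> snd (y s))) / 2 * (0 + 2 * (snd (y s) \<bullet> snd (y' s)))"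
      unfolding geq by (rule DERIV_chain2[OF DERIV_real_sqrt[OF p] DERIV_add[OF DERIV_const D]])
    moreover have "inverse (sqrt (1 + snd (y s) \<bullet> snd (y s))) / 2 * (0 + 2 * (snd (y s) \<bullet> snd (y' s))) = g' s"
      unfolding g'_def geq by (simp add: field_simps)
    ultimately show ?thesis
      by (simp only: has_real_derivative_iff_has_vector_derivative)
  qed
  moreover have "norm (g' s) \<le> M * \<bar>s\<bar> ^ 0" for s
  proof -
    have "\<bar>g' s\<bar> \<le> M * norm (snd (y s)) / g s"
      using bnd[of s] gpos[of s] by (simp add: g'_def divide_right_mono)
    also have "\<dots> \<le> M" using gge[of s] gpos[of s] M_nonneg by (simp add: divide_le_eq mult_left_mono)
    finally show ?thesis by simp
  qed
  ultimately have "norm (g t - g 0) \<le> M * \<bar>t\<bar> ^ Suc 0 / Suc 0" by (rule norm_diff_le_power)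
  then have "g t \<le> g 0 + M * \<bar>t\<bar>" by (simp add: abs_le_iff)
  then show ?thesis using gge[of t] by (simp add: g_def)
qed

text \<open>The bound of \<open>solution_growth\<close> at time \<open>t\<close> for initial
  momentum of norm \<open>r\<close>; being positive, it can also serve as a truncation
  radius.\<close>

definition radius :: "real \<Rightarrow> real \<Rightarrow> real" where
  "radius r t = sqrt (1 + r\<^sup>2) + M * \<bar>t\<bar>"

lemma radius_pos: "radius r t > 0"
  using M_nonneg by (simp add: radius_def add_pos_nonneg)

lemma radius_mono: "\<bar>r\<bar> \<le> \<bar>r'\<bar> \<Longrightarrow> \<bar>t\<bar> \<le> \<bar>t'\<bar> \<Longrightarrow> radius r t \<le> radius r' t'"
  unfolding radius_def using M_nonneg by (intro add_mono mult_left_mono) (auto simp: abs_le_square_iff)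

lemma solution_bounds:
  assumes "is_solution y"
  shows "norm (snd (y t)) \<le> radius (norm (snd (y 0))) t"
    and "norm (fst (y t) - fst (y 0)) \<le> radius (norm (snd (y 0))) t * \<bar>t\<bar>"
proof -
  have d: "\<And>s. (y has_vector_derivative X s (y s)) (at s)" using assms by (simp add: is_solution_def)
  show 1: "norm (snd (y t)) \<le> radius (norm (snd (y 0))) t" for t
    unfolding radius_def by (rule solution_growth[OF d]) (rule power_bound)
  have d1: "((\<lambda>s. fst (y s)) has_vector_derivative snd (y s)) (at s)" for s
    using has_derivative_fst[OF d[of s, unfolded has_vector_derivative_def]] fst_X
    by (simp add: has_vector_derivative_def)
  have "norm (fst (y t) - fst (y 0)) \<le> radius (norm (snd (y 0))) t * \<bar>t\<bar> ^ Suc 0 / Suc 0"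
    by (rule norm_diff_le_power[OF d1]) (use order_trans[OF 1 radius_mono] in auto)
  then show "norm (fst (y t) - fst (y 0)) \<le> radius (norm (snd (y 0))) t * \<bar>t\<bar>" by simp
qed

lemma solution_norm_bound:
  assumes "is_solution y" "norm (y 0) \<le> r" "\<bar>t\<bar> \<le> T"
  shows "norm (y t) \<le> r + radius r T * (T + 1)"
proof -
  have T: "T \<ge> 0" and r: "r \<ge> 0" using assms(3) order_trans[OF norm_ge_zero assms(2)] by auto
  have s0: "norm (snd (y 0)) \<le> r" using assms(2) norm_snd_le[of "snd (y 0)" "fst (y 0)"] by simp
  have f0: "norm (fst (y 0)) \<le> r" using assms(2) norm_fst_le[of "fst (y 0)" "snd (y 0)"] by simp
  have R: "radius (norm (snd (y 0))) t \<le> radius r T" by (rule radius_mono) (use s0 assms T r in auto)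
  have "norm (y t) \<le> norm (fst (y t)) + norm (snd (y t))" using norm_Pair_le[of "fst (y t)" "snd (y t)"] by simp
  also have "norm (fst (y t)) \<le> norm (fst (y 0)) + norm (fst (y t) - fst (y 0))" using norm_triangle_sub by blast
  also have "norm (fst (y t) - fst (y 0)) \<le> radius r T * T"
    using solution_bounds(2)[OF assms(1), of t] R assms(3) radius_pos[of "norm (snd (y 0))" t]
    by (meson mult_mono abs_ge_zero less_imp_le order_trans radius_pos)
  also have "norm (snd (y t)) \<le> radius r T" using solution_bounds(1)[OF assms(1), of t] R by simp
  finally show ?thesis using f0 by (simp add: algebra_simps)
qed

text \<open>The field is only locally Lipschitz, so position and momentum are truncated at sizes
  \<open>Q t\<close> and \<open>R t\<close> that no solution can exceed. The truncated equation has
  a global solution, and the growth bounds show that the truncation does not affect it.\<close>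

lemma solution_exists: "\<exists>y. is_solution y \<and> y 0 = z0"
proof -
  define R where "R t = radius (norm (snd z0)) t" for t
  define Q where "Q t = norm (fst z0) + R t * \<bar>t\<bar> + 1" for t
  define F where "F t z = X t (clip (Q t) (fst z), clip (R t) (snd z))" for t z
  have Rpos: "R t > 0" for t by (simp add: R_def radius_pos)
  have Qpos: "Q t > 0" for t using Rpos[of t] by (simp add: Q_def add_nonneg_pos)
  have Rc: "continuous_on UNIV R" unfolding R_def radius_def by (intro continuous_intros)
  have Qc: "continuous_on UNIV Q" unfolding Q_def by (intro continuous_intros Rc)
  have Rc': "continuous_on UNIV (\<lambda>x::real \<times> 'a \<times> 'a. R (fst x))" "continuous_on UNIV (\<lambda>x::real \<times> 'a \<times> 'a. Q (fst x))"
    by (intro continuous_on_compose2[OF Rc] continuous_on_compose2[OF Qc] continuous_intros; simp)+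
  have nz: "max (R t) c \<noteq> 0" "max (Q t) c \<noteq> 0" for t c using Rpos[of t] Qpos[of t] by (auto simp: max_def)
  have "continuous_on UNIV (\<lambda>x. (fst x, (Q (fst x) / max (Q (fst x)) (norm (fst (snd x)))) *\<^sub>R fst (snd x),
      (R (fst x) / max (R (fst x)) (norm (snd (snd x)))) *\<^sub>R (snd (snd x :: 'a \<times> 'a) :: 'a)))"
    by (intro continuous_intros Rc') (simp_all add: nz)
  from continuous_on_compose2[OF X_cont this]
  have Fc: "continuous_on UNIV (\<lambda>(t, z). F t z)"
    by (simp add: F_def clip_eq Rpos Qpos case_prod_unfold)
  have Flip: "\<exists>L\<ge>0. \<forall>t z z'. \<bar>t\<bar> \<le> T \<longrightarrow> norm (F t z - F t z') \<le> L * norm (z - z')" for T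
  proof -
    define r where "r = norm (fst z0) + radius (norm (snd z0)) T * \<bar>T\<bar> + 1 + radius (norm (snd z0)) T"
    obtain L where L: "L \<ge> 0" "\<And>t z z'. \<bar>t\<bar> \<le> T \<Longrightarrow> norm z \<le> r \<Longrightarrow> norm z' \<le> r \<Longrightarrow> norm (X t z - X t z') \<le> L * norm (z - z')"
      using X_lipschitz_on_cball[of T r] by blast
    have "norm (F t z - F t z') \<le> (2 * L) * norm (z - z')" if t: "\<bar>t\<bar> \<le> T" for t z z'
    proof -
      have RT: "R t \<le> radius (norm (snd z0)) T" unfolding R_def by (rule radius_mono) (use t in auto)
      have "R t * \<bar>t\<bar> \<le> radius (norm (snd z0)) T * \<bar>T\<bar>" using RT t Rpos[of t] radius_pos by (intro mult_mono) (auto intro: less_imp_le)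
      with RT have QR: "Q t + R t \<le> r" by (simp add: Q_def r_def)
      have nb: "norm (clip (Q t) a, clip (R t) b) \<le> r" for a b :: 'a
        using norm_Pair_le[of "clip (Q t) a" "clip (R t) b"] norm_clip_le[of "Q t" a] norm_clip_le[of "R t" b] QR Qpos[of t] Rpos[of t] by simp
      have "norm (F t z - F t z') \<le> L * norm ((clip (Q t) (fst z), clip (R t) (snd z)) - (clip (Q t) (fst z'), clip (R t) (snd z')))"
        unfolding F_def by (rule L(2)[OF t nb nb])
      also have "norm ((clip (Q t) (fst z), clip (R t) (snd z)) - (clip (Q t) (fst z'), clip (R t) (snd z')))
        \<le> norm (clip (Q t) (fst z) - clip (Q t) (fst z')) + norm (clip (R t) (snd z) - clip (R t) (snd z'))"
        by (simp add: norm_Pair_le)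
      also have "\<dots> \<le> norm (fst z - fst z') + norm (snd z - snd z')"
        using Rpos[of t] Qpos[of t] by (intro add_mono norm_clip_diff_le) auto
      also have "\<dots> \<le> 2 * norm (z - z')"
        using norm_fst_le[of "fst (z - z')" "snd (z - z')"] norm_snd_le[of "snd (z - z')" "fst (z - z')"] by (simp del: fst_diff snd_diff) (simp add: fst_diff snd_diff)
      finally show ?thesis using L(1) by (simp add: mult_left_mono)
    qed
    then show ?thesis using L(1) by (intro exI[of _ "2 * L"]) auto
  qed
  obtain y where y0: "y 0 = z0" and y: "\<And>t. (y has_vector_derivative F t (y t)) (at t)"
    using global_solution_exists[OF Fc Flip] by blast
  \<comment> \<open>Truncation rescales the momentum by a factor \<open>c > 0\<close>. In
    \<open>power_bound\<close> at \<open>c *\<^sub>R snd (y s)\<close> this factor appears on both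
    sides and cancels.\<close>
  have pb: "\<bar>snd (y s) \<bullet> snd (F s (y s))\<bar> \<le> M * norm (snd (y s))" for s
  proof -
    define c where "c = R s / max (R s) (norm (snd (y s)))"
    have c: "c > 0" unfolding c_def using Rpos[of s] by (intro divide_pos_pos) (auto simp: less_max_iff_disj)
    have "\<bar>(c *\<^sub>R snd (y s)) \<bullet> snd (F s (y s))\<bar> \<le> M * norm (c *\<^sub>R snd (y s))"
      using power_bound[of "(clip (Q s) (fst (y s)), c *\<^sub>R snd (y s))" s] by (simp add: F_def clip_eq[OF Rpos] c_def)
    then have "c * \<bar>snd (y s) \<bullet> snd (F s (y s))\<bar> \<le> c * (M * norm (snd (y s)))"
      using c by (simp add: abs_mult mult.left_commute)
    then show ?thesis using c by simp
  qed
  have sb: "norm (snd (y t)) \<le> R t" for t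
    using solution_growth[OF y pb, of t] by (simp add: y0 R_def radius_def)
  \<comment> \<open>By \<open>sb\<close> the momentum lies inside its truncation radius, so the
    position moves with velocity \<open>snd (y s)\<close> itself.\<close>
  have d1: "((\<lambda>s. fst (y s)) has_vector_derivative snd (y s)) (at s)" for s
    using has_derivative_fst[OF y[of s, unfolded has_vector_derivative_def]] fst_X clip_eq_self[OF sb]
    by (simp add: has_vector_derivative_def F_def)
  have "norm (fst (y t) - fst (y 0)) \<le> R t * \<bar>t\<bar> ^ Suc 0 / Suc 0" for t
    by (rule norm_diff_le_power[OF d1]) (use order_trans[OF sb] in \<open>auto simp: R_def intro!: radius_mono\<close>)
  then have "norm (fst (y t)) \<le> Q t" for t
    using norm_triangle_sub[of "fst (y t)" "fst (y 0)"] by (simp add: Q_def y0) (smt (verit))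
  then have "F t (y t) = X t (y t)" for t
    by (simp add: F_def clip_eq_self sb)
  then show ?thesis using y y0 by (auto simp: is_solution_def)
qed

text \<open>The growth bounds keep both solutions in one ball, where the field is Lipschitz;
  Gronwall then applies with \<open>c = 0\<close>. One \<open>K\<close> for all pairs yields
  uniqueness as well as continuous dependence.\<close>

lemma solutions_lipschitz:
  "\<exists>K. \<forall>y y'. is_solution y \<longrightarrow> is_solution y' \<longrightarrow> norm (y 0) \<le> r \<longrightarrow> norm (y' 0) \<le> r
     \<longrightarrow> (\<forall>t\<in>{0..T}. (norm (y t - y' t))\<^sup>2 \<le> K * (norm (y 0 - y' 0))\<^sup>2)"
proof -
  obtain L where L: "L \<ge> 0" "\<And>t z z'. \<bar>t\<bar> \<le> T \<Longrightarrow> norm z \<le> r + radius r T * (T + 1) \<Longrightarrow> norm z' \<le> r + radius r T * (T + 1)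
     \<Longrightarrow> norm (X t z - X t z') \<le> L * norm (z - z')"
    using X_lipschitz_on_cball by blast
  have "(norm (y t - y' t))\<^sup>2 \<le> exp (2 * L * T) * (norm (y 0 - y' 0))\<^sup>2"
    if y: "is_solution y" "is_solution y'" "norm (y 0) \<le> r" "norm (y' 0) \<le> r" and t: "t \<in> {0..T}" for y y' t
  proof -
    let ?u = "\<lambda>s. y s - y' s"
    have "(norm (?u t))\<^sup>2 \<le> exp (2 * L * t) * ((norm (?u 0))\<^sup>2 + 0 * t)"
    proof (rule gronwall_norm_sq)
      fix s assume s: "s \<in> {0..t}"
      show "(?u has_vector_derivative X s (y s) - X s (y' s)) (at s)"
        using y(1,2) by (intro derivative_intros) (auto simp: is_solution_def)
      have "?u s \<bullet> (X s (y s) - X s (y' s)) \<le> norm (?u s) * norm (X s (y s) - X s (y' s))"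
        by (rule norm_cauchy_schwarz)
      also have "\<dots> \<le> norm (?u s) * (L * norm (?u s))"
        using s t y by (intro mult_left_mono L solution_norm_bound) auto
      finally show "2 * (?u s \<bullet> (X s (y s) - X s (y' s))) \<le> 2 * L * (norm (?u s))\<^sup>2 + 0"
        by (simp add: power2_eq_square mult_ac)
    qed (use t L in auto)
    also have "\<dots> \<le> exp (2 * L * T) * (norm (?u 0))\<^sup>2"
      using t L by (auto intro!: mult_right_mono mult_left_mono)
    finally show ?thesis .
  qed
  then show ?thesis by blast
qed

lemma is_solution_unique_forward:
  assumes "is_solution y" "is_solution y'" "y 0 = y' 0" "t \<ge> 0"
  shows "y t = y' t"
proof -
  obtain K where K: "\<forall>z z'. is_solution z \<longrightarrow> is_solution z' \<longrightarrow> norm (z 0) \<le> norm (y 0) \<longrightarrow> norm (z' 0) \<le> norm (y 0)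
     \<longrightarrow> (\<forall>s\<in>{0..t}. (norm (z s - z' s))\<^sup>2 \<le> K * (norm (z 0 - z' 0))\<^sup>2)"
    using solutions_lipschitz by blast
  have "(norm (y t - y' t))\<^sup>2 \<le> K * (norm (y 0 - y' 0))\<^sup>2"
    by (rule K[rule_format, OF assms(1,2)]) (use assms in auto)
  then show ?thesis using assms by simp
qed

end

text \<open>Time reversal, which transfers the forward uniqueness to negative times.\<close>

lemma (in newton_field) newton_field_reversed:
  "newton_field (\<lambda>t z. (snd z, snd (X (- t) (fst z, - snd z))))
     (\<lambda>t z v. (snd v, snd (DX (- t) (fst z, - snd z) (fst v, - snd v)))) M"
proof
  have c: "continuous_on UNIV (\<lambda>x::real \<times> 'a \<times> 'a. (- fst x, fst (snd x), - snd (snd x)))"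
    by (intro continuous_intros)
  show "continuous_on UNIV (\<lambda>(t, z). (snd z, snd (X (- t) (fst z, - snd z))))"
    using continuous_on_compose2[OF X_cont c] unfolding case_prod_unfold by (auto intro!: continuous_intros)
  show "continuous_on UNIV (\<lambda>(t, z). (snd v, snd (DX (- t) (fst z, - snd z) (fst v, - snd v))))" for v
    using continuous_on_compose2[OF DX_cont c] unfolding case_prod_unfold by (auto intro!: continuous_intros)
  show "((\<lambda>z. (snd z, snd (X (- t) (fst z, - snd z)))) has_derivative (\<lambda>v. (snd v, snd (DX (- t) (fst z, - snd z) (fst v, - snd v))))) (at z)" for t z
  proof -
    have "((\<lambda>z. (fst z, - snd z)) has_derivative (\<lambda>v. (fst v, - snd v))) (at z)"
      by (auto intro!: derivative_eq_intros)
    from has_derivative_compose[OF this X_deriv] show ?thesis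
      by (intro derivative_eq_intros) (auto simp: fun_eq_iff)
  qed
  show "\<bar>snd z \<bullet> snd (snd z, snd (X (- t) (fst z, - snd z)))\<bar> \<le> M * norm (snd z)" for t z
    using power_bound[of "(fst z, - snd z)" "- t"] by simp
qed simp

context newton_field
begin

lemma is_solution_unique:
  assumes "is_solution y" "is_solution y'" "y 0 = y' 0"
  shows "y t = y' t"
proof (cases "t \<ge> 0")
  case True then show ?thesis using is_solution_unique_forward assms by blast
next
  case False
  interpret R: newton_field "\<lambda>t z. (snd z, snd (X (- t) (fst z, - snd z)))"
     "\<lambda>t z v. (snd v, snd (DX (- t) (fst z, - snd z) (fst v, - snd v)))" M
    by (rule newton_field_reversed)
  have R: "R.is_solution (\<lambda>s. (fst (z (- s)), - snd (z (- s))))" if "is_solution z" for z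
    unfolding R.is_solution_def
  proof
    fix t
    have "((\<lambda>s. z (- s)) has_vector_derivative - X (- t) (z (- t))) (at t)"
      by (rule has_vector_derivative_reflect) (use that in \<open>simp add: is_solution_def\<close>)
    then have "((\<lambda>s. (fst (z (- s)), - snd (z (- s)))) has_derivative (\<lambda>h. (fst (h *\<^sub>R - X (- t) (z (- t))), - snd (h *\<^sub>R - X (- t) (z (- t)))))) (at t)"
      unfolding has_vector_derivative_def by (intro has_derivative_Pair has_derivative_fst has_derivative_snd has_derivative_minus)
    then show "((\<lambda>s. (fst (z (- s)), - snd (z (- s)))) has_vector_derivative
      (snd (fst (z (- t)), - snd (z (- t))), snd (X (- t) (fst (fst (z (- t)), - snd (z (- t))), - snd (fst (z (- t)), - snd (z (- t))))))) (at t)"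
      by (simp add: has_vector_derivative_def fst_X scaleR_prod_def)
  qed
  have "(\<lambda>s. (fst (y (- s)), - snd (y (- s)))) (- t) = (\<lambda>s. (fst (y' (- s)), - snd (y' (- s)))) (- t)"
    by (rule R.is_solution_unique_forward) (use R assms False in auto)
  then show ?thesis by (simp add: prod_eq_iff)
qed

section \<open>The flow map and its derivative\<close>

definition flow :: "real \<Rightarrow> 'a \<times> 'a \<Rightarrow> 'a \<times> 'a" where
  "flow t z = (SOME y. is_solution y \<and> y 0 = z) t"

lemma flow_solution: "is_solution (\<lambda>t. flow t z)" and flow_0: "flow 0 z = z"
  unfolding flow_def using someI_ex[OF solution_exists[of z]] by auto

lemma flow_eqI: "is_solution y \<Longrightarrow> y 0 = z \<Longrightarrow> flow t z = y t"
  by (rule is_solution_unique[OF flow_solution]) (simp_all add: flow_0)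

lemma flow_deriv: "((\<lambda>t. flow t z) has_vector_derivative X t (flow t z)) (at t)"
  using flow_solution by (simp add: is_solution_def)

lemma flow_lipschitz:
  "\<exists>K\<ge>0. \<forall>z z'. norm z \<le> r \<longrightarrow> norm z' \<le> r \<longrightarrow> (\<forall>t\<in>{0..T}. norm (flow t z - flow t z') \<le> K * norm (z - z'))"
proof -
  obtain K where K: "\<forall>y y'. is_solution y \<longrightarrow> is_solution y' \<longrightarrow> norm (y 0) \<le> r \<longrightarrow> norm (y' 0) \<le> r
     \<longrightarrow> (\<forall>s\<in>{0..T}. (norm (y s - y' s))\<^sup>2 \<le> K * (norm (y 0 - y' 0))\<^sup>2)"
    using solutions_lipschitz by blast
  have "norm (flow t z - flow t z') \<le> sqrt \<bar>K\<bar> * norm (z - z')" if "norm z \<le> r" "norm z' \<le> r" "t \<in> {0..T}" for z z' t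
  proof -
    have "(norm (flow t z - flow t z'))\<^sup>2 \<le> K * (norm (flow 0 z - flow 0 z'))\<^sup>2"
      using K flow_solution that by (metis flow_0)
    also have "\<dots> \<le> (sqrt \<bar>K\<bar> * norm (z - z'))\<^sup>2"
      by (simp add: flow_0 power_mult_distrib mult_right_mono)
    finally show ?thesis by (rule power2_le_imp_le) simp
  qed
  then show ?thesis by (intro exI[of _ "sqrt \<bar>K\<bar>"]) auto
qed

lemma continuous_on_flow:
  assumes "T \<ge> 0" shows "continuous_on UNIV (flow T)"
proof -
  have "isCont (flow T) z" for z
  proof -
    obtain K where K: "K \<ge> 0" "\<And>z1 z2. norm z1 \<le> norm z + 1 \<Longrightarrow> norm z2 \<le> norm z + 1 \<Longrightarrow> norm (flow T z1 - flow T z2) \<le> K * norm (z1 - z2)"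
      using flow_lipschitz[of "norm z + 1" T] assms by (auto simp: Ball_def)
    have "continuous_on (ball z 1) (flow T)"
    proof (rule lipschitz_on_continuous_on)
      show "lipschitz_on K (ball z 1) (flow T)"
      proof (rule lipschitz_onI)
        fix a b assume "a \<in> ball z 1" "b \<in> ball z 1"
        then have "norm a \<le> norm z + 1" "norm b \<le> norm z + 1"
          using norm_triangle_sub[of a z] norm_triangle_sub[of b z] by (auto simp: dist_norm norm_minus_commute)
        then show "dist (flow T a) (flow T b) \<le> K * dist a b" using K by (simp add: dist_norm)
      qed (use K in simp)
    qed
    then show ?thesis by (simp add: continuous_on_eq_continuous_at)
  qed
  then show ?thesis by (simp add: continuous_at_imp_continuous_on)
qed

text \<open>The remainder has derivative \<open>DX t (g t + v) - DX t (g t)\<close> in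
  \<open>v\<close>, which \<open>k\<close> measures on the basis vectors. Uniform continuity of
  \<open>k\<close> on a compact set gives one \<open>d\<close> for all times, and the mean value
  inequality does the rest.\<close>

lemma X_linearization_along_curve:
  assumes g: "continuous_on UNIV g" and "e > 0"
  shows "\<exists>d>0. \<forall>t\<in>{0..T}. \<forall>v. norm v \<le> d \<longrightarrow> norm (X t (g t + v) - X t (g t) - DX t (g t) v) \<le> e * norm v"
proof -
  define k where "k = (\<lambda>(t, v). \<Sum>b\<in>Basis. norm (DX t (g t + v) b - DX t (g t) b))"
  have gc: "continuous_on UNIV (\<lambda>x::real \<times> 'a \<times> 'a. g (fst x))"
    by (intro continuous_on_compose2[OF g] continuous_intros) auto
  have "continuous_on UNIV (\<lambda>x::real \<times> 'a \<times> 'a. (fst x, g (fst x) + snd x))" "continuous_on UNIV (\<lambda>x::real \<times> 'a \<times> 'a. (fst x, g (fst x)))"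
    by (intro continuous_intros gc)+
  then have "continuous_on UNIV k"
    unfolding k_def case_prod_unfold
    by (intro continuous_intros continuous_on_compose2[OF DX_cont[unfolded case_prod_unfold], of _ "\<lambda>x. (fst x, g (fst x) + snd x)", simplified]
      continuous_on_compose2[OF DX_cont[unfolded case_prod_unfold], of _ "\<lambda>x. (fst x, g (fst x))", simplified]) (auto intro!: gc continuous_intros)
  then have "uniformly_continuous_on ({0..T} \<times> cball 0 1) k"
    by (intro compact_uniformly_continuous compact_Times) (auto intro: continuous_on_subset)
  then obtain d where d: "d > 0" "\<And>x x'. x \<in> {0..T} \<times> cball 0 1 \<Longrightarrow> x' \<in> {0..T} \<times> cball 0 1 \<Longrightarrow> dist x' x < d \<Longrightarrow> dist (k x') (k x) < e"
    unfolding uniformly_continuous_on_def using \<open>e > 0\<close> by metis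
  define r where "r = min 1 (d / 2)"
  have r: "r > 0" "r \<le> 1" "r < d" using d by (auto simp: r_def)
  have ke: "k (t, v) \<le> e" if "t \<in> {0..T}" "norm v \<le> r" for t v
  proof -
    have "dist (k (t, v)) (k (t, 0)) < e" by (rule d(2)) (use that r in \<open>auto simp: dist_Pair_Pair\<close>)
    moreover have "k (t, 0) = 0" by (simp add: k_def)
    ultimately show ?thesis by (simp add: dist_real_def)
  qed
  have "norm (X t (g t + v) - X t (g t) - DX t (g t) v) \<le> e * norm v" if t: "t \<in> {0..T}" and v: "norm v \<le> r" for t v
  proof -
    let ?F = "\<lambda>v. X t (g t + v) - DX t (g t) v"
    have "norm (?F v - ?F 0) \<le> e * norm (v - 0)"
    proof (rule differentiable_bound[of "cball 0 r" ?F "\<lambda>v u. DX t (g t + v) u - DX t (g t) u"])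
      fix x assume x: "x \<in> cball (0::'a \<times> 'a) r"
      have "((\<lambda>v. X t (g t + v)) has_derivative DX t (g t + x)) (at x)"
        using has_derivative_compose[of "\<lambda>v. g t + v" "\<lambda>v. v" x UNIV, OF _ X_deriv] by (simp add: has_derivative_add_const add.commute)
      moreover have "(DX t (g t) has_derivative DX t (g t)) (at x)"
        by (rule bounded_linear_imp_has_derivative[OF bounded_linear_DX])
      ultimately show "(?F has_derivative (\<lambda>u. DX t (g t + x) u - DX t (g t) u)) (at x within cball 0 r)"
        by (intro has_derivative_diff) (auto intro: has_derivative_at_withinI)
      have "onorm (\<lambda>u. DX t (g t + x) u - DX t (g t) u) \<le> (\<Sum>b\<in>Basis. norm (DX t (g t + x) b - DX t (g t) b))"
        by (rule onorm_componentwise) (intro bounded_linear_sub bounded_linear_DX)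
      also have "\<dots> \<le> e" using ke[OF t, of x] x by (simp add: k_def)
      finally show "onorm (\<lambda>u. DX t (g t + x) u - DX t (g t) u) \<le> e" .
    qed (use v r in auto)
    moreover have "DX t (g t) 0 = 0" using bounded_linear_DX linear_0 bounded_linear.linear by blast
    ultimately show ?thesis by (simp add: algebra_simps)
  qed
  then show ?thesis using r(1) by blast
qed

text \<open>A linear equation is globally Lipschitz in space, with a constant bounded on compact
  time intervals.\<close>

lemma linearized_solution_exists:
  assumes g: "continuous_on UNIV g"
  shows "\<exists>y. y 0 = v \<and> (\<forall>t. (y has_vector_derivative DX t (g t) (y t)) (at t))"
proof (rule global_solution_exists[of "\<lambda>t. DX t (g t)"])
  have gc: "continuous_on UNIV (\<lambda>x::real \<times> 'a \<times> 'a. (fst x, g (fst x)))"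
    by (intro continuous_intros continuous_on_compose2[OF g]) auto
  have DXg: "continuous_on UNIV (\<lambda>x::real \<times> 'a \<times> 'a. DX (fst x) (g (fst x)) b)" for b
    using continuous_on_compose2[OF DX_cont gc] by simp
  have rep: "DX t z w = (\<Sum>b\<in>Basis. (w \<bullet> b) *\<^sub>R DX t z b)" for t z w
  proof -
    interpret bounded_linear "DX t z" by (rule bounded_linear_DX)
    show ?thesis using euclidean_representation[of w] by (metis (no_types, lifting) sum sum.cong scaleR)
  qed
  show "continuous_on UNIV (\<lambda>(t, w). DX t (g t) w)"
    unfolding case_prod_unfold rep[of _ _ "snd _"] by (intro continuous_intros DXg)
  fix T
  have gc': "continuous_on UNIV (\<lambda>t. (t, g t))" by (intro continuous_intros g)
  have "continuous_on {-T..T} (\<lambda>t. \<Sum>b\<in>Basis. norm (DX t (g t) b))"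
    using continuous_on_compose2[OF DX_sum_cont gc'] by (auto intro: continuous_on_subset)
  then have "bounded ((\<lambda>t. \<Sum>b\<in>Basis. norm (DX t (g t) b)) ` {-T..T})"
    by (intro compact_imp_bounded compact_continuous_image) auto
  then obtain L where L: "\<And>t. t \<in> {-T..T} \<Longrightarrow> \<bar>\<Sum>b\<in>Basis. norm (DX t (g t) b)\<bar> \<le> L"
    unfolding bounded_iff by fastforce
  have "norm (DX t (g t) z - DX t (g t) z') \<le> max L 0 * norm (z - z')" if "\<bar>t\<bar> \<le> T" for t z z'
  proof -
    have "DX t (g t) z - DX t (g t) z' = DX t (g t) (z - z')"
      using bounded_linear_DX linear_diff bounded_linear.linear by metis
    also have "norm \<dots> \<le> onorm (DX t (g t)) * norm (z - z')" by (rule onorm[OF bounded_linear_DX])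
    also have "onorm (DX t (g t)) \<le> (\<Sum>b\<in>Basis. norm (DX t (g t) b))" by (rule onorm_componentwise[OF bounded_linear_DX])
    also have "\<dots> \<le> max L 0" using L[of t] that by (auto simp: abs_le_iff)
    finally show ?thesis by (simp add: mult_right_mono)
  qed
  then show "\<exists>L\<ge>0. \<forall>t z z'. \<bar>t\<bar> \<le> T \<longrightarrow> norm (DX t (g t) z - DX t (g t) z') \<le> L * norm (z - z')"
    by (intro exI[of _ "max L 0"]) auto
qed

text \<open>\<open>K\<close> depends on \<open>g\<close> and \<open>T\<close> alone. With
  \<open>q = 0\<close> and zero initial value the bound is uniqueness, hence linearity of the
  solution operator; with small \<open>q\<close> it controls the error of the linearization.\<close>

lemma linearized_solution_bound:
  assumes g: "continuous_on UNIV g" and "T \<ge> 0"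
  shows "\<exists>K\<ge>0. \<forall>r q c. c \<ge> 0 \<longrightarrow> (\<forall>t\<in>{0..T}. (r has_vector_derivative DX t (g t) (r t) + q t) (at t) \<and> norm (q t) \<le> c)
     \<longrightarrow> (norm (r T))\<^sup>2 \<le> K * ((norm (r 0))\<^sup>2 + c\<^sup>2 * T)"
proof -
  have gc': "continuous_on UNIV (\<lambda>t. (t, g t))" by (intro continuous_intros g)
  have "continuous_on {0..T} (\<lambda>t. \<Sum>b\<in>Basis. norm (DX t (g t) b))"
    using continuous_on_compose2[OF DX_sum_cont gc'] by (auto intro: continuous_on_subset)
  then have "bounded ((\<lambda>t. \<Sum>b\<in>Basis. norm (DX t (g t) b)) ` {0..T})"
    by (intro compact_imp_bounded compact_continuous_image) auto
  then obtain L where L: "\<And>t. t \<in> {0..T} \<Longrightarrow> \<bar>\<Sum>b\<in>Basis. norm (DX t (g t) b)\<bar> \<le> L"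
    unfolding bounded_iff by fastforce
  have L0: "L \<ge> 0" using L[of 0] \<open>T \<ge> 0\<close> by auto
  have "(norm (r T))\<^sup>2 \<le> exp ((2 * L + 1) * T) * ((norm (r 0))\<^sup>2 + c\<^sup>2 * T)"
    if "c \<ge> 0" and q: "\<And>t. t \<in> {0..T} \<Longrightarrow> (r has_vector_derivative DX t (g t) (r t) + q t) (at t)" "\<And>t. t \<in> {0..T} \<Longrightarrow> norm (q t) \<le> c"
    for r q c
  proof (rule gronwall_norm_sq[OF \<open>T \<ge> 0\<close> _ _ q(1)])
    fix t assume t: "t \<in> {0..T}"
    have "norm (DX t (g t) (r t)) \<le> onorm (DX t (g t)) * norm (r t)" by (rule onorm[OF bounded_linear_DX])
    also have "onorm (DX t (g t)) \<le> (\<Sum>b\<in>Basis. norm (DX t (g t) b))" by (rule onorm_componentwise[OF bounded_linear_DX])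
    also have "\<dots> \<le> L" using L[OF t] by (auto simp: abs_le_iff)
    finally have 1: "norm (DX t (g t) (r t)) \<le> L * norm (r t)" by (simp add: mult_right_mono)
    have "r t \<bullet> (DX t (g t) (r t) + q t) \<le> norm (r t) * norm (DX t (g t) (r t)) + norm (r t) * norm (q t)"
      unfolding inner_add_right by (intro add_mono norm_cauchy_schwarz)
    also have "\<dots> \<le> norm (r t) * (L * norm (r t)) + norm (r t) * c"
      using 1 q(2)[OF t] by (intro add_mono mult_left_mono) auto
    finally have "2 * (r t \<bullet> (DX t (g t) (r t) + q t)) \<le> 2 * L * (norm (r t))\<^sup>2 + 2 * norm (r t) * c"
      by (simp add: power2_eq_square algebra_simps)
    moreover have "2 * norm (r t) * c \<le> (norm (r t))\<^sup>2 + c\<^sup>2" by (rule sum_squares_bound)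
    ultimately show "2 * (r t \<bullet> (DX t (g t) (r t) + q t)) \<le> (2 * L + 1) * (norm (r t))\<^sup>2 + c\<^sup>2"
      by (simp add: algebra_simps)
  qed (use L0 that in auto)
  then show ?thesis by (intro exI[of _ "exp ((2 * L + 1) * T)"] conjI allI impI) (simp, blast)
qed

text \<open>The derivative in direction \<open>v\<close> is the value at time \<open>T\<close> of
  the variational equation along the orbit of \<open>z0\<close>, started at \<open>v\<close>. The
  error \<open>r\<close> starts at \<open>0\<close> and solves the same equation with an
  inhomogeneity \<open>q\<close> that is small compared with \<open>norm (y - z0)\<close>.\<close>

theorem flow_differentiable:
  assumes "T \<ge> 0"
  shows "\<exists>D. (flow T has_derivative D) (at z0)"
proof -
  define g where "g = (\<lambda>t. flow t z0)"
  have gc: "continuous_on UNIV g"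
    using flow_deriv unfolding g_def by (meson continuous_at_imp_continuous_on has_vector_derivative_continuous)
  obtain Y where Y0: "\<And>v. Y v 0 = v" and Y: "\<And>v t. (Y v has_vector_derivative DX t (g t) (Y v t)) (at t)"
    using linearized_solution_exists[OF gc] by metis
  obtain K where K: "K \<ge> 0" "\<And>r q c. c \<ge> 0 \<Longrightarrow> (\<And>t. t \<in> {0..T} \<Longrightarrow> (r has_vector_derivative DX t (g t) (r t) + q t) (at t) \<and> norm (q t) \<le> c)
     \<Longrightarrow> (norm (r T))\<^sup>2 \<le> K * ((norm (r 0))\<^sup>2 + c\<^sup>2 * T)"
    using linearized_solution_bound[OF gc assms] by blast
  define D where "D v = Y v T" for v
  have lin: "linear D"
  proof (rule linearI)
    have DX_lin: "linear (DX t z)" for t z using bounded_linear_DX by (rule bounded_linear.linear)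
    show "D (a + b) = D a + D b" for a b
    proof -
      have "(norm ((\<lambda>t. Y (a + b) t - (Y a t + Y b t)) T))\<^sup>2 \<le> K * ((norm ((\<lambda>t. Y (a + b) t - (Y a t + Y b t)) 0))\<^sup>2 + 0\<^sup>2 * T)"
      proof (rule K(2)[where q = "\<lambda>_. 0"], simp, intro conjI)
        fix t
        have "((\<lambda>t. Y (a + b) t - (Y a t + Y b t)) has_vector_derivative DX t (g t) (Y (a + b) t) - (DX t (g t) (Y a t) + DX t (g t) (Y b t))) (at t)"
          by (intro derivative_intros Y)
        then show "((\<lambda>t. Y (a + b) t - (Y a t + Y b t)) has_vector_derivative DX t (g t) (Y (a + b) t - (Y a t + Y b t)) + 0) (at t)"
          by (simp add: linear_diff[OF DX_lin] linear_add[OF DX_lin])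
      qed simp
      then show ?thesis by (simp add: Y0 D_def)
    qed
    show "D (c *\<^sub>R a) = c *\<^sub>R D a" for c a
    proof -
      have "(norm ((\<lambda>t. Y (c *\<^sub>R a) t - c *\<^sub>R Y a t) T))\<^sup>2 \<le> K * ((norm ((\<lambda>t. Y (c *\<^sub>R a) t - c *\<^sub>R Y a t) 0))\<^sup>2 + 0\<^sup>2 * T)"
      proof (rule K(2)[where q = "\<lambda>_. 0"], simp, intro conjI)
        fix t
        have "((\<lambda>t. c *\<^sub>R Y a t) has_vector_derivative c *\<^sub>R DX t (g t) (Y a t)) (at t)"
          using bounded_linear.has_vector_derivative[OF bounded_linear_scaleR_right Y] by blast
        then have "((\<lambda>t. Y (c *\<^sub>R a) t - c *\<^sub>R Y a t) has_vector_derivative DX t (g t) (Y (c *\<^sub>R a) t) - c *\<^sub>R DX t (g t) (Y a t)) (at t)"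
          by (intro has_vector_derivative_diff Y)
        then show "((\<lambda>t. Y (c *\<^sub>R a) t - c *\<^sub>R Y a t) has_vector_derivative DX t (g t) (Y (c *\<^sub>R a) t - c *\<^sub>R Y a t) + 0) (at t)"
          by (simp add: linear_diff[OF DX_lin] linear_scale[OF DX_lin])
      qed simp
      then show ?thesis by (simp add: Y0 D_def)
    qed
  qed
  obtain L where L: "L \<ge> 0" "\<And>z t. norm z \<le> norm z0 + 1 \<Longrightarrow> t \<in> {0..T} \<Longrightarrow> norm (flow t z - flow t z0) \<le> L * norm (z - z0)"
    using flow_lipschitz[of "norm z0 + 1" T] by (metis add_increasing2 order_refl zero_le_one)
  have "(flow T has_derivative D) (at z0)"
    unfolding has_derivative_at_alt
  proof (intro conjI allI impI)
    show "bounded_linear D" using lin by (simp add: linear_conv_bounded_linear)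
    fix e :: real assume "e > 0"
    \<comment> \<open>Makes \<open>sqrt (K * T) * L * e'\<close> at most \<open>e\<close>; the
      summand \<open>1\<close> keeps the denominator positive.\<close>
    define e' where "e' = e / (sqrt (K * T) * L + 1)"
    have den: "sqrt (K * T) * L + 1 > 0" using K(1) L(1) assms by (intro add_nonneg_pos) auto
    then have "e' > 0" using \<open>e > 0\<close> by (simp add: e'_def)
    then obtain d where d: "d > 0" "\<And>t v. t \<in> {0..T} \<Longrightarrow> norm v \<le> d \<Longrightarrow> norm (X t (g t + v) - X t (g t) - DX t (g t) v) \<le> e' * norm v"
      using X_linearization_along_curve[OF gc, of e' T] by blast
    \<comment> \<open>Keeps \<open>y\<close> in the ball where \<open>L\<close> is valid and,
      through the Lipschitz bound of the flow, the deviation of the orbits below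
      \<open>d\<close>.\<close>
    define d' where "d' = min 1 (d / (L + 1))"
    have d': "d' > 0" "d' \<le> 1" "L * d' \<le> d"
    proof -
      show "d' > 0" "d' \<le> 1" using d L by (auto simp: d'_def)
      have "L * d' \<le> (L + 1) * (d / (L + 1))" using d L by (intro mult_mono) (auto simp: d'_def)
      then show "L * d' \<le> d" using L by simp
    qed
    have "norm (flow T y - flow T z0 - D (y - z0)) \<le> e * norm (y - z0)" if y: "norm (y - z0) < d'" for y
    proof -
      define r where "r = (\<lambda>t. flow t y - flow t z0 - Y (y - z0) t)"
      define q where "q = (\<lambda>t. X t (flow t y) - X t (g t) - DX t (g t) (flow t y - g t))"
      define c where "c = e' * (L * norm (y - z0))"
      have c0: "c \<ge> 0" using \<open>e' > 0\<close> L by (simp add: c_def)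
      have "norm y \<le> norm z0 + 1" using y d' norm_triangle_sub[of y z0] by simp
      then have close: "norm (flow t y - flow t z0) \<le> L * norm (y - z0)" if "t \<in> {0..T}" for t using L that by blast
      have "(norm (r T))\<^sup>2 \<le> K * ((norm (r 0))\<^sup>2 + c\<^sup>2 * T)"
      proof (rule K(2)[OF c0, where q = q], intro conjI)
        fix t assume t: "t \<in> {0..T}"
        have "(r has_vector_derivative X t (flow t y) - X t (flow t z0) - DX t (g t) (Y (y - z0) t)) (at t)"
          unfolding r_def by (intro derivative_intros flow_deriv Y)
        moreover have "X t (flow t y) - X t (flow t z0) - DX t (g t) (Y (y - z0) t) = DX t (g t) (r t) + q t"
          unfolding r_def q_def g_def by (simp add: linear_diff[OF bounded_linear.linear[OF bounded_linear_DX]])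
        ultimately show "(r has_vector_derivative DX t (g t) (r t) + q t) (at t)" by simp
        have "norm (flow t y - g t) \<le> d"
          using close[OF t] y d' L by (simp add: g_def) (meson less_imp_le mult_left_mono order_trans)
        from d(2)[OF t this] have "norm (q t) \<le> e' * norm (flow t y - g t)" by (simp add: q_def)
        also have "\<dots> \<le> c" unfolding c_def using close[OF t] \<open>e' > 0\<close> by (simp add: g_def)
        finally show "norm (q t) \<le> c" .
      qed
      then have "(norm (r T))\<^sup>2 \<le> (sqrt (K * T) * c)\<^sup>2"
        using K(1) assms by (simp add: r_def flow_0 Y0 power_mult_distrib mult_ac)
      then have "norm (r T) \<le> sqrt (K * T) * c"
        by (rule power2_le_imp_le) (use K(1) assms c0 in simp)
      also have "\<dots> = (sqrt (K * T) * L) * e' * norm (y - z0)" by (simp add: c_def)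
      also have "\<dots> \<le> e * norm (y - z0)"
      proof (rule mult_right_mono)
        have "(sqrt (K * T) * L) * e' \<le> (sqrt (K * T) * L + 1) * e'" using \<open>e' > 0\<close> by (simp add: algebra_simps)
        also have "\<dots> = e" using den by (simp add: e'_def)
        finally show "sqrt (K * T) * L * e' \<le> e" .
      qed simp
      finally show ?thesis by (simp add: r_def D_def)
    qed
    then show "\<exists>d>0. \<forall>y. norm (y - z0) < d \<longrightarrow> norm (flow T y - flow T z0 - D (y - z0)) \<le> e * norm (y - z0)"
      using d'(1) by blast
  qed
  then show ?thesis by blast
qed

end

section \<open>Smooth maps and the lifted magnetic field\<close>

lemma linear_eq_sum_Basis:
  fixes f :: "'a::euclidean_space \<Rightarrow> 'b::real_vector"
  assumes "linear f"
  shows "f v = (\<Sum>b\<in>Basis. (v \<bullet> b) *\<^sub>R f b)"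
proof -
  have "f v = f (\<Sum>b\<in>Basis. (v \<bullet> b) *\<^sub>R b)" by (simp only: euclidean_representation)
  then show ?thesis by (simp add: linear_sum[OF assms] linear_scale[OF assms])
qed

text \<open>Any derivative \<open>D\<close> may be exhibited, since by uniqueness it is the one
  named \<open>frechet_derivative\<close>.\<close>

lemma times_differentiable_on_SucI:
  assumes "\<And>x. (f has_derivative D x) (at x)" "\<And>v. times_differentiable_on n UNIV (\<lambda>x. D x v)"
  shows "times_differentiable_on (Suc n) UNIV f"
proof -
  have "frechet_derivative f (at x) = D x" for x using frechet_derivative_at[OF assms(1)] by simp
  then show ?thesis using assms by (auto simp: differentiable_def)
qed

lemma times_differentiable_on_SucD:
  assumes "times_differentiable_on (Suc n) UNIV f"
  shows "(f has_derivative frechet_derivative f (at x)) (at x)"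
    "times_differentiable_on n UNIV (\<lambda>x. frechet_derivative f (at x) v)"
  using assms by (auto simp: frechet_derivative_works)

lemma times_differentiable_on_Suc_imp:
  "times_differentiable_on (Suc n) UNIV f \<Longrightarrow> times_differentiable_on n UNIV f"
proof (induction n arbitrary: f)
  case 0
  then show ?case by (auto intro!: continuous_at_imp_continuous_on differentiable_imp_continuous_within)
next
  case (Suc n)
  show ?case by (rule times_differentiable_on_SucI[OF times_differentiable_on_SucD(1)[OF Suc.prems]])
    (use Suc in auto)
qed

lemma times_differentiable_on_const: "times_differentiable_on n UNIV (\<lambda>x. c)"
proof (induction n arbitrary: c)
  case (Suc n)
  show ?case by (rule times_differentiable_on_SucI[of _ "\<lambda>_ _. 0"]) (use Suc in auto)
qed simp

lemma times_differentiable_on_add: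
  "times_differentiable_on n UNIV f \<Longrightarrow> times_differentiable_on n UNIV g \<Longrightarrow> times_differentiable_on n UNIV (\<lambda>x. f x + g x)"
proof (induction n arbitrary: f g)
  case (Suc n)
  show ?case
    by (rule times_differentiable_on_SucI[OF has_derivative_add[OF times_differentiable_on_SucD(1)[OF Suc.prems(1)] times_differentiable_on_SucD(1)[OF Suc.prems(2)]]])
      (use Suc.prems in \<open>auto intro: Suc.IH\<close>)
qed (auto intro: continuous_intros)

lemma times_differentiable_on_sum:
  "(\<And>i. i \<in> I \<Longrightarrow> times_differentiable_on n UNIV (f i)) \<Longrightarrow> times_differentiable_on n UNIV (\<lambda>x. \<Sum>i\<in>I. f i x)"
  by (induction I rule: infinite_finite_induct)
    (auto intro: times_differentiable_on_add times_differentiable_on_const)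

lemma times_differentiable_on_bounded_linear:
  "bounded_linear L \<Longrightarrow> times_differentiable_on n UNIV f \<Longrightarrow> times_differentiable_on n UNIV (\<lambda>x. L (f x))"
proof (induction n arbitrary: f)
  case 0
  then show ?case by (auto intro: bounded_linear.continuous_on)
next
  case (Suc n)
  show ?case
    by (rule times_differentiable_on_SucI[OF bounded_linear.has_derivative[OF Suc.prems(1) times_differentiable_on_SucD(1)[OF Suc.prems(2)]]])
      (use Suc in auto)
qed

lemma times_differentiable_on_id: "times_differentiable_on n UNIV (\<lambda>x. x)"
proof (cases n)
  case (Suc m)
  show ?thesis
    unfolding Suc by (rule times_differentiable_on_SucI[OF has_derivative_ident]) (rule times_differentiable_on_const)
qed simp

lemma times_differentiable_on_scaleR:
  fixes f :: "'a::real_normed_vector \<Rightarrow> real"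
  shows "times_differentiable_on n UNIV f \<Longrightarrow> times_differentiable_on n UNIV g \<Longrightarrow> times_differentiable_on n UNIV (\<lambda>x. f x *\<^sub>R g x)"
proof (induction n arbitrary: f g)
  case (Suc n)
  show ?case
    by (rule times_differentiable_on_SucI[OF has_derivative_scaleR[OF times_differentiable_on_SucD(1)[OF Suc.prems(1)] times_differentiable_on_SucD(1)[OF Suc.prems(2)]]])
      (intro times_differentiable_on_add Suc.IH times_differentiable_on_SucD(2)[OF Suc.prems(1)] times_differentiable_on_SucD(2)[OF Suc.prems(2)]
        times_differentiable_on_Suc_imp[OF Suc.prems(1)] times_differentiable_on_Suc_imp[OF Suc.prems(2)])
qed (auto intro: continuous_intros)

lemma times_differentiable_on_Pair:
  assumes "times_differentiable_on n UNIV f" "times_differentiable_on n UNIV g"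
  shows "times_differentiable_on n UNIV (\<lambda>x. (f x, g x))"
proof -
  have "bounded_linear (\<lambda>x. (x, 0))" "bounded_linear (\<lambda>x. (0, x))"
    by (intro bounded_linear_Pair bounded_linear_ident bounded_linear_zero)+
  from times_differentiable_on_add[OF times_differentiable_on_bounded_linear[OF this(1) assms(1)] times_differentiable_on_bounded_linear[OF this(2) assms(2)]]
  show ?thesis by simp
qed

text \<open>Only \<open>f\<close> is limited to order \<open>n\<close>, which is the form that
  bootstrapping needs. Expanding \<open>?Dg (f x) (?Df x v)\<close> in a basis leaves fixed
  directions, so the induction hypothesis applies to the partial derivatives of \<open>g\<close>,
  which are again smooth.\<close>

lemma times_differentiable_on_compose:
  fixes f :: "'a::real_normed_vector \<Rightarrow> 'b::euclidean_space"
  assumes "times_differentiable_on n UNIV f" "smooth_on UNIV g"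
  shows "times_differentiable_on n UNIV (\<lambda>x. g (f x))"
  using assms
proof (induction n arbitrary: g)
  case 0
  then have "continuous_on UNIV g" by (metis smooth_on_def times_differentiable_on.simps(1))
  then show ?case using 0 by (auto intro: continuous_on_compose2)
next
  case (Suc n)
  let ?Df = "\<lambda>x. frechet_derivative f (at x)" and ?Dg = "\<lambda>y. frechet_derivative g (at y)"
  have dg: "(g has_derivative ?Dg y) (at y)" for y
    using Suc.prems(2) times_differentiable_on_SucD(1) unfolding smooth_on_def by blast
  have df: "(f has_derivative ?Df x) (at x)" for x
    using times_differentiable_on_SucD(1)[OF Suc.prems(1)] .
  show ?case
  proof (rule times_differentiable_on_SucI[OF has_derivative_compose[OF df dg]])
    fix v
    have "?Dg (f x) (?Df x v) = (\<Sum>b\<in>Basis. (?Df x v \<bullet> b) *\<^sub>R ?Dg (f x) b)" for x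
      by (rule linear_eq_sum_Basis[OF has_derivative_linear[OF dg]])
    moreover have "times_differentiable_on n UNIV (\<lambda>x. \<Sum>b\<in>Basis. (?Df x v \<bullet> b) *\<^sub>R ?Dg (f x) b)"
    proof (intro times_differentiable_on_sum times_differentiable_on_scaleR)
      fix b :: 'b
      show "times_differentiable_on n UNIV (\<lambda>x. ?Df x v \<bullet> b)"
        by (rule times_differentiable_on_bounded_linear[OF bounded_linear_inner_left times_differentiable_on_SucD(2)[OF Suc.prems(1)]])
      have "smooth_on UNIV (\<lambda>y. ?Dg y b)"
        using Suc.prems(2) times_differentiable_on_SucD(2) unfolding smooth_on_def by blast
      then show "times_differentiable_on n UNIV (\<lambda>x. ?Dg (f x) b)"
        using Suc.IH times_differentiable_on_Suc_imp[OF Suc.prems(1)] by blast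
    qed
    ultimately show "times_differentiable_on n UNIV (\<lambda>x. ?Dg (f x) (?Df x v))" by simp
  qed
qed

lemma smooth_on_compose:
  fixes f :: "'a::real_normed_vector \<Rightarrow> 'b::euclidean_space"
  shows "smooth_on UNIV f \<Longrightarrow> smooth_on UNIV g \<Longrightarrow> smooth_on UNIV (\<lambda>x. g (f x))"
  by (simp add: smooth_on_def[of _ f] smooth_on_def[of _ "\<lambda>x. g (f x)"] times_differentiable_on_compose)

lemma smooth_on_bounded_linear: "bounded_linear L \<Longrightarrow> smooth_on UNIV L"
  unfolding smooth_on_def using times_differentiable_on_bounded_linear times_differentiable_on_id by blast

lemma smooth_on_partial_derivative: "smooth_on UNIV g \<Longrightarrow> smooth_on UNIV (\<lambda>y. frechet_derivative g (at y) v)"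
  unfolding smooth_on_def using times_differentiable_on_SucD(2) by blast

lemma smooth_on_has_derivative: "smooth_on UNIV g \<Longrightarrow> (g has_derivative frechet_derivative g (at y)) (at y)"
  unfolding smooth_on_def using times_differentiable_on_SucD(1) by blast

lemma smooth_on_imp_continuous_on: "smooth_on UNIV g \<Longrightarrow> continuous_on UNIV g"
  by (metis smooth_on_def times_differentiable_on.simps(1))

text \<open>Bootstrapping: if \<open>y\<close> is \<open>n\<close> times differentiable then so is
  its velocity \<open>X t (y t)\<close>.\<close>

lemma solution_smooth:
  fixes y :: "real \<Rightarrow> 'a::euclidean_space"
  assumes "smooth_on UNIV (\<lambda>(t, z). X t z)" "\<And>t. (y has_vector_derivative X t (y t)) (at t)"
  shows "smooth_on UNIV y"
  unfolding smooth_on_def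
proof
  fix n
  show "times_differentiable_on n UNIV y"
  proof (induction n)
    case 0
    show ?case using assms(2)
      by (auto intro!: continuous_at_imp_continuous_on has_vector_derivative_continuous)
  next
    case (Suc n)
    have "times_differentiable_on n UNIV (\<lambda>t. X t (y t))"
      using times_differentiable_on_compose[OF times_differentiable_on_Pair[OF times_differentiable_on_id Suc] assms(1)] by simp
    then show ?case
      by (intro times_differentiable_on_SucI[OF assms(2)[unfolded has_vector_derivative_def]]
          times_differentiable_on_scaleR times_differentiable_on_const)
  qed
qed

lemma int_lattice_minus: "l \<in> int_lattice \<Longrightarrow> - l \<in> int_lattice"
  by (auto simp: int_lattice_def)

lemma torus_proj_eq_iff: "torus_proj x = torus_proj y \<longleftrightarrow> x - y \<in> int_lattice"
  by (simp add: torus.abs_eq_iff lattice_rel_def)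

lemma torus_proj_add_lattice: "l \<in> int_lattice \<Longrightarrow> torus_proj (x + l) = torus_proj x"
  by (simp add: torus_proj_eq_iff)

lemma torus_proj_rep: "torus_proj (torus_rep q) = q"
  by (rule Quotient_abs_rep[OF Quotient_torus])

lemma torus_rep_proj_lattice: "torus_rep (torus_proj x) - x \<in> int_lattice"
  using torus_proj_rep torus_proj_eq_iff by blast

lemma lattice_representative_in_unit_box:
  fixes x :: "'a::euclidean_space"
  obtains l where "l \<in> int_lattice" "x - l \<in> cbox 0 One"
proof
  let ?l = "\<Sum>b\<in>Basis. of_int \<lfloor>x \<bullet> b\<rfloor> *\<^sub>R b :: 'a"
  show "?l \<in> int_lattice" by (auto simp: int_lattice_def)
  show "x - ?l \<in> cbox 0 One"
    by (auto simp: mem_box inner_diff_left of_int_floor_le) (metis add.commute less_eq_real_def real_of_int_floor_add_one_ge diff_le_eq)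
qed

lemma frechet_derivative_periodic:
  fixes f :: "'a::real_normed_vector \<Rightarrow> 'b::real_normed_vector"
  assumes "\<And>x. f (x + a) = f x" "f differentiable (at x)"
  shows "frechet_derivative f (at (x + a)) = frechet_derivative f (at x)"
proof -
  have "((\<lambda>y. y + - a) has_derivative (\<lambda>v. v)) (at (x + a))"
    by (auto intro!: derivative_eq_intros)
  then have "((\<lambda>y. f (y + - a)) has_derivative frechet_derivative f (at x)) (at (x + a))"
    using has_derivative_compose[of "\<lambda>y. y + - a" "\<lambda>v. v" "x + a" UNIV f "frechet_derivative f (at x)"] assms(2)
    by (simp add: frechet_derivative_works)
  moreover have "f (y + - a) = f y" for y using assms(1)[of "y + - a"] by simp
  ultimately show ?thesis using frechet_derivative_at by fastforce
qed

section \<open>The magnetic vector field on the universal cover\<close>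

locale magnetic_system =
  fixes \<tau> :: real and \<sigma> :: "'a::euclidean_space torus_form2" and V :: "real \<Rightarrow> 'a torus \<Rightarrow> real"
  assumes tau: "\<tau> > 0" and sigma: "smooth_form2 \<sigma>" and pot: "smooth_potential \<tau> V"
begin

definition dV :: "real \<Rightarrow> 'a \<Rightarrow> 'a \<Rightarrow> real" where
  "dV t x v = frechet_derivative (\<lambda>(t, x). V t (torus_proj x)) (at (t, x)) (0, v)"

text \<open>Hamilton's equations solved for the velocity: \<open>x' = p\<close>, and the force
  paired with \<open>u\<close> is \<open>- dV u - \<sigma> p u\<close>. The sum over the basis turns
  this covector into a vector.\<close>

definition lifted_field :: "real \<Rightarrow> 'a \<times> 'a \<Rightarrow> 'a \<times> 'a" where
  "lifted_field t z = (snd z, \<Sum>b\<in>Basis. (- dV t (fst z) b - \<sigma> (torus_proj (fst z)) (snd z) b) *\<^sub>R b)"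

lemma V_smooth: "smooth_on UNIV (\<lambda>(t, x). V t (torus_proj x))"
  using pot by (simp add: smooth_potential_def)

lemma V_deriv: "((\<lambda>x. V t (torus_proj x)) has_derivative dV t x) (at x)"
proof -
  have "((\<lambda>x. (t, x)) has_derivative (\<lambda>v. (0, v))) (at x)"
    by (auto intro!: derivative_eq_intros)
  from has_derivative_compose[OF this smooth_on_has_derivative[OF V_smooth]]
  show ?thesis by (simp add: dV_def[abs_def])
qed

lemma dV_linear: "linear (dV t x)" using V_deriv has_derivative_linear by blast

lemma dV_smooth: "smooth_on UNIV (\<lambda>(t, x). dV t x v)"
  using smooth_on_partial_derivative[OF V_smooth, of "(0, v)"] by (simp add: dV_def case_prod_unfold)

lemma V_differentiable: "(\<lambda>(t, x). V t (torus_proj x)) differentiable (at y)"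
  unfolding differentiable_def using smooth_on_has_derivative[OF V_smooth] by blast

lemma dV_periodic:
  assumes "l \<in> int_lattice" shows "dV t (x + l) = dV t x"
proof -
  have "frechet_derivative (\<lambda>(t, x). V t (torus_proj x)) (at ((t, x) + (0, l))) = frechet_derivative (\<lambda>(t, x). V t (torus_proj x)) (at (t, x))"
    by (rule frechet_derivative_periodic[OF _ V_differentiable]) (auto simp: torus_proj_add_lattice assms)
  then show ?thesis by (auto simp: dV_def)
qed

lemma dV_time_periodic: "dV (t + \<tau>) x = dV t x"
proof -
  have "frechet_derivative (\<lambda>(t, x). V t (torus_proj x)) (at ((t, x) + (\<tau>, 0))) = frechet_derivative (\<lambda>(t, x). V t (torus_proj x)) (at (t, x))"
    by (rule frechet_derivative_periodic[OF _ V_differentiable]) (use pot in \<open>auto simp: smooth_potential_def\<close>)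
  then show ?thesis by (auto simp: dV_def)
qed

lemma dV_eq_sum: "dV t x v = (\<Sum>b\<in>Basis. (v \<bullet> b) * dV t x b)"
  using linear_eq_sum_Basis[OF dV_linear] unfolding real_scaleR_def .

lemma sigma_bilinear: "bilinear (\<sigma> q)" and sigma_alt: "\<sigma> q u u = 0"
  and sigma_smooth: "smooth_on UNIV (\<lambda>x. \<sigma> (torus_proj x) u v)"
  using sigma by (auto simp: smooth_form2_def smooth_torus_fun_def)

lemma sigma_eq_sum_left: "\<sigma> q u v = (\<Sum>b\<in>Basis. (u \<bullet> b) * \<sigma> q b v)"
  by (rule linear_eq_sum_Basis[of "\<lambda>u. \<sigma> q u v", unfolded real_scaleR_def]) (use sigma_bilinear in \<open>simp add: bilinear_def\<close>)

lemma sigma_eq_sum_right: "\<sigma> q u v = (\<Sum>b\<in>Basis. (v \<bullet> b) * \<sigma> q u b)"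
  by (rule linear_eq_sum_Basis[of "\<lambda>v. \<sigma> q u v", unfolded real_scaleR_def]) (use sigma_bilinear in \<open>simp add: bilinear_def\<close>)

lemma lifted_force_inner:
  "snd (lifted_field t z) \<bullet> u = - dV t (fst z) u - \<sigma> (torus_proj (fst z)) (snd z) u"
  unfolding dV_eq_sum[of t "fst z" u] sigma_eq_sum_right[of _ "snd z" u]
  by (simp add: lifted_field_def inner_sum_left flip: sum_subtractf sum_negf)
    (auto intro!: sum.cong simp: algebra_simps inner_commute)


lemma cot_differential_liouville: "cot_differential (\<lambda>m. liouville_form m B) m A = snd A \<bullet> fst B"
proof -
  have "((\<lambda>z. liouville_form (cot_proj z) B) has_derivative (\<lambda>A. snd A \<bullet> fst B)) (at (cot_rep m))"
    unfolding liouville_form_def cot_proj_def by (auto intro!: derivative_eq_intros)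
  then show ?thesis unfolding cot_differential_def using frechet_derivative_at by metis
qed

text \<open>\<open>cot_differential\<close> is evaluated at the representative chosen by
  \<open>cot_rep\<close>; periodicity of \<open>dV\<close> moves the result to an arbitrary point
  \<open>z\<close> of the fibre.\<close>

lemma cot_differential_hamiltonian:
  "cot_differential (hamiltonian V t) (cot_proj z) B = snd z \<bullet> snd B + dV t (fst z) (fst B)"
proof -
  let ?z = "cot_rep (cot_proj z)"
  have "((\<lambda>z'. hamiltonian V t (cot_proj z')) has_derivative (\<lambda>B. snd y \<bullet> snd B + dV t (fst y) (fst B))) (at y)" for y
  proof -
    have 1: "((\<lambda>z'. snd z' \<bullet> snd z' / 2) has_derivative (\<lambda>B. snd y \<bullet> snd B)) (at y)"
      by (auto intro!: derivative_eq_intros simp: inner_commute)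
    have 2: "((\<lambda>z'. V t (torus_proj (fst z'))) has_derivative (\<lambda>B. dV t (fst y) (fst B))) (at y)"
      by (rule has_derivative_compose[OF has_derivative_fst[OF has_derivative_ident] V_deriv])
    show ?thesis
      unfolding hamiltonian_def cot_proj_def fst_conv snd_conv power2_norm_eq_inner
      by (rule has_derivative_add[OF 1 2])
  qed
  from fun_cong[OF frechet_derivative_at[OF this[of ?z]], of B]
  have "cot_differential (hamiltonian V t) (cot_proj z) B = snd ?z \<bullet> snd B + dV t (fst ?z) (fst B)"
    unfolding cot_differential_def by (rule sym)
  moreover have "dV t (fst ?z) = dV t (fst z)"
    using dV_periodic[OF torus_rep_proj_lattice, of t "fst z" "fst z"] by (simp add: cot_rep_def cot_proj_def)
  ultimately show ?thesis by (simp add: cot_rep_def cot_proj_def)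
qed

text \<open>Uniqueness in the defining description is nondegeneracy of the form: vertical test
  vectors \<open>(0, v)\<close> determine the position part of \<open>A\<close>, horizontal ones
  \<open>(u, 0)\<close> its momentum part.\<close>

lemma magnetic_field_cot_proj: "magnetic_field \<sigma> V t (cot_proj z) = lifted_field t z"
  unfolding magnetic_field_def
proof (rule the_equality)
  have form: "magnetic_form \<sigma> (cot_proj z) A B = snd A \<bullet> fst B - snd B \<bullet> fst A + \<sigma> (torus_proj (fst z)) (fst A) (fst B)" for A B
    by (simp add: magnetic_form_def ext_deriv1_def cot_differential_liouville cot_proj_def)
  show "\<forall>B. magnetic_form \<sigma> (cot_proj z) (lifted_field t z) B = - cot_differential (hamiltonian V t) (cot_proj z) B"
    unfolding form cot_differential_hamiltonian lifted_force_inner by (simp add: lifted_field_def inner_commute)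
  fix A assume A: "\<forall>B. magnetic_form \<sigma> (cot_proj z) A B = - cot_differential (hamiltonian V t) (cot_proj z) B"
  have s0: "\<sigma> q u 0 = 0" for q u using sigma_bilinear by (rule bilinear_rzero)
  have d0: "dV t x 0 = 0" for x using dV_linear by (rule linear_0)
  have "fst A \<bullet> v = snd z \<bullet> v" for v
    using A[rule_format, of "(0, v)"] unfolding form cot_differential_hamiltonian by (simp add: s0 d0 inner_commute)
  then have fA: "fst A = snd z" by (metis vector_eq_rdot)
  have "snd A \<bullet> u = snd (lifted_field t z) \<bullet> u" for u
    using A[rule_format, of "(u, 0)"] unfolding form cot_differential_hamiltonian lifted_force_inner by (simp add: fA)
  then have "snd A = snd (lifted_field t z)" by (metis vector_eq_rdot)
  then show "A = lifted_field t z" using fA by (simp add: prod_eq_iff lifted_field_def)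
qed

lemma lifted_field_periodic: "l \<in> int_lattice \<Longrightarrow> lifted_field t (z + (l, 0)) = lifted_field t z"
  by (simp add: lifted_field_def dV_periodic torus_proj_add_lattice)

lemma lifted_field_time_periodic: "lifted_field (t + \<tau>) z = lifted_field t z"
  by (simp add: lifted_field_def dV_time_periodic)

lemma lifted_field_smooth: "smooth_on UNIV (\<lambda>(t, z). lifted_field t z)"
  unfolding smooth_on_def
proof
  fix n
  have L: "smooth_on UNIV (\<lambda>x::real \<times> 'a \<times> 'a. fst (snd x))" "smooth_on UNIV (\<lambda>x::real \<times> 'a \<times> 'a. (fst x, fst (snd x)))"
    by (intro smooth_on_bounded_linear bounded_linear_intros)+
  have d: "times_differentiable_on n UNIV (\<lambda>x::real \<times> 'a \<times> 'a. dV (fst x) (fst (snd x)) b)" for b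
    using smooth_on_compose[OF L(2) dV_smooth[of b]] by (simp add: smooth_on_def)
  have s: "times_differentiable_on n UNIV (\<lambda>x::real \<times> 'a \<times> 'a. \<sigma> (torus_proj (fst (snd x))) c b)" for c b
    using smooth_on_compose[OF L(1) sigma_smooth] by (simp add: smooth_on_def)
  have p: "times_differentiable_on n UNIV (\<lambda>x::real \<times> 'a \<times> 'a. snd (snd x))"
    by (rule times_differentiable_on_bounded_linear[OF bounded_linear_compose[OF bounded_linear_snd bounded_linear_snd] times_differentiable_on_id])
  have pb: "times_differentiable_on n UNIV (\<lambda>x::real \<times> 'a \<times> 'a. snd (snd x) \<bullet> b)" for b
    by (rule times_differentiable_on_bounded_linear[OF bounded_linear_inner_left p])
  have sp: "times_differentiable_on n UNIV (\<lambda>x::real \<times> 'a \<times> 'a. \<Sum>c\<in>Basis. (snd (snd x) \<bullet> c) *\<^sub>R \<sigma> (torus_proj (fst (snd x))) c b)" for b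
    by (intro times_differentiable_on_sum times_differentiable_on_scaleR s pb)
  \<comment> \<open>Smoothness of \<open>\<sigma>\<close> is available for fixed arguments only, so
    the momentum argument is expanded in the basis.\<close>
  have eq: "(\<lambda>(t, z). lifted_field t z) = (\<lambda>x. (snd (snd x), \<Sum>b\<in>Basis. ((-1) *\<^sub>R dV (fst x) (fst (snd x)) b
       + (-1) *\<^sub>R (\<Sum>c\<in>Basis. (snd (snd x) \<bullet> c) *\<^sub>R \<sigma> (torus_proj (fst (snd x))) c b)) *\<^sub>R b))"
    unfolding lifted_field_def sigma_eq_sum_left[of _ "snd _"] by (simp add: case_prod_unfold)
  show "times_differentiable_on n UNIV (\<lambda>(t, z). lifted_field t z)"
    unfolding eq
    by (intro times_differentiable_on_Pair p times_differentiable_on_sum times_differentiable_on_scaleR times_differentiable_on_add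
        times_differentiable_on_const d sp)
qed

text \<open>Periodicity in time and space reduces the bound to the compact set
  \<open>{0..\<tau>} \<times> cbox 0 One\<close>.\<close>

lemma dV_bounded: "\<exists>M\<ge>0. \<forall>t x v. \<bar>dV t x v\<bar> \<le> M * norm v"
proof -
  let ?S = "\<lambda>(t, x). \<Sum>b\<in>Basis. \<bar>dV t x b\<bar>"
  have "continuous_on UNIV ?S"
    using smooth_on_imp_continuous_on[OF dV_smooth] unfolding case_prod_unfold by (intro continuous_intros) auto
  then have "compact (?S ` ({0..\<tau>} \<times> cbox 0 One))"
    by (intro compact_continuous_image compact_Times) (auto intro: continuous_on_subset)
  then have "bounded (?S ` ({0..\<tau>} \<times> cbox 0 One))" by (rule compact_imp_bounded)
  then obtain M where M: "\<And>t x. t \<in> {0..\<tau>} \<Longrightarrow> x \<in> cbox 0 One \<Longrightarrow> \<bar>\<Sum>b\<in>Basis. \<bar>dV t x b\<bar>\<bar> \<le> M"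
    unfolding bounded_iff by fastforce
  have per: "dV (t + of_int k * \<tau>) x = dV t x" for t k x
  proof (induction k rule: int_induct[where k=0])
    case (step1 i)
    then show ?case using dV_time_periodic[of "t + of_int i * \<tau>" x] by (simp add: algebra_simps)
  next
    case (step2 i)
    then show ?case using dV_time_periodic[of "t + of_int (i - 1) * \<tau>" x] by (simp add: algebra_simps)
  qed simp
  have "\<bar>dV t x v\<bar> \<le> M * norm v" for t x v
  proof -
    obtain l where l: "l \<in> int_lattice" "x - l \<in> cbox 0 One" by (rule lattice_representative_in_unit_box)
    define k where "k = \<lfloor>t / \<tau>\<rfloor>"
    define s where "s = t - of_int k * \<tau>"
    have "of_int k \<le> t / \<tau>" "t / \<tau> \<le> of_int k + 1" by (simp_all add: k_def)
    then have s: "s \<in> {0..\<tau>}" using tau by (auto simp: s_def field_simps)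
    have dVe: "dV t x = dV s (x - l)"
      using per[of s k x] dV_periodic[OF l(1), of s "x - l"] by (simp add: s_def)
    have "\<bar>dV t x v\<bar> \<le> (\<Sum>b\<in>Basis. \<bar>(v \<bullet> b) * dV t x b\<bar>)"
      unfolding dV_eq_sum[of t x v] by (rule sum_abs)
    also have "\<dots> \<le> (\<Sum>b\<in>Basis. norm v * \<bar>dV t x b\<bar>)"
      by (intro sum_mono) (simp add: abs_mult Basis_le_norm mult_right_mono)
    also have "\<dots> = norm v * (\<Sum>b\<in>Basis. \<bar>dV s (x - l) b\<bar>)" by (simp add: sum_distrib_left dVe)
    also have "\<dots> \<le> norm v * M" using M[OF s l(2)] by (intro mult_left_mono) auto
    finally show ?thesis by (simp add: mult.commute)
  qed
  moreover from this have "M \<ge> 0"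
  proof -
    obtain b :: 'a where "b \<in> Basis" using nonempty_Basis by blast
    then show ?thesis using \<open>\<And>v x t. \<bar>dV t x v\<bar> \<le> M * norm v\<close>[of 0 0 b] by (simp add: order_trans[OF abs_ge_zero])
  qed
  ultimately show ?thesis by blast
qed

definition force_bound :: real where "force_bound = (SOME M. M \<ge> 0 \<and> (\<forall>t x v. \<bar>dV t x v\<bar> \<le> M * norm v))"

lemma force_bound: "force_bound \<ge> 0" "\<bar>dV t x v\<bar> \<le> force_bound * norm v"
  using someI_ex[OF dV_bounded] by (auto simp: force_bound_def)

sublocale newton_field lifted_field
  "\<lambda>t z v. frechet_derivative (\<lambda>(t, z). lifted_field t z) (at (t, z)) (0, v)" force_bound
proof
  show "continuous_on UNIV (\<lambda>(t, z). lifted_field t z)"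
    by (rule smooth_on_imp_continuous_on[OF lifted_field_smooth])
  show "continuous_on UNIV (\<lambda>(t, z). frechet_derivative (\<lambda>(t, z). lifted_field t z) (at (t, z)) (0, v))" for v
    using smooth_on_imp_continuous_on[OF smooth_on_partial_derivative[OF lifted_field_smooth, of "(0, v)"]]
    by (simp add: case_prod_unfold)
  fix t :: real and z :: "'a \<times> 'a"
  have "((\<lambda>z. (t, z)) has_derivative (\<lambda>v. (0, v))) (at z)"
    by (auto intro!: derivative_eq_intros)
  from has_derivative_compose[OF this smooth_on_has_derivative[OF lifted_field_smooth]]
  show "(lifted_field t has_derivative (\<lambda>v. frechet_derivative (\<lambda>(t, z). lifted_field t z) (at (t, z)) (0, v))) (at z)"
    by simp
  show "fst (lifted_field t z) = snd z" by (simp add: lifted_field_def)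
  \<comment> \<open>As \<open>\<sigma> q p p = 0\<close>, only the force of the potential does
    work.\<close>
  show "\<bar>snd z \<bullet> snd (lifted_field t z)\<bar> \<le> force_bound * norm (snd z)"
    using lifted_force_inner[of t z "snd z"] force_bound(2)[of t "fst z" "snd z"] by (simp add: sigma_alt inner_commute)
qed

lemma flow_smooth: "smooth_on UNIV (\<lambda>t. flow t z)"
  by (rule solution_smooth[OF lifted_field_smooth flow_deriv])

lemma flow_add_lattice: "l \<in> int_lattice \<Longrightarrow> flow t (z + (l, 0)) = flow t z + (l, 0)"
  by (rule flow_eqI) (auto simp: is_solution_def lifted_field_periodic flow_0 intro!: derivative_eq_intros flow_deriv)

text \<open>The field has period \<open>\<tau>\<close> in time, so the shifted curve is a solution;
  it starts at a lattice translate of \<open>z\<close>, and translation commutes with the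
  flow.\<close>

lemma flow_periodic_orbit:
  assumes "flow \<tau> z = z + (h, 0)" "h \<in> int_lattice"
  shows "flow (t + \<tau>) z = flow t z + (h, 0)"
proof -
  have "is_solution (\<lambda>t. flow (t + \<tau>) z)"
    unfolding is_solution_def
  proof
    fix t
    have "((\<lambda>t. t + \<tau>) has_vector_derivative 1) (at t)" by (auto intro!: derivative_eq_intros)
    from vector_diff_chain_at[OF this flow_deriv]
    show "((\<lambda>t. flow (t + \<tau>) z) has_vector_derivative lifted_field t (flow (t + \<tau>) z)) (at t)"
      by (simp add: o_def lifted_field_time_periodic)
  qed
  then have "flow t (flow (0 + \<tau>) z) = flow (t + \<tau>) z" by (rule flow_eqI) simp
  then show ?thesis using assms by (simp add: flow_add_lattice)
qed

end

section \<open>Lifting curves from the torus\<close>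

lemma continuous_on_torus_proj: "continuous_on S torus_proj"
  by (rule continuous_on_subset[OF _ subset_UNIV]) (auto simp: continuous_on_open_vimage open_torus_def)

lemma continuous_on_cot_proj: "continuous_on S cot_proj"
  unfolding cot_proj_def by (intro continuous_intros continuous_on_compose2[OF continuous_on_torus_proj[of UNIV]]) auto

text \<open>The coordinate characters separate the points of the torus, so lifting a map to the
  cover becomes taking a continuous logarithm in each coordinate.\<close>

definition torus_char :: "'a::euclidean_space \<Rightarrow> 'a torus \<Rightarrow> complex" where
  "torus_char b q = exp (\<i> * of_real (2 * pi * (torus_rep q \<bullet> b)))"

lemma exp_2pi_eq_iff: "exp (\<i> * of_real (2 * pi * r)) = exp (\<i> * of_real (2 * pi * s)) \<longleftrightarrow> r - s \<in> \<int>"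
proof -
  have "exp (\<i> * of_real (2 * pi * r)) = exp (\<i> * of_real (2 * pi * s)) \<longleftrightarrow>
    (\<exists>n::int. \<i> * of_real (2 * pi * r) = \<i> * of_real (2 * pi * s) + of_real (of_int (2 * n) * pi) * \<i>)"
    by (simp only: exp_eq)
  also have "\<dots> \<longleftrightarrow> (\<exists>n::int. 2 * pi * r = 2 * pi * s + of_int (2 * n) * pi)"
    by (simp add: complex_eq_iff algebra_simps)
  also have "\<dots> \<longleftrightarrow> (\<exists>n::int. r - s = of_int n)"
  proof -
    have "2 * pi * r = 2 * pi * s + of_int (2 * n) * pi \<longleftrightarrow> r - s = of_int n" for n :: int
    proof -
      have "2 * pi * r = 2 * pi * s + of_int (2 * n) * pi \<longleftrightarrow> (2 * pi) * r = (2 * pi) * (s + of_int n)"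
        by (simp add: algebra_simps)
      also have "\<dots> \<longleftrightarrow> r = s + of_int n" by (subst mult_cancel_left) auto
      finally show ?thesis by (auto simp: algebra_simps)
    qed
    then show ?thesis by blast
  qed
  also have "\<dots> \<longleftrightarrow> r - s \<in> \<int>" by (auto simp: Ints_def)
  finally show ?thesis .
qed

lemma torus_char_proj:
  assumes "b \<in> Basis" shows "torus_char b (torus_proj x) = exp (\<i> * of_real (2 * pi * (x \<bullet> b)))"
  using torus_rep_proj_lattice[of x] assms
  unfolding torus_char_def exp_2pi_eq_iff by (simp add: int_lattice_def inner_diff_left)

lemma continuous_on_torus_char:
  assumes "b \<in> Basis" shows "continuous_on S (torus_char b)"
proof (rule continuous_on_subset[OF _ subset_UNIV])
  have c: "continuous_on UNIV (\<lambda>x. exp (\<i> * of_real (2 * pi * (x \<bullet> b))))"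
    by (intro continuous_intros)
  show "continuous_on UNIV (torus_char b)"
    unfolding continuous_on_open_vimage[OF open_UNIV]
  proof (intro allI impI)
    fix B :: "complex set" assume "open B"
    have "torus_proj -` (torus_char b -` B \<inter> UNIV) = (\<lambda>x. exp (\<i> * of_real (2 * pi * (x \<bullet> b)))) -` B"
      using assms by (auto simp: torus_char_proj)
    also have "open \<dots>" using c \<open>open B\<close> by (simp add: continuous_on_open_vimage)
    finally show "open (torus_char b -` B \<inter> UNIV)" by (simp add: open_torus_def)
  qed
qed

text \<open>A nonvanishing function on a contractible set has a continuous logarithm, and modulus
  \<open>1\<close> makes it purely imaginary.\<close>

lemma continuous_angle_lift:
  fixes f :: "'c::real_normed_vector \<Rightarrow> complex"
  assumes "continuous_on S f" "contractible S" "\<And>s. s \<in> S \<Longrightarrow> cmod (f s) = 1"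
  obtains g where "continuous_on S g" "\<And>s. s \<in> S \<Longrightarrow> f s = exp (\<i> * of_real (2 * pi * g s))"
proof -
  have "f s \<noteq> 0" if "s \<in> S" for s using assms(3)[OF that] by auto
  then obtain g where g: "continuous_on S g" "\<And>s. s \<in> S \<Longrightarrow> f s = exp (g s)"
    using continuous_logarithm_on_contractible[OF assms(1,2)] by metis
  show ?thesis
  proof
    show "continuous_on S (\<lambda>s. Im (g s) / (2 * pi))" by (intro continuous_intros g) auto
    fix s assume s: "s \<in> S"
    then have "Re (g s) = 0" using assms(3)[OF s] g(2)[OF s] by simp
    then have "g s = \<i> * of_real (2 * pi * (Im (g s) / (2 * pi)))" by (simp add: complex_eq_iff)
    then show "f s = exp (\<i> * of_real (2 * pi * (Im (g s) / (2 * pi))))" using g(2)[OF s] by simp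
  qed
qed

lemma norm_torus_char [simp]: "cmod (torus_char b q) = 1"
  by (simp add: torus_char_def)

lemma torus_proj_eqI_char:
  assumes "\<And>b. b \<in> Basis \<Longrightarrow> torus_char b q = exp (\<i> * of_real (2 * pi * (x \<bullet> b)))"
  shows "torus_proj x = q"
proof -
  have "x - torus_rep q \<in> int_lattice"
    unfolding int_lattice_def
  proof (intro CollectI ballI)
    fix b :: 'a assume "b \<in> Basis"
    then have "exp (\<i> * of_real (2 * pi * (x \<bullet> b))) = exp (\<i> * of_real (2 * pi * (torus_rep q \<bullet> b)))"
      using assms[of b] by (simp add: torus_char_def)
    then show "(x - torus_rep q) \<bullet> b \<in> \<int>" unfolding exp_2pi_eq_iff by (simp add: inner_diff_left)
  qed
  then show ?thesis using torus_proj_eq_iff torus_proj_rep by metis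
qed

text \<open>Used for the square of a homotopy of loops and for the time line of an integral curve;
  in both cases continuity is at hand in terms of the characters.\<close>

lemma continuous_torus_lift:
  fixes q :: "'c::real_normed_vector \<Rightarrow> 'a::euclidean_space torus"
  assumes "\<And>b. b \<in> Basis \<Longrightarrow> continuous_on S (\<lambda>s. torus_char b (q s))" "contractible S"
  obtains x where "continuous_on S x" "\<And>s. s \<in> S \<Longrightarrow> torus_proj (x s) = q s"
proof -
  have "\<exists>g. continuous_on S g \<and> (\<forall>s\<in>S. torus_char b (q s) = exp (\<i> * of_real (2 * pi * g s)))" if "b \<in> Basis" for b
    using continuous_angle_lift[OF assms(1)[OF that] assms(2)] by (metis norm_torus_char)
  then obtain g where g: "\<And>b. b \<in> Basis \<Longrightarrow> continuous_on S (g b)"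
    "\<And>b s. b \<in> Basis \<Longrightarrow> s \<in> S \<Longrightarrow> torus_char b (q s) = exp (\<i> * of_real (2 * pi * g b s))"
    by metis
  show ?thesis
  proof
    show "continuous_on S (\<lambda>s. \<Sum>b\<in>Basis. g b s *\<^sub>R b)" by (intro continuous_intros g)
    show "torus_proj (\<Sum>b\<in>Basis. g b s *\<^sub>R b) = q s" if "s \<in> S" for s
      by (rule torus_proj_eqI_char) (use g(2) that in simp)
  qed
qed

lemma Ints_dist_ge_1: "r \<in> \<int> \<Longrightarrow> s \<in> \<int> \<Longrightarrow> r \<noteq> s \<Longrightarrow> \<bar>r - s\<bar> \<ge> (1::real)"
  using Ints_nonzero_abs_ge1[of "r - s"] by auto

lemma continuous_Ints_valued_constant:
  fixes f :: "'c::topological_space \<Rightarrow> real"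
  assumes "connected S" "continuous_on S f" "\<And>s. s \<in> S \<Longrightarrow> f s \<in> \<int>" "s \<in> S" "s' \<in> S"
  shows "f s = f s'"
proof -
  have "f constant_on S"
    by (rule continuous_discrete_range_constant[OF assms(1,2)])
      (rule exI[of _ 1], use assms(3) in \<open>auto intro!: Ints_dist_ge_1\<close>)
  then show ?thesis using assms by (auto simp: constant_on_def)
qed

text \<open>Lattice points at distance below \<open>1\<close> coincide. This compares two lifts of
  the same map: near a point they differ by a fixed vector and hence have the same
  derivative.\<close>

lemma lattice_valued_locally_constant:
  fixes f :: "'c::metric_space \<Rightarrow> 'a::euclidean_space"
  assumes "isCont f x" "open U" "x \<in> U" "\<And>y. y \<in> U \<Longrightarrow> f y \<in> int_lattice"
  shows "\<exists>W. open W \<and> x \<in> W \<and> W \<subseteq> U \<and> (\<forall>y\<in>W. f y = f x)"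
proof -
  obtain d where d: "d > 0" "\<And>y. dist y x < d \<Longrightarrow> dist (f y) (f x) < 1"
    using assms(1) unfolding continuous_at_eps_delta by (metis zero_less_one)
  show ?thesis
  proof (intro exI[of _ "ball x d \<inter> U"] conjI ballI)
    fix y assume y: "y \<in> ball x d \<inter> U"
    show "f y = f x"
    proof (rule euclidean_eqI)
      fix b :: 'a assume b: "b \<in> Basis"
      have "\<bar>f y \<bullet> b - f x \<bullet> b\<bar> \<le> norm (f y - f x)" using b by (metis Basis_le_norm inner_diff_left)
      also have "\<dots> < 1" using d(2)[of y] y by (simp add: dist_norm[symmetric] dist_commute)
      finally show "f y \<bullet> b = f x \<bullet> b"
        using Ints_dist_ge_1[of "f y \<bullet> b" "f x \<bullet> b"] assms(3,4) y b by (force simp: int_lattice_def)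
    qed
  qed (use assms d in auto)
qed

text \<open>The straight homotopy on the cover joins the lift to the segment
  \<open>s *\<^sub>R h\<close>. Each intermediate path has end points differing by
  \<open>(h, 0)\<close>, so it closes up in the quotient.\<close>

lemma represents_lift:
  assumes "continuous_on {0..\<tau>} \<gamma>" "\<gamma> \<tau> = \<gamma> 0 + (h, 0)" "h \<in> int_lattice" "\<tau> > 0"
  shows "represents \<tau> h (\<lambda>t. cot_proj (\<gamma> t))"
proof -
  let ?K = "\<lambda>z. (1 - fst z) *\<^sub>R \<gamma> (\<tau> * snd z) + fst z *\<^sub>R (snd z *\<^sub>R h, 0)"
  have "continuous_on ({0..1} \<times> {0..1}) (\<lambda>z :: real \<times> real. \<gamma> (\<tau> * snd z))"
    by (intro continuous_on_compose2[OF assms(1)] continuous_intros)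
      (use assms(4) in \<open>auto simp: mult_left_le\<close>)
  then have "continuous_on ({0..1} \<times> {0..1}) ?K" by (intro continuous_intros)
  then have c: "continuous_on ({0..1} \<times> {0..1}) (\<lambda>z. cot_proj (?K z))"
    by (rule continuous_on_compose2[OF continuous_on_cot_proj[of UNIV]]) auto
  have "cot_proj (?K (s, 1)) = cot_proj (?K (s, 0))" for s
  proof -
    have "?K (s, 1) = ?K (s, 0) + (h, 0)" by (simp add: assms(2) algebra_simps prod_eq_iff)
    then show ?thesis by (simp add: cot_proj_def torus_proj_add_lattice assms(3))
  qed
  with c show ?thesis
    unfolding represents_def homotopic_loops
    by (intro exI[of _ "\<lambda>z. cot_proj (?K z)"]) (auto simp: pathstart_def pathfinish_def zero_prod_def[symmetric])
qed

text \<open>Lifting the homotopy to the square makes the displacement of the loops continuous and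
  lattice valued, hence the same at both ends of the homotopy. At one end it is compared with
  \<open>h\<close>, at the other with \<open>\<gamma>\<close>; differences of lifts are again
  constant along the path.\<close>

lemma represents_lift_unique:
  assumes "continuous_on {0..\<tau>} \<gamma>" "\<And>t. w t = cot_proj (\<gamma> t)" "represents \<tau> h w" "\<tau> > 0"
  shows "fst (\<gamma> \<tau>) = fst (\<gamma> 0) + h"
proof -
  obtain H where H: "continuous_on ({0..1} \<times> {0..1}) H" "\<And>x. x \<in> {0..1} \<Longrightarrow> H (0::real, x::real) = w (\<tau> * x)"
    "\<And>x. x \<in> {0..1} \<Longrightarrow> H (1, x) = cot_proj (x *\<^sub>R h, 0)" "\<And>s. s \<in> {0..1} \<Longrightarrow> H (s, 1) = H (s, 0)"
    using assms(3) unfolding represents_def homotopic_loops by (auto simp: pathstart_def pathfinish_def)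
  have cs: "contractible ({0..1} \<times> {0..1} :: (real \<times> real) set)"
    by (intro convex_imp_contractible convex_Times) auto
  have Hc: "continuous_on ({0..1} \<times> {0..1}) (\<lambda>s. torus_char b (fst (H s)))" if "b \<in> Basis" for b
    by (intro continuous_on_compose2[OF continuous_on_torus_char[OF that, of UNIV]] continuous_on_fst H(1)) auto
  obtain X where X: "continuous_on ({0..1} \<times> {0..1}) X" "\<And>z. z \<in> {0..1} \<times> {0..1} \<Longrightarrow> torus_proj (X z) = fst (H z)"
    using continuous_torus_lift[OF Hc cs] by blast
  show ?thesis
  proof (rule euclidean_eqI)
    fix b :: 'a assume b: "b \<in> Basis"
    have int: "x \<bullet> b - y \<bullet> b \<in> \<int>" if "torus_proj x = torus_proj y" for x y
      using that b unfolding torus_proj_eq_iff by (simp add: int_lattice_def inner_diff_left)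
    have Xc: "continuous_on T (\<lambda>t. X (u t) \<bullet> b)" if "continuous_on T u" "u ` T \<subseteq> {0..1} \<times> {0..1}" for T and u :: "real \<Rightarrow> real \<times> real"
      using continuous_on_compose2[OF X(1) that] by (intro continuous_intros)
    have "X (0, 1) \<bullet> b - X (0, 0) \<bullet> b = X (1, 1) \<bullet> b - X (1, 0) \<bullet> b"
      by (rule continuous_Ints_valued_constant[of "{0..1}" "\<lambda>s. X (s, 1) \<bullet> b - X (s, 0) \<bullet> b"])
        (auto intro!: continuous_intros Xc int simp: X(2) H(4))
    moreover have "X (1, 0) \<bullet> b - (0 *\<^sub>R h) \<bullet> b = X (1, 1) \<bullet> b - (1 *\<^sub>R h) \<bullet> b"
      by (rule continuous_Ints_valued_constant[of "{0..1}" "\<lambda>x. X (1, x) \<bullet> b - (x *\<^sub>R h) \<bullet> b"])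
        (auto intro!: continuous_intros Xc int simp del: inner_scaleR_left simp: X(2) H(3) cot_proj_def)
    moreover have "X (0, 0) \<bullet> b - fst (\<gamma> (\<tau> * 0)) \<bullet> b = X (0, 1) \<bullet> b - fst (\<gamma> (\<tau> * 1)) \<bullet> b"
    proof (rule continuous_Ints_valued_constant[of "{0..1}" "\<lambda>x. X (0, x) \<bullet> b - fst (\<gamma> (\<tau> * x)) \<bullet> b"])
      have "continuous_on {0..1} (\<lambda>x. \<gamma> (\<tau> * x))"
        by (intro continuous_on_compose2[OF assms(1)] continuous_intros) (use assms(4) in \<open>auto simp: mult_left_le\<close>)
      then show "continuous_on {0..1} (\<lambda>x. X (0, x) \<bullet> b - fst (\<gamma> (\<tau> * x)) \<bullet> b)"
        by (intro continuous_intros Xc) auto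
    qed (auto intro!: int simp: X(2) H(2) cot_proj_def assms(2))
    ultimately show "fst (\<gamma> \<tau>) \<bullet> b = (fst (\<gamma> 0) + h) \<bullet> b" by (simp add: inner_add_left)
  qed
qed

section \<open>The flow on the cotangent bundle and its tangent map\<close>

context magnetic_system
begin

lemma integral_curve_cot_proj_flow: "integral_curve \<sigma> V (\<lambda>t. cot_proj (flow t z))"
  unfolding integral_curve_def has_velocity_def magnetic_field_cot_proj
  by (intro allI exI[of _ UNIV] exI[of _ "\<lambda>t. flow t z"] conjI ballI flow_deriv) auto

text \<open>A global lift of \<open>w\<close> differs near each time from the local lift of
  \<open>has_velocity\<close> by a constant, so it solves the lifted equation; uniqueness upstairs
  makes it a flow line.\<close>

lemma integral_curve_eq_flow:
  assumes w: "integral_curve \<sigma> V w" and z: "w 0 = cot_proj z"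
  shows "w t = cot_proj (flow t z)"
proof -
  have loc: "\<exists>U \<gamma>. open U \<and> t \<in> U \<and> (\<forall>s\<in>U. w s = cot_proj (\<gamma> s)) \<and> (\<gamma> has_vector_derivative magnetic_field \<sigma> V t (w t)) (at t)" for t
    using w by (simp add: integral_curve_def has_velocity_def)
  \<comment> \<open>The local lift attached to \<open>t\<close> is known to be differentiable at
    \<open>t\<close> alone, so continuity is obtained one time at a time.\<close>
  have sndc: "isCont (\<lambda>t. snd (w t)) t" and charc: "b \<in> Basis \<Longrightarrow> isCont (\<lambda>t. torus_char b (fst (w t))) t" for t b
  proof -
    obtain U \<gamma> where U: "open U" "t \<in> U" "\<And>s. s \<in> U \<Longrightarrow> w s = cot_proj (\<gamma> s)"
      and d: "(\<gamma> has_vector_derivative magnetic_field \<sigma> V t (w t)) (at t)"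
      using loc[of t] by blast
    have c: "isCont \<gamma> t" using d by (rule has_vector_derivative_continuous)
    have ev: "\<forall>\<^sub>F s in nhds t. s \<in> U" by (rule eventually_nhds_in_open[OF U(1,2)])
    have "isCont (\<lambda>t. snd (\<gamma> t)) t" using c by (intro continuous_intros)
    moreover have "\<forall>\<^sub>F s in nhds t. snd (w s) = snd (\<gamma> s)"
      using ev by eventually_elim (simp add: U(3) cot_proj_def)
    ultimately show "isCont (\<lambda>t. snd (w t)) t" by (simp only: isCont_cong)
    assume b: "b \<in> Basis"
    have "isCont (\<lambda>t. exp (\<i> * of_real (2 * pi * (fst (\<gamma> t) \<bullet> b)))) t" using c by (intro continuous_intros)
    moreover have "\<forall>\<^sub>F s in nhds t. torus_char b (fst (w s)) = exp (\<i> * of_real (2 * pi * (fst (\<gamma> s) \<bullet> b)))"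
      using ev by eventually_elim (simp add: U(3) cot_proj_def torus_char_proj[OF b])
    ultimately show "isCont (\<lambda>t. torus_char b (fst (w t))) t" by (simp only: isCont_cong)
  qed
  have wc: "continuous_on UNIV (\<lambda>s. torus_char b (fst (w s)))" if "b \<in> Basis" for b
    by (intro continuous_at_imp_continuous_on ballI charc[OF that])
  \<comment> \<open>The global lift is built from the characters, since local lifts attached to
    different times need not fit together.\<close>
  obtain x where x: "continuous_on UNIV x" "\<And>t. torus_proj (x t) = fst (w t)"
    by (rule continuous_torus_lift[of UNIV "\<lambda>t. fst (w t)"]) (use wc in \<open>auto intro: convex_imp_contractible\<close>)
  define g where "g t = (x t, snd (w t))" for t
  have gw: "cot_proj (g t) = w t" for t by (simp add: g_def cot_proj_def x prod_eq_iff)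
  have gc: "isCont g t" for t
    unfolding g_def using x(1) sndc by (intro continuous_Pair) (auto simp: continuous_on_eq_continuous_at)
  have "(g has_vector_derivative lifted_field t (g t)) (at t)" for t
  proof -
    obtain U \<gamma> where U: "open U" "t \<in> U" "\<And>s. s \<in> U \<Longrightarrow> w s = cot_proj (\<gamma> s)"
      and d: "(\<gamma> has_vector_derivative magnetic_field \<sigma> V t (w t)) (at t)"
      using loc[of t] by blast
    have c: "isCont \<gamma> t" using d by (rule has_vector_derivative_continuous)
    have "isCont (\<lambda>s. fst (g s) - fst (\<gamma> s)) t" using c gc by (intro continuous_intros)
    moreover have eq: "cot_proj (g s) = cot_proj (\<gamma> s)" if "s \<in> U" for s using U(3)[OF that] gw by simp
    then have "fst (g s) - fst (\<gamma> s) \<in> int_lattice" if "s \<in> U" for s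
      using that by (simp add: cot_proj_def torus_proj_eq_iff)
    ultimately obtain W where W: "open W" "t \<in> W" "W \<subseteq> U" "\<And>s. s \<in> W \<Longrightarrow> fst (g s) - fst (\<gamma> s) = fst (g t) - fst (\<gamma> t)"
      using lattice_valued_locally_constant[of t "\<lambda>s. fst (g s) - fst (\<gamma> s)" U] U by blast
    let ?a = "g t - \<gamma> t"
    have ga: "\<gamma> s + ?a = g s" if "s \<in> W" for s
    proof -
      have "snd (g s) = snd (\<gamma> s)" "snd (g t) = snd (\<gamma> t)" using eq[of s] eq[of t] that W U by (auto simp: cot_proj_def)
      then show ?thesis using W(4)[OF that] by (simp add: prod_eq_iff algebra_simps)
    qed
    have "((\<lambda>s. \<gamma> s + ?a) has_vector_derivative magnetic_field \<sigma> V t (w t)) (at t)"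
      using d by (auto intro!: derivative_eq_intros)
    then have "(g has_vector_derivative magnetic_field \<sigma> V t (w t)) (at t)"
      by (rule has_vector_derivative_transform_within_open[OF _ W(1,2) ga])
    then show ?thesis using magnetic_field_cot_proj[of t "g t"] gw by simp
  qed
  then have gs: "is_solution g" by (simp add: is_solution_def)
  have "cot_proj (g 0) = cot_proj z" using gw z by simp
  then obtain l where l: "l \<in> int_lattice" "g 0 = z + (l, 0)"
    using that[of "fst (g 0) - fst z"] by (auto simp: cot_proj_def torus_proj_eq_iff prod_eq_iff)
  have "w t = cot_proj (flow t (g 0))" using flow_eqI[OF gs] gw by simp
  then show ?thesis using l by (simp add: flow_add_lattice cot_proj_def torus_proj_add_lattice)
qed

lemma magnetic_flow_cot_proj: "magnetic_flow \<sigma> V t (cot_proj z) = cot_proj (flow t z)"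
proof -
  have "(THE w. integral_curve \<sigma> V w \<and> w 0 = cot_proj z) = (\<lambda>t. cot_proj (flow t z))"
    by (rule the_equality) (auto simp: integral_curve_cot_proj_flow flow_0 integral_curve_eq_flow)
  then show ?thesis by (simp add: magnetic_flow_def)
qed

lemma cot_proj_rep: "cot_proj (cot_rep m) = m"
  by (simp add: cot_proj_def cot_rep_def torus_proj_rep)

text \<open>The competing lift \<open>G\<close> in \<open>has_tangent_map\<close> differs from
  \<open>flow T\<close> by a lattice translation near the point, so its derivative is
  \<open>D\<close>; this gives the uniqueness behind the definite description.\<close>

lemma tangent_map_magnetic_flow:
  assumes D: "(flow T has_derivative D) (at (cot_rep m))"
  shows "tangent_map (magnetic_flow \<sigma> V T) m = D"
  unfolding tangent_map_def
proof (rule the_equality)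
  show "has_tangent_map (magnetic_flow \<sigma> V T) m D"
    unfolding has_tangent_map_def by (intro exI[of _ UNIV] exI[of _ "flow T"]) (use D in \<open>auto simp: magnetic_flow_cot_proj\<close>)
  fix D' assume "has_tangent_map (magnetic_flow \<sigma> V T) m D'"
  then obtain U G where U: "open U" "cot_rep m \<in> U" "\<And>z. z \<in> U \<Longrightarrow> cot_proj (flow T z) = cot_proj (G z)"
    and G: "(G has_derivative D') (at (cot_rep m))"
    unfolding has_tangent_map_def magnetic_flow_cot_proj by blast
  let ?z = "cot_rep m" and ?f = "\<lambda>z. fst (flow T z) - fst (G z)"
  have "isCont ?f ?z" using has_derivative_continuous[OF D] has_derivative_continuous[OF G] by (intro continuous_intros)
  moreover have "?f z \<in> int_lattice" if "z \<in> U" for z using U(3)[OF that] by (simp add: cot_proj_def torus_proj_eq_iff)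
  ultimately obtain W where W: "open W" "?z \<in> W" "W \<subseteq> U" "\<And>z. z \<in> W \<Longrightarrow> ?f z = ?f ?z"
    using lattice_valued_locally_constant[of ?z ?f U] U by blast
  let ?a = "flow T ?z - G ?z"
  have ga: "G z + ?a = flow T z" if "z \<in> W" for z
  proof -
    have "snd (flow T z) = snd (G z)" "snd (flow T ?z) = snd (G ?z)" using U(3)[of z] U(3)[of ?z] that W(3) U(2) by (auto simp: cot_proj_def subset_iff simp del: split_paired_All)
    then show ?thesis using W(4)[OF that] by (simp add: prod_eq_iff algebra_simps)
  qed
  have "((\<lambda>z. G z + ?a) has_derivative D') (at ?z)" using G by (auto intro!: derivative_eq_intros)
  then have "(flow T has_derivative D') (at ?z)"
    by (rule has_derivative_transform_within_open[OF _ W(1,2) ga])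
  then show "D' = D" using D by (rule has_derivative_unique)
qed

end

section \<open>Zeros of lattice-periodic maps\<close>

text \<open>The cotangent bundle of a torus is a product of cylinders. Each cylinder is a punctured plane with
  coordinate \<open>exp (p + 2 \<pi> \<i> x)\<close>, so the bundle is open in a Euclidean space, whose homology then
  replaces that of the torus.\<close>

definition plane_coord :: "'a::euclidean_space \<Rightarrow> 'a \<times> 'a \<Rightarrow> complex" where
  "plane_coord b u = of_real (fst u \<bullet> b) + \<i> * of_real (snd u \<bullet> b)"

definition cylinder_coord :: "'a::euclidean_space \<Rightarrow> 'a \<times> 'a \<Rightarrow> complex" where
  "cylinder_coord b z = of_real (snd z \<bullet> b) + \<i> * of_real (2 * pi * (fst z \<bullet> b))"

definition of_plane_coords :: "('a::euclidean_space \<Rightarrow> complex) \<Rightarrow> 'a \<times> 'a" where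
  "of_plane_coords c = (\<Sum>b\<in>Basis. Re (c b) *\<^sub>R b, \<Sum>b\<in>Basis. Im (c b) *\<^sub>R b)"

definition of_cylinder_coords :: "('a::euclidean_space \<Rightarrow> complex) \<Rightarrow> 'a \<times> 'a" where
  "of_cylinder_coords c = (\<Sum>b\<in>Basis. (Im (c b) / (2 * pi)) *\<^sub>R b, \<Sum>b\<in>Basis. Re (c b) *\<^sub>R b)"

definition cylinder_embedding :: "'a::euclidean_space \<times> 'a \<Rightarrow> 'a \<times> 'a" where
  "cylinder_embedding z = of_plane_coords (\<lambda>b. exp (cylinder_coord b z))"

text \<open>A right inverse of \<open>cylinder_embedding\<close> on the punctured planes. It jumps
  by lattice vectors across the cut of \<open>Ln\<close>, which maps periodic under the lattice do
  not notice.\<close>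

definition cylinder_chart :: "'a::euclidean_space \<times> 'a \<Rightarrow> 'a \<times> 'a" where
  "cylinder_chart u = of_cylinder_coords (\<lambda>b. Ln (plane_coord b u))"

definition punctured_planes :: "('a::euclidean_space \<times> 'a) set" where
  "punctured_planes = {u. \<forall>b\<in>Basis. plane_coord b u \<noteq> 0}"

lemma bounded_linear_plane_coord: "bounded_linear (plane_coord b)"
  unfolding plane_coord_def
  by (intro bounded_linear_add bounded_linear_compose[OF bounded_linear_of_real] bounded_linear_compose[OF bounded_linear_mult_right]
      bounded_linear_compose[OF bounded_linear_inner_left] bounded_linear_fst bounded_linear_snd)

lemma bounded_linear_cylinder_coord: "bounded_linear (cylinder_coord b)"
  unfolding cylinder_coord_def
  by (intro bounded_linear_add bounded_linear_compose[OF bounded_linear_of_real] bounded_linear_compose[OF bounded_linear_mult_right]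
      bounded_linear_compose[OF bounded_linear_inner_left] bounded_linear_fst bounded_linear_snd)

lemma plane_coord_of_plane_coords [simp]: "b \<in> Basis \<Longrightarrow> plane_coord b (of_plane_coords c) = c b"
  by (simp add: plane_coord_def of_plane_coords_def complex_eq_iff)

lemma cylinder_coord_of_cylinder_coords [simp]: "b \<in> Basis \<Longrightarrow> cylinder_coord b (of_cylinder_coords c) = c b"
  by (simp add: cylinder_coord_def of_cylinder_coords_def complex_eq_iff)

lemma plane_coord_eqI: "(\<And>b. b \<in> Basis \<Longrightarrow> plane_coord b u = plane_coord b v) \<Longrightarrow> u = v"
  unfolding prod_eq_iff euclidean_eq_iff[of "fst u"] euclidean_eq_iff[of "snd u"]
  by (auto simp: plane_coord_def complex_eq_iff)

lemma cylinder_coord_eqI: "(\<And>b. b \<in> Basis \<Longrightarrow> cylinder_coord b u = cylinder_coord b v) \<Longrightarrow> u = v"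
  unfolding prod_eq_iff euclidean_eq_iff[of "fst u"] euclidean_eq_iff[of "snd u"]
  by (auto simp: cylinder_coord_def complex_eq_iff)

lemma cylinder_embedding_in: "cylinder_embedding z \<in> punctured_planes"
  by (simp add: punctured_planes_def cylinder_embedding_def)

lemma cylinder_embedding_chart: "u \<in> punctured_planes \<Longrightarrow> cylinder_embedding (cylinder_chart u) = u"
  by (rule plane_coord_eqI) (simp add: cylinder_embedding_def cylinder_chart_def punctured_planes_def)

lemma open_punctured_planes: "open punctured_planes"
proof -
  have "open {u. plane_coord b u \<noteq> 0}" for b :: 'a
    by (intro open_Collect_neq linear_continuous_on bounded_linear_plane_coord continuous_on_const)
  then have "open (\<Inter>b\<in>Basis. {u. plane_coord b (u :: 'a \<times> 'a) \<noteq> 0})" by (intro open_INT) auto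
  moreover have "(\<Inter>b\<in>Basis. {u. plane_coord b (u :: 'a \<times> 'a) \<noteq> 0}) = punctured_planes"
    by (auto simp: punctured_planes_def)
  ultimately show ?thesis by simp
qed

lemma cylinder_embedding_eq_iff:
  "cylinder_embedding z = cylinder_embedding z' \<longleftrightarrow> cot_proj z = cot_proj z'"
proof -
  have c: "exp (cylinder_coord b z) = exp (cylinder_coord b z') \<longleftrightarrow> snd z \<bullet> b = snd z' \<bullet> b \<and> (fst z - fst z') \<bullet> b \<in> \<int>" for b
  proof -
    have "exp (cylinder_coord b z) = exp (cylinder_coord b z') \<longleftrightarrow>
        (\<exists>n::int. cylinder_coord b z = cylinder_coord b z' + of_real (of_int (2 * n) * pi) * \<i>)"
      by (simp only: exp_eq)
    also have "\<dots> \<longleftrightarrow> (\<exists>n::int. snd z \<bullet> b = snd z' \<bullet> b \<and> (2 * pi) * (fst z \<bullet> b) = (2 * pi) * (fst z' \<bullet> b + of_int n))"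
      by (simp add: cylinder_coord_def complex_eq_iff algebra_simps)
    also have "\<dots> \<longleftrightarrow> (\<exists>n::int. snd z \<bullet> b = snd z' \<bullet> b \<and> fst z \<bullet> b = fst z' \<bullet> b + of_int n)"
      by (subst mult_cancel_left) auto
    also have "\<dots> \<longleftrightarrow> snd z \<bullet> b = snd z' \<bullet> b \<and> (fst z - fst z') \<bullet> b \<in> \<int>"
      by (auto simp: Ints_def inner_diff_left algebra_simps)
    finally show ?thesis .
  qed
  have "cylinder_embedding z = cylinder_embedding z' \<longleftrightarrow> (\<forall>b\<in>Basis. exp (cylinder_coord b z) = exp (cylinder_coord b z'))"
  proof
    assume "cylinder_embedding z = cylinder_embedding z'"
    then show "\<forall>b\<in>Basis. exp (cylinder_coord b z) = exp (cylinder_coord b z')"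
      unfolding cylinder_embedding_def by (metis plane_coord_of_plane_coords)
  next
    assume "\<forall>b\<in>Basis. exp (cylinder_coord b z) = exp (cylinder_coord b z')"
    then show "cylinder_embedding z = cylinder_embedding z'"
      by (intro plane_coord_eqI) (simp add: cylinder_embedding_def)
  qed
  also have "\<dots> \<longleftrightarrow> cot_proj z = cot_proj z'"
    unfolding c by (auto simp: cot_proj_def torus_proj_eq_iff int_lattice_def euclidean_eq_iff[of "snd z" "snd z'"])
  finally show ?thesis .
qed

lemma continuous_on_of_cylinder_coords:
  "(\<And>b. b \<in> Basis \<Longrightarrow> continuous_on S (\<lambda>u. c u b)) \<Longrightarrow> continuous_on S (\<lambda>u. of_cylinder_coords (c u))"
  unfolding of_cylinder_coords_def by (intro continuous_intros) auto

lemma continuous_on_cylinder_embedding: "continuous_on S cylinder_embedding"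
  unfolding cylinder_embedding_def of_plane_coords_def
  by (intro continuous_intros linear_continuous_on bounded_linear_cylinder_coord)

lemma differentiable_cylinder_embedding: "cylinder_embedding differentiable (at z)"
proof -
  have e: "((\<lambda>z. exp (cylinder_coord b z)) has_derivative (\<lambda>v. exp (cylinder_coord b z) * cylinder_coord b v)) (at z)" for b
    using has_derivative_compose[OF bounded_linear_imp_has_derivative[OF bounded_linear_cylinder_coord]
        DERIV_exp[of "cylinder_coord b z", unfolded has_field_derivative_def]] .
  have "(cylinder_embedding has_derivative (\<lambda>v. of_plane_coords (\<lambda>b. exp (cylinder_coord b z) * cylinder_coord b v))) (at z)"
    unfolding cylinder_embedding_def[abs_def] of_plane_coords_def
    by (intro has_derivative_Pair has_derivative_sum has_derivative_scaleR_left
        bounded_linear.has_derivative[OF bounded_linear_Re] bounded_linear.has_derivative[OF bounded_linear_Im] e)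
  then show ?thesis by (auto simp: differentiable_def)
qed

lemma differentiable_cylinder_chart:
  assumes "\<And>b. b \<in> Basis \<Longrightarrow> plane_coord b u \<notin> \<real>\<^sub>\<le>\<^sub>0"
  shows "cylinder_chart differentiable (at u)"
proof -
  have e: "((\<lambda>u. Ln (plane_coord b u)) has_derivative (\<lambda>v. inverse (plane_coord b u) * plane_coord b v)) (at u)" if "b \<in> Basis" for b
    using has_derivative_compose[OF bounded_linear_imp_has_derivative[OF bounded_linear_plane_coord]
        has_field_derivative_Ln[OF assms[OF that], unfolded has_field_derivative_def]] .
  have "(cylinder_chart has_derivative (\<lambda>v. of_cylinder_coords (\<lambda>b. inverse (plane_coord b u) * plane_coord b v))) (at u)"
    unfolding cylinder_chart_def[abs_def] of_cylinder_coords_def divide_inverse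
    by (intro has_derivative_Pair has_derivative_sum has_derivative_scaleR_left has_derivative_mult_left
        bounded_linear.has_derivative[OF bounded_linear_Re] bounded_linear.has_derivative[OF bounded_linear_Im] e)
  then show ?thesis by (auto simp: differentiable_def)
qed

text \<open>Near \<open>u1\<close> the branch \<open>Ln (plane_coord b u / plane_coord b u1) + Ln
  (plane_coord b u1)\<close> is continuous, as the quotient has positive real part. It yields
  another preimage under the embedding, so it may replace the chart inside \<open>G\<close>.\<close>

lemma continuous_on_periodic_chart:
  fixes G :: "'a::euclidean_space \<times> 'a \<Rightarrow> 'b::topological_space"
  assumes "continuous_on UNIV G" "\<And>z z'. cot_proj z = cot_proj z' \<Longrightarrow> G z = G z'"
  shows "continuous_on punctured_planes (\<lambda>u. G (cylinder_chart u))"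
proof -
  have "isCont (\<lambda>u. G (cylinder_chart u)) u1" if u1: "u1 \<in> punctured_planes" for u1
  proof -
    let ?L = "\<lambda>u. of_cylinder_coords (\<lambda>b. Ln (plane_coord b u / plane_coord b u1) + Ln (plane_coord b u1))"
    define W where "W = punctured_planes \<inter> (\<Inter>b\<in>Basis. {u. 0 < Re (plane_coord b u / plane_coord b u1)})"
    have pc: "continuous_on UNIV (plane_coord b)" for b :: 'a
      by (intro linear_continuous_on bounded_linear_plane_coord)
    have op: "open {u. 0 < Re (plane_coord b u / plane_coord b u1)}" if "b \<in> Basis" for b
      using u1 that by (intro open_Collect_less continuous_intros pc) (auto simp: punctured_planes_def)
    have W: "open W"
      unfolding W_def by (intro open_Int open_INT open_punctured_planes ballI op) auto
    have u1W: "u1 \<in> W"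
      using u1 by (auto simp: W_def) (auto simp: punctured_planes_def)
    have "continuous_on W ?L"
    proof (rule continuous_on_of_cylinder_coords)
      fix b :: 'a assume b: "b \<in> Basis"
      show "continuous_on W (\<lambda>u. Ln (plane_coord b u / plane_coord b u1) + Ln (plane_coord b u1))"
      proof (intro continuous_intros)
        show "continuous_on W (\<lambda>u. plane_coord b u)" by (rule continuous_on_subset[OF pc]) simp
        show "\<forall>u\<in>W. plane_coord b u1 \<noteq> 0" using u1 b by (auto simp: punctured_planes_def)
        show "plane_coord b u / plane_coord b u1 \<notin> \<real>\<^sub>\<le>\<^sub>0" if "u \<in> W" for u
          using that b by (auto simp: W_def complex_nonpos_Reals_iff)
      qed
    qed
    then have c: "continuous_on W (\<lambda>u. G (?L u))"
      by (rule continuous_on_compose2[OF assms(1)]) auto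
    have eq: "G (?L u) = G (cylinder_chart u)" if "u \<in> W" for u
    proof (rule assms(2), subst cylinder_embedding_eq_iff[symmetric], subst cylinder_embedding_chart)
      show "u \<in> punctured_planes" using that by (simp add: W_def)
      show "cylinder_embedding (?L u) = u"
        by (rule plane_coord_eqI)
          (use that u1 in \<open>auto simp: cylinder_embedding_def exp_add W_def punctured_planes_def\<close>)
    qed
    have "continuous_on W (\<lambda>u. G (cylinder_chart u))"
      using c by (rule continuous_on_eq) (rule eq)
    then show ?thesis using W u1W by (simp add: continuous_on_eq_continuous_at)
  qed
  then show ?thesis by (simp add: continuous_at_imp_continuous_on)
qed

section \<open>Solutions modulo the lattice\<close>

text \<open>If all solutions lay over one point, \<open>?F (0, _)\<close> would have a single
  regular zero on the punctured planes. By \<open>nz\<close> the end map has none, and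
  \<open>bnd\<close> together with lattice translation confines all intermediate zeros to a compact
  set.\<close>

theorem second_zero_of_periodic_map:
  fixes G :: "'a::euclidean_space \<times> 'a \<Rightarrow> 'a \<times> 'a"
  assumes cont: "continuous_on UNIV G"
    and per: "\<And>l z. l \<in> int_lattice \<Longrightarrow> G (z + (l, 0)) = G z"
    and bnd: "\<And>s z. s \<in> {0..1} \<Longrightarrow> G z = e0 + s *\<^sub>R e1 \<Longrightarrow> norm (snd z) \<le> C"
    and nz: "\<And>z. G z \<noteq> e0 + e1"
    and z0: "G z0 = e0" and deriv: "(G has_derivative D) (at z0)" and "inj D"
  shows "\<exists>z. G z = e0 \<and> cot_proj z \<noteq> cot_proj z0"
proof (rule ccontr)
  assume "\<not> ?thesis"
  then have only: "cot_proj z = cot_proj z0" if "G z = e0" for z using that by blast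
  \<comment> \<open>The shift moves the known solution to position \<open>0\<close>. Its image then
    has positive real coordinates, off the cut of \<open>Ln\<close>, where the chart is
    differentiable.\<close>
  define g where "g z = G (z + (fst z0, 0))" for z
  have gper: "g z = g z'" if "cot_proj z = cot_proj z'" for z z'
  proof -
    have "z + (fst z0, 0) = (z' + (fst z0, 0)) + (fst z - fst z', 0)"
      using that by (simp add: cot_proj_def prod_eq_iff)
    moreover have "fst z - fst z' \<in> int_lattice" using that by (simp add: cot_proj_def torus_proj_eq_iff)
    ultimately show ?thesis unfolding g_def using per by metis
  qed
  have gc: "continuous_on UNIV g"
    unfolding g_def by (intro continuous_on_compose2[OF cont] continuous_intros) auto
  define p0 where "p0 = (0 :: 'a, snd z0)"
  have p0: "p0 + (fst z0, 0) = z0" by (simp add: p0_def prod_eq_iff)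
  define u0 where "u0 = cylinder_embedding p0"
  let ?U = "punctured_planes :: ('a \<times> 'a) set"
  let ?F = "\<lambda>z. g (cylinder_chart (snd z)) - (e0 + fst z *\<^sub>R e1)"
  \<comment> \<open>Every zero has a representative with position in the unit cell, and its momentum
    is at most \<open>C\<close>.\<close>
  let ?Z = "cylinder_embedding ` (cbox (0 :: 'a) One \<times> cball (0 :: 'a) C)"
  have pos: "plane_coord b u0 = of_real (exp (snd z0 \<bullet> b))" if "b \<in> Basis" for b
    using that by (simp add: u0_def cylinder_embedding_def cylinder_coord_def p0_def exp_of_real)
  have chart0: "cylinder_chart u0 = p0"
    by (rule cylinder_coord_eqI) (simp add: cylinder_chart_def pos Ln_of_real, simp add: cylinder_coord_def p0_def)
  have notneg: "plane_coord b u0 \<notin> \<real>\<^sub>\<le>\<^sub>0" if "b \<in> Basis" for b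
    unfolding pos[OF that] by (simp add: complex_nonpos_Reals_iff not_le)
  obtain E where E: "(cylinder_chart has_derivative E) (at u0)"
    using differentiable_cylinder_chart[OF notneg] by (auto simp: differentiable_def)
  obtain E' where E': "(cylinder_embedding has_derivative E') (at (cylinder_chart u0))"
    using differentiable_cylinder_embedding[of "cylinder_chart u0"] by (auto simp: differentiable_def)
  \<comment> \<open>Differentiating \<open>cylinder_embedding (cylinder_chart u) = u\<close> gives a
    left inverse of \<open>E\<close>.\<close>
  have "inj E"
  proof -
    have "((\<lambda>u. cylinder_embedding (cylinder_chart u)) has_derivative (\<lambda>v. E' (E v))) (at u0)"
      by (rule has_derivative_compose[OF E E'])
    moreover have "((\<lambda>u. cylinder_embedding (cylinder_chart u)) has_derivative (\<lambda>v. v)) (at u0)"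
      by (rule has_derivative_transform_within_open[OF has_derivative_ident open_punctured_planes])
        (auto simp: u0_def cylinder_embedding_in cylinder_embedding_chart)
    ultimately have "(\<lambda>v. E' (E v)) = (\<lambda>v. v)" by (rule has_derivative_unique)
    then show ?thesis by (metis injI)
  qed
  have "(g has_derivative D) (at p0)"
  proof -
    have "((\<lambda>z. z + (fst z0, 0)) has_derivative (\<lambda>v. v)) (at p0)"
      by (auto intro!: derivative_eq_intros)
    from has_derivative_compose[OF this] show ?thesis using deriv by (simp add: g_def[abs_def] p0)
  qed
  then have "((\<lambda>u. g (cylinder_chart u)) has_derivative (\<lambda>v. D (E v))) (at u0)"
    using has_derivative_compose[OF E, of g D] by (simp add: chart0)
  then have dF: "((\<lambda>u. ?F (0, u)) has_derivative (\<lambda>v. D (E v))) (at u0)"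
    by (auto intro!: derivative_eq_intros)
  have injDE: "inj (\<lambda>v. D (E v))" using \<open>inj D\<close> \<open>inj E\<close> by (metis injD injI)
  have gz: "g z = e0 \<longleftrightarrow> cot_proj z = cot_proj p0" for z
  proof
    assume "g z = e0"
    then have "cot_proj (z + (fst z0, 0)) = cot_proj (p0 + (fst z0, 0))" unfolding p0 using only by (simp add: g_def)
    then show "cot_proj z = cot_proj p0" by (simp add: cot_proj_def torus_proj_eq_iff)
  next
    assume "cot_proj z = cot_proj p0"
    then show "g z = e0" using gper[of z p0] z0 by (simp add: g_def p0)
  qed
  show False
  proof (rule no_isolated_regular_zero_if_homotopic_nonvanishing[of ?U ?Z ?F u0, OF open_punctured_planes _ _ _ _ _ _ _ dF injDE])
    show "compact ?Z"
      by (intro compact_continuous_image continuous_on_cylinder_embedding compact_Times) auto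
    show "?Z \<subseteq> ?U" using cylinder_embedding_in by blast
    show "continuous_on ({0..1} \<times> ?U) ?F"
      by (intro continuous_intros continuous_on_compose2[OF continuous_on_periodic_chart[OF gc gper]]) auto
    show "u0 \<in> ?U" by (simp add: u0_def cylinder_embedding_in)
    show "?F (1, u) \<noteq> 0" for u using nz by (simp add: g_def)
    show "?F (0, u) = 0 \<longleftrightarrow> u = u0" if "u \<in> ?U" for u
    proof -
      have "?F (0, u) = 0 \<longleftrightarrow> cot_proj (cylinder_chart u) = cot_proj p0" using gz by simp
      also have "\<dots> \<longleftrightarrow> cylinder_embedding (cylinder_chart u) = u0"
        unfolding u0_def by (simp add: cylinder_embedding_eq_iff)
      finally show ?thesis by (simp add: cylinder_embedding_chart that)
    qed
    show "u \<in> ?Z" if s: "s \<in> {0..1}" and u: "u \<in> ?U" and F: "?F (s, u) = 0" for s u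
    proof -
      have "G (cylinder_chart u + (fst z0, 0)) = e0 + s *\<^sub>R e1" using F by (simp add: g_def)
      from bnd[OF s this] have C: "norm (snd (cylinder_chart u)) \<le> C" by simp
      obtain l where l: "l \<in> int_lattice" "fst (cylinder_chart u) - l \<in> cbox 0 One"
        by (rule lattice_representative_in_unit_box)
      let ?z = "(fst (cylinder_chart u) - l, snd (cylinder_chart u))"
      have "cot_proj ?z = cot_proj (cylinder_chart u)"
        using l int_lattice_minus by (auto simp: cot_proj_def torus_proj_eq_iff)
      then have "cylinder_embedding ?z = u"
        using cylinder_embedding_eq_iff[of ?z "cylinder_chart u"] cylinder_embedding_chart[OF u] by simp
      moreover have "?z \<in> cbox 0 One \<times> cball 0 C" using l C by simp
      ultimately show ?thesis by (metis imageI)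
    qed
  qed
qed

section \<open>Periodic orbits of non-resonant magnetic systems\<close>

text \<open>The strict inequalities put \<open>\<tau> * a q\<close> between consecutive multiples of
  \<open>2 * pi\<close>, where \<open>cis\<close> is not \<open>1\<close>; compactness of the unit
  cell makes the separation uniform.\<close>

lemma cis_separated_from_1_if_non_resonant:
  fixes a :: "'a::euclidean_space torus \<Rightarrow> real"
  assumes "smooth_torus_fun a" "\<tau> > 0"
    and "\<And>q. 2 * pi * real_of_int k / \<tau> < a q \<and> a q < 2 * pi * real_of_int (k + 1) / \<tau>"
  shows "\<exists>c>0. \<forall>q. c \<le> cmod (cis (\<tau> * a q) - 1)"
proof -
  let ?f = "\<lambda>y. cmod (cis (\<tau> * a (torus_proj y)) - 1)"
  have "continuous_on UNIV (\<lambda>y. a (torus_proj y))"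
    using assms(1) by (simp add: smooth_torus_fun_def smooth_on_imp_continuous_on)
  then have "continuous_on (cbox 0 One) ?f"
    by (intro continuous_intros) (auto intro: continuous_on_subset)
  then obtain y0 where y0: "\<And>y. y \<in> cbox 0 One \<Longrightarrow> ?f y0 \<le> ?f y"
    using continuous_attains_inf[of "cbox (0::'a) One" ?f] by (auto simp: box_ne_empty)
  have "cis (\<tau> * a q) \<noteq> 1" for q
  proof
    assume "cis (\<tau> * a q) = 1"
    then obtain n :: int where "\<tau> * a q = of_int (2 * n) * pi"
      by (auto simp: cis_conv_exp exp_eq_1)
    moreover have "2 * pi * of_int k < \<tau> * a q" "\<tau> * a q < 2 * pi * of_int (k + 1)"
      using assms(3)[of q] \<open>\<tau> > 0\<close> by (auto simp: divide_simps mult.commute)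
    ultimately have "(2 * pi) * of_int k < (2 * pi) * of_int n" "(2 * pi) * of_int n < (2 * pi) * of_int (k + 1)"
      by (simp_all add: mult_ac)
    then have "(of_int k :: real) < of_int n" "(of_int n :: real) < of_int (k + 1)"
      by (simp_all only: mult_less_cancel_left_pos[of "2 * pi"] pi_gt_zero zero_less_mult_iff zero_less_numeral simp_thms)
    then have "k < n" "n < k + 1" by (simp_all only: of_int_less_iff)
    then show False by simp
  qed
  then have "?f y0 > 0" by simp
  moreover have "?f y0 \<le> cmod (cis (\<tau> * a q) - 1)" for q
  proof -
    obtain l where l: "l \<in> int_lattice" "torus_rep q - l \<in> cbox 0 One"
      by (rule lattice_representative_in_unit_box)
    have "torus_proj (torus_rep q - l) = q"
      using torus_proj_add_lattice[OF int_lattice_minus[OF l(1)], of "torus_rep q"] by (simp add: torus_proj_rep)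
    then show ?thesis using y0[OF l(2)] by simp
  qed
  ultimately show ?thesis by blast
qed

text \<open>The rate \<open>\<alpha>\<close> varies along the orbit, while the separation concerns
  single values of it. The mean value theorem bridges the two: the total angle over a period is
  \<open>\<tau> * \<alpha> s\<close> for some \<open>s\<close>.\<close>

lemma rotating_periodic_bound:
  fixes P g :: "real \<Rightarrow> complex" and \<alpha> :: "real \<Rightarrow> real"
  assumes P: "\<And>t. (P has_vector_derivative (- \<i> * of_real (\<alpha> t) * P t - g t)) (at t)"
    and \<alpha>: "continuous_on UNIV \<alpha>" and g: "\<And>t. cmod (g t) \<le> M" and "\<tau> > 0"
    and c: "c > 0" "\<And>t. c \<le> cmod (cis (\<tau> * \<alpha> t) - 1)"
    and per: "P \<tau> = P 0"
  shows "cmod (P 0) \<le> M * \<tau> / c"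
proof -
  obtain \<theta> where \<theta>: "\<theta> 0 = 0" "\<And>t. (\<theta> has_vector_derivative \<alpha> t) (at t)"
    using continuous_antiderivative[OF \<alpha>] by blast
  define Q where "Q t = cis (\<theta> t) * P t" for t
  have Q: "(Q has_vector_derivative - cis (\<theta> t) * g t) (at t)" for t
  proof -
    have "((\<lambda>t. cis (\<theta> t)) has_vector_derivative \<alpha> t *\<^sub>R (\<i> * cis (\<theta> t))) (at t)"
      using has_derivative_cis[OF \<theta>(2)[of t, unfolded has_vector_derivative_def]]
      by (simp add: has_vector_derivative_def)
    from has_vector_derivative_mult[OF this P] have "(Q has_vector_derivative cis (\<theta> t) * (- \<i> * of_real (\<alpha> t) * P t - g t) + \<alpha> t *\<^sub>R (\<i> * cis (\<theta> t)) * P t) (at t)"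
      unfolding Q_def .
    then show ?thesis by (simp add: algebra_simps scaleR_conv_of_real)
  qed
  have "norm (Q \<tau> - Q 0) \<le> M * \<bar>\<tau>\<bar> ^ Suc 0 / Suc 0"
    by (rule norm_diff_le_power[OF Q]) (use g in \<open>simp add: norm_mult\<close>)
  \<comment> \<open>Since \<open>\<theta> 0 = 0\<close> and \<open>P \<tau> = P 0\<close>, the
    difference \<open>Q \<tau> - Q 0\<close> is
    \<open>(cis (\<theta> \<tau>) - 1) * P 0\<close>.\<close>
  then have 1: "cmod (cis (\<theta> \<tau>) - 1) * cmod (P 0) \<le> M * \<tau>"
    using \<open>\<tau> > 0\<close> by (simp add: Q_def \<theta>(1) per norm_mult[symmetric] left_diff_distrib)
  obtain s where "\<theta> \<tau> - \<theta> 0 = (\<tau> - 0) * \<alpha> s"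
    using MVT2[OF \<open>\<tau> > 0\<close>, of \<theta> \<alpha>] \<theta>(2) by (auto simp: has_real_derivative_iff_has_vector_derivative)
  then have "c \<le> cmod (cis (\<theta> \<tau>) - 1)" using c(2)[of s] \<theta>(1) by simp
  then have "c * cmod (P 0) \<le> M * \<tau>" using 1 by (meson mult_right_mono norm_ge_zero order_trans)
  then show ?thesis using c(1) by (simp add: pos_le_divide_eq mult.commute)
qed

lemma bij_betw_coord_frame: "bij_betw (coord_frame :: ('n::finite \<times> 2) + ('n \<times> 2) \<Rightarrow> _) UNIV Basis"
proof (rule bij_betwI')
  fix k l :: "('n \<times> 2) + ('n \<times> 2)"
  show "coord_frame k = coord_frame l \<longleftrightarrow> k = l"
    by (cases k; cases l) (auto simp: axis_eq_axis axis_eq_0_iff)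
  show "coord_frame k \<in> Basis"
    unfolding Basis_prod_def Basis_vec_def by (cases k) (force simp: image_iff)+
next
  fix b :: "(real^2^'n) \<times> (real^2^'n)" assume "b \<in> Basis"
  then consider j i where "b = (axis j (axis i 1), 0)" | j i where "b = (0, axis j (axis i 1))"
    by (auto simp: Basis_prod_def Basis_vec_def)
  then show "\<exists>k\<in>UNIV. b = coord_frame k"
    by cases (metis UNIV_I coord_frame.simps)+
qed

text \<open>Turns the determinant condition into the injectivity used in the homological argument:
  the coordinates \<open>c\<close> of a fixed vector of \<open>D\<close> lie in the kernel of the
  invertible matrix.\<close>

lemma inj_of_det_coord_matrix:
  fixes D :: "(real^2^'n::finite) \<times> (real^2^'n) \<Rightarrow> (real^2^'n) \<times> (real^2^'n)"
  assumes "linear D" "det (coord_matrix D - mat 1) \<noteq> 0"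
  shows "inj (\<lambda>v. D v - v)"
proof -
  have lin: "linear (\<lambda>v. D v - v)" using assms(1) by (intro linear_compose_sub linear_id[unfolded id_def])
  have "u = 0" if u: "D u - u = 0" for u
  proof -
    define c where "c = (\<chi> l. u \<bullet> coord_frame l)"
    have rep: "(\<Sum>l\<in>UNIV. (v \<bullet> coord_frame l) *\<^sub>R coord_frame l) = v" for v :: "(real^2^'n) \<times> (real^2^'n)"
      using sum.reindex_bij_betw[OF bij_betw_coord_frame, of "\<lambda>b. (v \<bullet> b) *\<^sub>R b"] by (simp add: euclidean_representation)
    have "(coord_matrix D *v c) $ k = c $ k" for k
    proof -
      have "(coord_matrix D *v c) $ k = (\<Sum>l\<in>UNIV. (u \<bullet> coord_frame l) *\<^sub>R D (coord_frame l)) \<bullet> coord_frame k"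
        by (simp add: matrix_vector_mult_def coord_matrix_def c_def inner_sum_left mult.commute)
      also have "(\<Sum>l\<in>UNIV. (u \<bullet> coord_frame l) *\<^sub>R D (coord_frame l)) = D (\<Sum>l\<in>UNIV. (u \<bullet> coord_frame l) *\<^sub>R coord_frame l)"
        using assms(1) by (simp add: linear_sum linear_scale)
      also have "\<dots> = u" using u by (simp add: rep)
      finally show ?thesis by (simp add: c_def)
    qed
    then have "(coord_matrix D - mat 1) *v c = 0"
      by (simp add: matrix_vector_mult_diff_rdistrib vec_eq_iff)
    moreover have "invertible (coord_matrix D - mat 1)" using assms(2) by (simp add: invertible_det_nz)
    ultimately have "c = 0"
      using invertible_left_inverse matrix_left_invertible_ker by blast
    then have "u \<bullet> coord_frame l = 0" for l by (simp add: c_def vec_eq_iff)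
    then show "u = 0" using rep[of u] by simp
  qed
  then show ?thesis using linear_injective_0[OF lin] by blast
qed

lemma periodic_momentum_bound:
  fixes \<sigma> :: "(real^2^'n::finite) torus_form2"
  assumes "magnetic_system \<tau> \<sigma> V" "non_resonant \<tau> \<sigma>"
  shows "\<exists>C. \<forall>z. snd (newton_field.flow (magnetic_system.lifted_field \<sigma> V) \<tau> z) = snd z \<longrightarrow> norm (snd z) \<le> C"
proof -
  interpret magnetic_system \<tau> \<sigma> V by fact
  obtain s where s: "\<And>j. non_resonant2 \<tau> (s j)" "\<And>q u v. \<sigma> q u v = (\<Sum>j\<in>UNIV. pullback_component j (s j) q u v)"
    using assms(2) unfolding non_resonant_def by blast
  then have "\<forall>j. \<exists>a. smooth_torus_fun a \<and> (\<forall>q u v. s j q u v = a q * area_form q u v) \<and>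
        (\<exists>k::int. \<forall>q. 2 * pi * real_of_int k / \<tau> < a q \<and> a q < 2 * pi * real_of_int (k + 1) / \<tau>)"
    by (simp add: non_resonant2_def)
  then obtain a where a: "\<And>j. smooth_torus_fun (a j)" "\<And>j q u v. s j q u v = a j q * area_form q u v"
    "\<And>j. \<exists>k::int. \<forall>q. 2 * pi * real_of_int k / \<tau> < a j q \<and> a j q < 2 * pi * real_of_int (k + 1) / \<tau>"
    by metis
  have "\<exists>c>0. \<forall>q. c \<le> cmod (cis (\<tau> * a j q) - 1)" for j
    using a(3)[of j] cis_separated_from_1_if_non_resonant[OF a(1) tau] by blast
  then obtain c where c: "\<And>j. c j > 0" "\<And>j q. c j \<le> cmod (cis (\<tau> * a j q) - 1)" by metis
  have comp: "torus_component j (torus_proj x) = torus_proj (x $ j)" for j :: 'n and x :: "real^2^'n"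
    by (rule torus_component.abs_eq)
  \<comment> \<open>\<open>area_form\<close> is the same at every base point, so
    \<open>undefined\<close> may stand there. The other summands vanish because
    \<open>axis j v\<close> has no component in their factors.\<close>
  have sig: "\<sigma> (torus_proj x) u (axis j v) = a j (torus_proj (x $ j)) * area_form undefined (u $ j) v" for x u j v
  proof -
    have "\<sigma> (torus_proj x) u (axis j v) = (\<Sum>i\<in>UNIV. if i = j then a j (torus_proj (x $ j)) * area_form undefined (u $ j) v else 0)"
      unfolding s(2) by (intro sum.cong refl) (auto simp: pullback_component_def a(2) comp area_form_def axis_def)
    then show ?thesis by simp
  qed
  \<comment> \<open>One \<open>2\<close> comes from bounding \<open>cmod (G t)\<close> by its two
    parts, each at most \<open>force_bound\<close>; the other from bounding the planar norm by two
    coordinates, each at most \<open>cmod (P 0)\<close>.\<close>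
  have bound: "norm (snd z $ j) \<le> 2 * (2 * force_bound * \<tau> / c j)" if per: "snd (flow \<tau> z) = snd z" for z j
  proof -
    define \<alpha> where "\<alpha> t = a j (torus_proj (fst (flow t z) $ j))" for t
    define P where "P t = Complex (snd (flow t z) $ j $ 1) (snd (flow t z) $ j $ 2)" for t
    define G where "G t = Complex (dV t (fst (flow t z)) (axis j (axis 1 1))) (dV t (fst (flow t z)) (axis j (axis 2 1)))" for t
    have fc: "continuous_on UNIV (\<lambda>t. flow t z)"
      using flow_deriv by (meson continuous_at_imp_continuous_on has_vector_derivative_continuous)
    have ac: "continuous_on UNIV (\<lambda>y. a j (torus_proj y))"
      using a(1) by (simp add: smooth_torus_fun_def smooth_on_imp_continuous_on)
    have \<alpha>c: "continuous_on UNIV \<alpha>"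
      unfolding \<alpha>_def by (rule continuous_on_compose2[OF ac]) (auto intro!: continuous_intros fc)
    have force: "snd (lifted_field t y) $ j $ i = - dV t (fst y) (axis j (axis i 1)) - a j (torus_proj (fst y $ j)) * area_form undefined (snd y $ j) (axis i 1)" for t y i
      using lifted_force_inner[of t y "axis j (axis i 1)"] by (simp add: inner_axis sig)
    have "(P has_vector_derivative (- \<i> * of_real (\<alpha> t) * P t - G t)) (at t)" for t
    proof -
      have d: "((\<lambda>t. snd (flow t z) $ j $ i) has_vector_derivative snd (lifted_field t (flow t z)) $ j $ i) (at t)" for i
        by (intro bounded_linear.has_vector_derivative[OF bounded_linear_vec_nth] bounded_linear.has_vector_derivative[OF bounded_linear_snd] flow_deriv)
      have "(P has_vector_derivative (of_real (snd (lifted_field t (flow t z)) $ j $ 1) + \<i> * of_real (snd (lifted_field t (flow t z)) $ j $ 2))) (at t)"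
        unfolding P_def Complex_eq
        by (intro has_vector_derivative_add bounded_linear.has_vector_derivative[OF bounded_linear_of_real d]
          bounded_linear.has_vector_derivative[OF bounded_linear_mult_right] )
      \<comment> \<open>Pairing \<open>p\<close> with the two axes by \<open>area_form\<close> gives
        \<open>- p2\<close> and \<open>p1\<close>, so the magnetic force is multiplication of
        \<open>p1 + \<i> p2\<close> by \<open>- \<i> * \<alpha> t\<close>.\<close>
      moreover have "of_real (snd (lifted_field t (flow t z)) $ j $ 1) + \<i> * of_real (snd (lifted_field t (flow t z)) $ j $ 2) = - \<i> * of_real (\<alpha> t) * P t - G t"
        unfolding force by (simp add: complex_eq_iff P_def G_def \<alpha>_def area_form_def axis_def)
      ultimately show ?thesis by simp
    qed
    moreover have "cmod (G t) \<le> 2 * force_bound" for t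
    proof -
      have "cmod (G t) \<le> \<bar>Re (G t)\<bar> + \<bar>Im (G t)\<bar>" by (rule cmod_le)
      also have "\<dots> \<le> force_bound * norm (axis j (axis 1 1) :: real^2^'n) + force_bound * norm (axis j (axis 2 1) :: real^2^'n)"
        unfolding G_def complex.sel by (intro add_mono force_bound(2))
      finally show ?thesis by simp
    qed
    moreover have "c j \<le> cmod (cis (\<tau> * \<alpha> t) - 1)" for t unfolding \<alpha>_def by (rule c(2))
    moreover have "P \<tau> = P 0" using per by (simp add: P_def flow_0)
    ultimately have "cmod (P 0) \<le> 2 * force_bound * \<tau> / c j"
      by (intro rotating_periodic_bound[OF _ \<alpha>c _ tau c(1)])
    moreover have "norm (snd z $ j) \<le> \<bar>snd z $ j $ 1\<bar> + \<bar>snd z $ j $ 2\<bar>"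
      using norm_le_l1_cart[of "snd z $ j"] by (simp add: UNIV_2)
    moreover have "\<bar>snd z $ j $ 1\<bar> \<le> cmod (P 0)" "\<bar>snd z $ j $ 2\<bar> \<le> cmod (P 0)"
      using abs_Re_le_cmod[of "P 0"] abs_Im_le_cmod[of "P 0"] by (simp_all add: P_def flow_0)
    ultimately show ?thesis by linarith
  qed
  show ?thesis
  proof (intro exI allI impI)
    fix z assume "snd (flow \<tau> z) = snd z"
    then have "(\<Sum>j\<in>UNIV. norm (snd z $ j)) \<le> (\<Sum>j\<in>UNIV. 2 * (2 * force_bound * \<tau> / c j))"
      by (intro sum_mono bound)
    moreover have "norm (snd z) \<le> (\<Sum>j\<in>UNIV. norm (snd z $ j))"
      unfolding norm_vec_def by (rule L2_set_le_sum) simp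
    ultimately show "norm (snd z) \<le> (\<Sum>j\<in>UNIV. 2 * (2 * force_bound * \<tau> / c j))" by linarith
  qed
qed

section \<open>The second periodic orbit\<close>

theorem mainTheorem4:
  fixes \<tau> :: real
    and \<sigma> :: "(real^2^'n::finite) torus_form2"
    and V :: "real \<Rightarrow> (real^2^'n) torus \<Rightarrow> real"
    and h :: "real^2^'n"
    and w :: "real \<Rightarrow> (real^2^'n) cotangent"
  assumes "\<tau> > 0"
    and "smooth_form2 \<sigma>"
    and "non_resonant \<tau> \<sigma>"
    and "smooth_potential \<tau> V"
    and "h \<in> int_lattice"
    and "h \<noteq> 0"
    and "w \<in> periodic_orbits_in \<tau> h \<sigma> V"
    and "nondegenerate \<tau> \<sigma> V w"
  shows "infinite (periodic_orbits_in \<tau> h \<sigma> V) \<or> card (periodic_orbits_in \<tau> h \<sigma> V) \<ge> 2"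
proof -
  interpret magnetic_system \<tau> \<sigma> V by standard (use assms in auto)
  define z0 where "z0 = cot_rep (w 0)"
  have w: "\<And>t. w (t + \<tau>) = w t" "integral_curve \<sigma> V w" "represents \<tau> h w"
    using assms(7) by (auto simp: periodic_orbits_in_def periodic_orbits_def)
  have z0: "cot_proj z0 = w 0" by (simp add: z0_def cot_proj_rep)
  have wf: "w t = cot_proj (flow t z0)" for t
    by (rule integral_curve_eq_flow[OF w(2) z0[symmetric]])
  have fc: "continuous_on S (\<lambda>t. flow t z)" for S z
    using flow_deriv by (meson continuous_at_imp_continuous_on has_vector_derivative_continuous)
  have "fst (flow \<tau> z0) = fst (flow 0 z0) + h"
    by (rule represents_lift_unique[OF fc wf w(3) tau])
  moreover have "snd (flow \<tau> z0) = snd z0"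
  proof -
    have "cot_proj (flow \<tau> z0) = cot_proj z0" using w(1)[of 0] wf[of \<tau>] z0 by simp
    then show ?thesis by (simp add: cot_proj_def)
  qed
  ultimately have per0: "flow \<tau> z0 = z0 + (h, 0)" by (simp add: prod_eq_iff flow_0)
  obtain D where D: "(flow \<tau> has_derivative D) (at z0)"
    using flow_differentiable[of \<tau> z0] tau by auto
  \<comment> \<open>\<open>z0\<close> is the representative at which the tangent map is computed, so
    nondegeneracy of \<open>w\<close> is a statement about \<open>D\<close>.\<close>
  have "inj (\<lambda>v. D v - v)"
    using assms(8) tangent_map_magnetic_flow[of \<tau> D "w 0"] D
    by (intro inj_of_det_coord_matrix has_derivative_linear[OF D]) (simp add: nondegenerate_def z0_def)
  obtain C where C: "\<And>z. snd (flow \<tau> z) = snd z \<Longrightarrow> norm (snd z) \<le> C"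
    using periodic_momentum_bound[OF magnetic_system_axioms assms(3)] by blast
  \<comment> \<open>When the momentum returns, the speed is at most \<open>radius C \<tau>\<close>
    during the whole period, so the displacement is at most \<open>B\<close>.\<close>
  define B where "B = radius C \<tau> * \<tau>"
  have B: "B \<ge> 0" using radius_pos[of C \<tau>] tau by (simp add: B_def)
  have disp: "norm (fst (flow \<tau> z) - fst z) \<le> B" if "snd (flow \<tau> z) = snd z" for z
  proof -
    have "norm (fst (flow \<tau> z) - fst z) \<le> radius (norm (snd z)) \<tau> * \<tau>"
      using solution_bounds(2)[OF flow_solution[of z], of \<tau>] tau by (simp add: flow_0)
    also have "\<dots> \<le> B"
      unfolding B_def using C[OF that] tau by (intro mult_right_mono radius_mono) auto
    finally show ?thesis .
  qed
  \<comment> \<open>With this factor \<open>norm (h + r *\<^sub>R h) = norm h + B\<close>, which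
    exceeds every possible displacement.\<close>
  define r where "r = B / norm h"
  have "\<exists>z. flow \<tau> z - z = (h, 0) \<and> cot_proj z \<noteq> cot_proj z0"
  proof (rule second_zero_of_periodic_map[of "\<lambda>z. flow \<tau> z - z" "(h, 0)" "(r *\<^sub>R h, 0)" C z0])
    show "continuous_on UNIV (\<lambda>z. flow \<tau> z - z)"
      using continuous_on_flow[of \<tau>] tau by (intro continuous_intros) auto
    show "flow \<tau> (z + (l, 0)) - (z + (l, 0)) = flow \<tau> z - z" if "l \<in> int_lattice" for l z
      using that by (simp add: flow_add_lattice)
    show "norm (snd z) \<le> C" if "flow \<tau> z - z = (h, 0) + s *\<^sub>R (r *\<^sub>R h, 0)" for s z
      using that by (intro C) (simp add: prod_eq_iff)
    show "flow \<tau> z - z \<noteq> (h, 0) + (r *\<^sub>R h, 0)" for z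
    proof
      assume eq: "flow \<tau> z - z = (h, 0) + (r *\<^sub>R h, 0)"
      then have "norm (h + r *\<^sub>R h) \<le> B" using disp[of z] by (simp add: prod_eq_iff)
      moreover have "h + r *\<^sub>R h = (1 + r) *\<^sub>R h" by (simp add: algebra_simps)
      moreover have "(1 + r) * norm h = norm h + B" using assms(6) by (simp add: r_def algebra_simps)
      moreover have "1 + r \<ge> 0" using B by (simp add: r_def)
      ultimately show False using assms(6) by simp
    qed
    show "flow \<tau> z0 - z0 = (h, 0)" by (simp add: per0)
    show "((\<lambda>z. flow \<tau> z - z) has_derivative (\<lambda>v. D v - v)) (at z0)"
      by (intro has_derivative_diff D has_derivative_ident)
  qed fact
  then obtain z1 where z1: "flow \<tau> z1 = z1 + (h, 0)" "cot_proj z1 \<noteq> cot_proj z0"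
    by (auto simp: algebra_simps)
  define w1 where "w1 t = cot_proj (flow t z1)" for t
  have "w1 \<in> periodic_orbits_in \<tau> h \<sigma> V"
    unfolding periodic_orbits_in_def periodic_orbits_def
  proof (intro CollectI conjI allI)
    show "w1 (t + \<tau>) = w1 t" for t
      unfolding w1_def flow_periodic_orbit[OF z1(1) assms(5)] by (simp add: cot_proj_def torus_proj_add_lattice assms(5))
    show "smooth_curve w1"
      unfolding smooth_curve_def w1_def using flow_smooth[of z1] by blast
    show "integral_curve \<sigma> V w1"
      unfolding w1_def[abs_def] by (rule integral_curve_cot_proj_flow)
    show "represents \<tau> h w1"
      unfolding w1_def[abs_def] by (rule represents_lift[OF fc _ assms(5) tau]) (simp add: z1(1) flow_0)
  qed
  \<comment> \<open>The initial points differ in the cotangent bundle itself, so \<open>w1\<close>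
    is not another lift of \<open>w\<close>.\<close>
  moreover have "w1 0 \<noteq> w 0" using z1(2) z0 by (simp add: w1_def flow_0)
  then have "w1 \<noteq> w" by auto
  ultimately have "card {w, w1} = 2" "{w, w1} \<subseteq> periodic_orbits_in \<tau> h \<sigma> V" using assms(7) by auto
  then show ?thesis by (metis card_mono)
qed

end
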